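(* Let $\mathbb G$ be a Carnot group of homogeneous dimension $Q$ endowed with an arbitrary left-invariant homogeneous distance, let $1\le h\le Q$ be an integer, and let $\phi$ be a $\mathscr P_h$-rectifiable measure on $\mathbb G$. Then $\mathbb G$ can be covered $\phi$-almost everywhere with countably many compact sets with the cone property with arbitrarily small opening: for every $\alpha>0$ there are homogeneous subgroups $\mathbb V_i$ of $\mathbb G$ of Hausdorff dimension $h$ and compact $C_{\mathbb V_i}(\alpha)$-sets $\Gamma_i$, $i\in\mathbb N$, such that $$\phi\Big(\mathbb G\setminus\bigcup_{i=1}^{+\infty}\Gamma_i\Big)=0.$$
   Context: A Carnot group $\mathbb G$ of step $\kappa$ is a simply connected Lie group whose Lie algebra has a stratification $\mathfrak g=V_1\oplus\dots\oplus V_\kappa$ with $[V_1,V_i]=V_{i+1}$ for $1\le i\le\kappa-1$, $[V_1,V_\kappa]=\{0\}$, $V_\kappa\ne\{0\}$. Via the exponential map $\mathbb G$ is identified with $\mathbb R^n$ (with identity $0$); the dilations $\delta_\lambda$ ($\lambda>0$), acting as multiplication by $\lambda^i$ on $V_i$, are group automorphisms. $Q=\sum_i i\dim V_i$. A homogeneous left-invariant distance satisfies $d(zx,zy)=d(x,y)$ and $d(\delta_\lambda x,\delta_\lambda y)=\lambda d(x,y)$; $\|x\|=d(x,0)$; $B(x,r)$ is the closed ball. A homogeneous subgroup is a Lie subgroup invariant under all $\delta_\lambda$. $Gr(h)$ is the set of homogeneous subgroups of Hausdorff dimension $h$ with respect to $d$. For $\mathbb V\in Gr(h)$ and $\alpha>0$,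 $C_{\mathbb V}(\alpha)=\{w\in\mathbb G:\operatorname{dist}(w,\mathbb V)\le\alpha\|w\|\}$. A set $E\subseteq\mathbb G$ is a $C_{\mathbb V}(\alpha)$-set if $E\subseteq p\cdot C_{\mathbb V}(\alpha)$ for every $p\in E$. $\mathcal S^h(A)=\sup_{\delta>0}\inf\{\sum_j r_j^h: A\subseteq\bigcup_j B(x_j,r_j),\ r_j\le\delta\}$. For a Radon measure $\phi$ on $\mathbb G$: $\Theta^h_*(\phi,x)=\liminf_{r\to0}\phi(B(x,r))/r^h$, $\Theta^{h,*}(\phi,x)=\limsup_{r\to0}\phi(B(x,r))/r^h$; $T_{x,r}\phi(E)=\phi(x\cdot\delta_r(E))$; $\mathrm{Tan}_h(\phi,x)$ is the set of Radon measures $\nu$ for which there is $r_i\to0^+$ with $r_i^{-h}T_{x,r_i}\phi\rightharpoonup\nu$ (weak convergence against $C_c(\mathbb G)$). A Radon measure $\phi$ is $\mathscr P_h$-rectifiable if for $\phi$-a.e. $x$: (i) $0<\Theta^h_*(\phi,x)\le\Theta^{h,*}(\phi,x)<+\infty$; (ii) there is $\mathbb V(x)\in Gr(h)$ with $\mathrm{Tan}_h(\phi,x)\subseteq\{\lambda\mathcal S^h\llcorner\mathbb V(x):\lambda\ge0\}$. *)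

theory Defs
  imports "HOL-Analysis.Analysis" "HOL-Algebra.Coset"
begin

section \<open>Smooth maps and embedded submanifolds\<close>

text \<open>Only used on open sets: there, existence of all iterated directional derivatives of a
  Frechet differentiable map together with their continuity is being of class C^k.\<close>

primrec Ck_on :: "nat \<Rightarrow> ('a::euclidean_space \<Rightarrow> 'b::euclidean_space) \<Rightarrow> 'a set \<Rightarrow> bool" where
  "Ck_on 0 f S \<longleftrightarrow> continuous_on S f"
| "Ck_on (Suc k) f S \<longleftrightarrow>
     (\<exists>f'. (\<forall>x\<in>S. (f has_derivative f' x) (at x)) \<and> (\<forall>v. Ck_on k (\<lambda>x. f' x v) S))"

definition smooth_on :: "('a::euclidean_space \<Rightarrow> 'b::euclidean_space) \<Rightarrow> 'a set \<Rightarrow> bool" where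
  "smooth_on f S \<longleftrightarrow> (\<forall>k. Ck_on k f S)"

definition embedded_submanifold :: "'a::euclidean_space set \<Rightarrow> bool" where
  "embedded_submanifold S \<longleftrightarrow>
     (\<exists>k::nat. \<forall>p\<in>S. \<exists>U W \<psi> g T.
        open U \<and> p \<in> U \<and> open W \<and> homeomorphism U W \<psi> g \<and> smooth_on \<psi> U \<and> smooth_on g W \<and>
        subspace (T :: 'a set) \<and> dim T = k \<and> \<psi> ` (S \<inter> U) = T \<inter> W)"


section \<open>Carnot groups in exponential coordinates\<close>

text \<open>For a Lie group structure \<open>G\<close> on the vector space \<open>'a\<close> with identity 0, the Lie algebra is
  the tangent space \<open>'a\<close> at 0, each vector \<open>v\<close> being identified with the left-invariant vector
  field whose value at 0 is \<open>v\<close>.\<close>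

definition left_inv_field :: "'a::euclidean_space monoid \<Rightarrow> 'a \<Rightarrow> 'a \<Rightarrow> 'a" where
  "left_inv_field G v p = frechet_derivative (\<lambda>q. p \<otimes>\<^bsub>G\<^esub> q) (at 0) v"

definition vf_bracket :: "('a::euclidean_space \<Rightarrow> 'a) \<Rightarrow> ('a \<Rightarrow> 'a) \<Rightarrow> 'a \<Rightarrow> 'a" where
  "vf_bracket X Y p = frechet_derivative Y (at p) (X p) - frechet_derivative X (at p) (Y p)"

definition lie_bracket :: "'a::euclidean_space monoid \<Rightarrow> 'a \<Rightarrow> 'a \<Rightarrow> 'a" where
  "lie_bracket G u v = vf_bracket (left_inv_field G u) (left_inv_field G v) 0"

definition bracket_span :: "'a::euclidean_space monoid \<Rightarrow> 'a set \<Rightarrow> 'a set \<Rightarrow> 'a set" where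
  "bracket_span G A B = span {lie_bracket G u v | u v. u \<in> A \<and> v \<in> B}"

text \<open>The underlying manifold is \<open>'a\<close> (hence simply connected). Assumption \<open>exp_coords\<close> says that
  the one-parameter subgroup with initial velocity \<open>v\<close> is \<open>t \<mapsto> t v\<close>, that is, the exponential
  map is the identity.\<close>

locale carnot_group = group G
  for G :: "'a::euclidean_space monoid" and \<kappa> :: nat and V :: "nat \<Rightarrow> 'a set" +
  assumes carrier_UNIV: "carrier G = UNIV"
    and one_zero: "\<one>\<^bsub>G\<^esub> = 0"
    and smooth_mult: "smooth_on (\<lambda>(x, y). x \<otimes>\<^bsub>G\<^esub> y) UNIV"
    and smooth_inv: "smooth_on (\<lambda>x. inv\<^bsub>G\<^esub> x) UNIV"
    and exp_coords: "(s *\<^sub>R v) \<otimes>\<^bsub>G\<^esub> (t *\<^sub>R v) = (s + t) *\<^sub>R v"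
    and step_pos: "1 \<le> \<kappa>"
    and layer_subspace: "i \<in> {1..\<kappa>} \<Longrightarrow> subspace (V i)"
    and direct_sum: "\<exists>!f. f \<in> (\<Pi>\<^sub>E i\<in>{1..\<kappa>}. V i) \<and> x = (\<Sum>i=1..\<kappa>. f i)"
    and bracket_layer: "i \<in> {1..<\<kappa>} \<Longrightarrow> bracket_span G (V 1) (V i) = V (i + 1)"
    and bracket_last: "bracket_span G (V 1) (V \<kappa>) = {0}"
    and last_layer: "V \<kappa> \<noteq> {0}"

definition layer_proj :: "nat \<Rightarrow> (nat \<Rightarrow> 'a::euclidean_space set) \<Rightarrow> 'a \<Rightarrow> nat \<Rightarrow> 'a" where
  "layer_proj \<kappa> V x = (THE f. f \<in> (\<Pi>\<^sub>E i\<in>{1..\<kappa>}. V i) \<and> x = (\<Sum>i=1..\<kappa>. f i))"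

definition dilation :: "nat \<Rightarrow> (nat \<Rightarrow> 'a::euclidean_space set) \<Rightarrow> real \<Rightarrow> 'a \<Rightarrow> 'a" where
  "dilation \<kappa> V r x = (\<Sum>i=1..\<kappa>. r ^ i *\<^sub>R layer_proj \<kappa> V x i)"

definition homogeneous_dim :: "nat \<Rightarrow> (nat \<Rightarrow> 'a::euclidean_space set) \<Rightarrow> nat" where
  "homogeneous_dim \<kappa> V = (\<Sum>i=1..\<kappa>. i * dim (V i))"

text \<open>The topology of \<open>d\<close> is not assumed to be the Euclidean one. ``Open'', ``compact'' and
  ``Borel'' always refer to the manifold topology of \<open>'a\<close>.\<close>

locale homogeneous_distance = carnot_group G \<kappa> V + Metric_space UNIV d
  for G :: "'a::euclidean_space monoid" and \<kappa> :: nat and V :: "nat \<Rightarrow> 'a set"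
    and d :: "'a \<Rightarrow> 'a \<Rightarrow> real" +
  assumes left_invariant: "d (z \<otimes>\<^bsub>G\<^esub> x) (z \<otimes>\<^bsub>G\<^esub> y) = d x y"
    and homogeneous: "0 < r \<Longrightarrow> d (dilation \<kappa> V r x) (dilation \<kappa> V r y) = r * d x y"

definition lie_subgroup :: "'a::euclidean_space monoid \<Rightarrow> 'a set \<Rightarrow> bool" where
  "lie_subgroup G H \<longleftrightarrow> subgroup H G \<and> embedded_submanifold H"

definition homogeneous_subgroup ::
    "'a::euclidean_space monoid \<Rightarrow> nat \<Rightarrow> (nat \<Rightarrow> 'a set) \<Rightarrow> 'a set \<Rightarrow> bool" where
  "homogeneous_subgroup G \<kappa> V H \<longleftrightarrow>
     lie_subgroup G H \<and> (\<forall>r>0. dilation \<kappa> V r ` H \<subseteq> H)"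


section \<open>Hausdorff dimension and spherical measure\<close>

abbreviation cl_ball :: "('a \<Rightarrow> 'a \<Rightarrow> real) \<Rightarrow> 'a \<Rightarrow> real \<Rightarrow> 'a set" where
  "cl_ball d \<equiv> Metric_space.mcball UNIV d"

definition diameter_wrt :: "('a \<Rightarrow> 'a \<Rightarrow> real) \<Rightarrow> 'a set \<Rightarrow> ennreal" where
  "diameter_wrt d E = (SUP x\<in>E. SUP y\<in>E. ennreal (d x y))"

definition hausdorff_measure :: "('a \<Rightarrow> 'a \<Rightarrow> real) \<Rightarrow> real \<Rightarrow> 'a set \<Rightarrow> ennreal" where
  "hausdorff_measure d s A =
     (SUP \<delta>\<in>{0<..}. INF E\<in>{E :: nat \<Rightarrow> 'a set. A \<subseteq> (\<Union>j. E j) \<and> (\<forall>j. diameter_wrt d (E j) \<le> ennreal \<delta>)}.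
        \<Sum>j. ennreal (enn2real (diameter_wrt d (E j)) powr s))"

text \<open>Exponents \<open>s = 0\<close> are left out, which does not change the infimum and avoids fixing a
  convention for \<open>0 powr 0\<close>.\<close>

definition hausdorff_dim :: "('a \<Rightarrow> 'a \<Rightarrow> real) \<Rightarrow> 'a set \<Rightarrow> ennreal" where
  "hausdorff_dim d A = (INF s\<in>{s. 0 < s \<and> hausdorff_measure d s A = 0}. ennreal s)"

definition spherical_measure :: "('a \<Rightarrow> 'a \<Rightarrow> real) \<Rightarrow> nat \<Rightarrow> 'a set \<Rightarrow> ennreal" where
  "spherical_measure d h A =
     (SUP \<delta>\<in>{0<..}. INF (x, r)\<in>{(x :: nat \<Rightarrow> 'a, r :: nat \<Rightarrow> real).
          A \<subseteq> (\<Union>j. cl_ball d (x j) (r j)) \<and> (\<forall>j. 0 < r j \<and> r j \<le> \<delta>)}.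
        \<Sum>j. ennreal (r j ^ h))"

definition Gr :: "'a::euclidean_space monoid \<Rightarrow> nat \<Rightarrow> (nat \<Rightarrow> 'a set) \<Rightarrow> ('a \<Rightarrow> 'a \<Rightarrow> real)
    \<Rightarrow> nat \<Rightarrow> 'a set set" where
  "Gr G \<kappa> V d h = {H. homogeneous_subgroup G \<kappa> V H \<and> hausdorff_dim d H = of_nat h}"


section \<open>Cones\<close>

definition cone_around :: "('a::euclidean_space \<Rightarrow> 'a \<Rightarrow> real) \<Rightarrow> 'a set \<Rightarrow> real \<Rightarrow> 'a set" where
  "cone_around d H \<alpha> = {w. (INF v\<in>H. d w v) \<le> \<alpha> * d w 0}"

definition cone_set :: "'a::euclidean_space monoid \<Rightarrow> ('a \<Rightarrow> 'a \<Rightarrow> real) \<Rightarrow> 'a set \<Rightarrow> real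
    \<Rightarrow> 'a set \<Rightarrow> bool" where
  "cone_set G d H \<alpha> E \<longleftrightarrow> (\<forall>p\<in>E. E \<subseteq> p <#\<^bsub>G\<^esub> cone_around d H \<alpha>)"


section \<open>Densities, tangent measures and rectifiability\<close>

text \<open>On a Euclidean space a Borel measure that is finite on compact sets is automatically
  inner and outer regular.\<close>

definition radon_measure :: "'a::euclidean_space measure \<Rightarrow> bool" where
  "radon_measure \<mu> \<longleftrightarrow> sets \<mu> = sets borel \<and> (\<forall>K. compact K \<longrightarrow> emeasure \<mu> K < \<infinity>)"

definition lower_density :: "('a::euclidean_space \<Rightarrow> 'a \<Rightarrow> real) \<Rightarrow> nat \<Rightarrow> 'a measure \<Rightarrow> 'a
    \<Rightarrow> ennreal" where
  "lower_density d h \<phi> x =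
     Liminf (at_right 0) (\<lambda>r. emeasure \<phi> (cl_ball d x r) / ennreal (r ^ h))"

definition upper_density :: "('a::euclidean_space \<Rightarrow> 'a \<Rightarrow> real) \<Rightarrow> nat \<Rightarrow> 'a measure \<Rightarrow> 'a
    \<Rightarrow> ennreal" where
  "upper_density d h \<phi> x =
     Limsup (at_right 0) (\<lambda>r. emeasure \<phi> (cl_ball d x r) / ennreal (r ^ h))"

text \<open>The preimage of \<open>E\<close> under \<open>y \<mapsto> \<delta>\<^bsub>1/r\<^esub>(x\<^sup>-\<^sup>1 y)\<close> is \<open>x \<cdot> \<delta>\<^bsub>r\<^esub>(E)\<close>.\<close>

definition blow_up :: "'a::euclidean_space monoid \<Rightarrow> nat \<Rightarrow> (nat \<Rightarrow> 'a set) \<Rightarrow> 'a measure \<Rightarrow> 'a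
    \<Rightarrow> real \<Rightarrow> 'a measure" where
  "blow_up G \<kappa> V \<phi> x r = distr \<phi> borel (\<lambda>y. dilation \<kappa> V (1 / r) (inv\<^bsub>G\<^esub> x \<otimes>\<^bsub>G\<^esub> y))"

definition weak_conv_Cc :: "(nat \<Rightarrow> 'a::euclidean_space measure) \<Rightarrow> 'a measure \<Rightarrow> bool" where
  "weak_conv_Cc \<mu> \<nu> \<longleftrightarrow>
     (\<forall>f :: 'a \<Rightarrow> real. continuous_on UNIV f \<and> compact (closure {x. f x \<noteq> 0}) \<longrightarrow>
        (\<lambda>i. \<integral>x. f x \<partial>\<mu> i) \<longlonglongrightarrow> (\<integral>x. f x \<partial>\<nu>))"

definition tangent_measures :: "'a::euclidean_space monoid \<Rightarrow> nat \<Rightarrow> (nat \<Rightarrow> 'a set) \<Rightarrow> nat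
    \<Rightarrow> 'a measure \<Rightarrow> 'a \<Rightarrow> 'a measure set" where
  "tangent_measures G \<kappa> V h \<phi> x =
     {\<nu>. radon_measure \<nu> \<and>
        (\<exists>r :: nat \<Rightarrow> real. (\<forall>i. 0 < r i) \<and> r \<longlonglongrightarrow> 0 \<and>
           weak_conv_Cc (\<lambda>i. scale_measure (ennreal (1 / r i ^ h)) (blow_up G \<kappa> V \<phi> x (r i))) \<nu>)}"

text \<open>Nonnegative multiples of the restriction of the \<open>h\<close>-dimensional spherical measure to \<open>H\<close>, given
  by their values because the spherical measure is an outer measure defined on all sets.\<close>

definition flat_measures :: "('a::euclidean_space \<Rightarrow> 'a \<Rightarrow> real) \<Rightarrow> nat \<Rightarrow> 'a set
    \<Rightarrow> 'a measure set" where
  "flat_measures d h H =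
     {\<nu>. sets \<nu> = sets borel \<and>
        (\<exists>c\<ge>0. \<forall>A\<in>sets borel. emeasure \<nu> A = ennreal c * spherical_measure d h (A \<inter> H))}"

definition P_rectifiable :: "'a::euclidean_space monoid \<Rightarrow> nat \<Rightarrow> (nat \<Rightarrow> 'a set)
    \<Rightarrow> ('a \<Rightarrow> 'a \<Rightarrow> real) \<Rightarrow> nat \<Rightarrow> 'a measure \<Rightarrow> bool" where
  "P_rectifiable G \<kappa> V d h \<phi> \<longleftrightarrow>
     radon_measure \<phi> \<and>
     (AE x in \<phi>.
        (0 < lower_density d h \<phi> x \<and> lower_density d h \<phi> x \<le> upper_density d h \<phi> x \<and>
         upper_density d h \<phi> x < \<infinity>) \<and>
        (\<exists>H\<in>Gr G \<kappa> V d h. tangent_measures G \<kappa> V h \<phi> x \<subseteq> flat_measures d h H))"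

end

theory Submission
  imports Defs "HOL-Library.Diagonal_Subsequence"
begin

text \<open>A point x where the tangent measures are flat along H has, by compactness of its blow-ups,
  vanishing density off every cone around \<open>x \<cdot> H\<close>. If another such point y left this cone, a ball around
  y of radius comparable to \<open>d x y\<close> would lie where almost no mass is, against the positive lower
  density at y. So the points at which these statements hold with fixed constants form, locally, cone
  sets. The cone condition is closed, hence closures may be taken and no measurability is involved;
  compactness of balls reduces the planes H to finitely many.

  None of this uses that the dilations are automorphisms. Group structure enters only for the null
  measure, for which the claim still asserts that there is a homogeneous subgroup of each dimension
  \<open>h \<in> {1..Q}\<close>. Writing \<open>h = j + k a + \<Sum>i>k. i dim (V i)\<close> with \<open>0 \<le> j < k\<close>, one takes a line in \<open>V j\<close>, an
  a-dimensional subspace of \<open>V k\<close> and all higher layers.\<close>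

section \<open>The topology of a homogeneous distance\<close>

text \<open>\<open>d\<close> comes with no relation to the topology of \<open>'a\<close>, while
  Radon measures, compactness and weak convergence live in that topology. Left-invariance and
  homogeneity force \<open>d\<close> to be continuous and proper, and everything else rests on this.
  A cone set belongs to one subgroup, whereas the tangent plane \<open>H\<close> varies with the
  point, possibly over uncountably many values. Passing to a nearby \<open>W\<close> from a finite
  list costs opening: mass is small off opening \<alpha>/8 around \<open>H\<close>, hence off
  \<alpha>/2 around \<open>W\<close>, and balls of radius \<alpha>/2 times the distance of two
  points then give opening \<alpha>. For the subgroups, a first-order substitute of the
  Baker-Campbell-Hausdorff formula suffices: adding \<open>v\<close> from the layers of index at
  least k to a factor adds \<open>v\<close> to the product, up to layers of index above k. A line in
  a lower layer is harmless because its multiples form a one-parameter subgroup, whatever its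
  brackets with the rest. The dimension of such a subgroup is found by counting lattice points
  instead of by an invariant measure, using that dilations are linear and left translations locally
  Lipschitz.\<close>

lemma smooth_on_has_derivative:
  assumes "smooth_on f UNIV"
  shows "(f has_derivative frechet_derivative f (at x)) (at x)"
proof -
  have "Ck_on (Suc 0) f UNIV"
    using assms by (simp only: smooth_on_def)
  then show ?thesis
    by (metis Ck_on.simps(2) UNIV_I differentiableI frechet_derivative_works)
qed

lemma smooth_on_frechet_derivative:
  assumes "smooth_on f UNIV"
  shows "smooth_on (\<lambda>x. frechet_derivative f (at x) v) UNIV"
  unfolding smooth_on_def
proof
  fix k
  have "Ck_on (Suc k) f UNIV"
    using assms by (simp only: smooth_on_def)
  then obtain f' where f': "\<And>x. (f has_derivative f' x) (at x)" "Ck_on k (\<lambda>x. f' x v) UNIV"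
    by auto
  then have "f' x = frechet_derivative f (at x)" for x
    by (intro frechet_derivative_at)
  then show "Ck_on k (\<lambda>x. frechet_derivative f (at x) v) UNIV"
    using f'(2) by simp
qed

lemma smooth_on_continuous:
  assumes "smooth_on f S"
  shows "continuous_on S f"
proof -
  have "Ck_on 0 f S"
    using assms by (simp only: smooth_on_def)
  then show ?thesis
    by simp
qed

section \<open>The product and the dilations in exponential coordinates\<close>

context carnot_group
begin

abbreviation mul :: "'a \<Rightarrow> 'a \<Rightarrow> 'a" (infixl "\<cdot>" 70) where
  "x \<cdot> y \<equiv> x \<otimes>\<^bsub>G\<^esub> y"

lemma mul_assoc: "(x \<cdot> y) \<cdot> z = x \<cdot> (y \<cdot> z)"
  using m_assoc by (simp add: carrier_UNIV)

lemma zero_mul [simp]: "0 \<cdot> x = x" and mul_zero [simp]: "x \<cdot> 0 = x"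
  using l_one[of x] r_one[of x] by (simp_all add: carrier_UNIV one_zero)

lemma mul_minus [simp]: "x \<cdot> (- x) = 0" and minus_mul [simp]: "(- x) \<cdot> x = 0"
  using exp_coords[of 1 x "-1"] exp_coords[of "-1" x 1] by simp_all

lemma minus_mul_cancel [simp]: "(- x) \<cdot> (x \<cdot> y) = y" "x \<cdot> (- x \<cdot> y) = y"
  by (simp_all add: mul_assoc[symmetric])

lemma inv_eq_minus: "inv\<^bsub>G\<^esub> x = - x"
  by (rule inv_equality) (simp_all add: carrier_UNIV one_zero)

lemma minus_mul_distrib: "- (x \<cdot> y) = (- y) \<cdot> (- x)"
  using inv_mult_group[of x y] by (simp add: carrier_UNIV inv_eq_minus)

definition mul_deriv :: "'a \<times> 'a \<Rightarrow> 'a \<times> 'a \<Rightarrow> 'a" where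
  "mul_deriv z = frechet_derivative (\<lambda>(x, y). x \<cdot> y) (at z)"

lemma mul_has_derivative: "((\<lambda>(x, y). x \<cdot> y) has_derivative mul_deriv z) (at z)"
  unfolding mul_deriv_def using smooth_mult by (rule smooth_on_has_derivative)

lemma has_derivative_mul [derivative_intros]:
  assumes "(f has_derivative f') (at x within S)" "(g has_derivative g') (at x within S)"
  shows "((\<lambda>t. f t \<cdot> g t) has_derivative (\<lambda>h. mul_deriv (f x, g x) (f' h, g' h))) (at x within S)"
  using has_derivative_compose[OF has_derivative_Pair[OF assms] mul_has_derivative] by simp

lemma linear_mul_deriv: "linear (mul_deriv z)"
  using mul_has_derivative has_derivative_linear by blast

lemma continuous_mul_deriv: "continuous_on UNIV (\<lambda>z. mul_deriv z v)"
  unfolding mul_deriv_def using smooth_on_frechet_derivative[OF smooth_mult] by (rule smooth_on_continuous)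

lemma continuous_on_mul [continuous_intros]:
  assumes "continuous_on S f" "continuous_on S g"
  shows "continuous_on S (\<lambda>x. f x \<cdot> g x)"
  using continuous_on_compose2[OF smooth_on_continuous[OF smooth_mult] continuous_on_Pair[OF assms]] by simp

lemma mul_deriv_left: "mul_deriv (0, q) (0, v) = v"
proof -
  have "((\<lambda>t. 0 \<cdot> t) has_derivative (\<lambda>h. mul_deriv (0, q) (0, h))) (at q)"
    using has_derivative_mul[of "\<lambda>t. 0" "\<lambda>h. 0" q UNIV "\<lambda>t. t" "\<lambda>h. h"] by simp
  then have "(\<lambda>h. mul_deriv (0, q) (0, h)) = (\<lambda>h. h)"
    by (simp add: has_derivative_unique[OF _ has_derivative_ident])
  then show ?thesis
    by meson
qed

lemma mul_deriv_right: "mul_deriv (p, 0) (v, 0) = v"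
proof -
  have "((\<lambda>t. t \<cdot> 0) has_derivative (\<lambda>h. mul_deriv (p, 0) (h, 0))) (at p)"
    using has_derivative_mul[of "\<lambda>t. t" "\<lambda>h. h" p UNIV "\<lambda>t. 0" "\<lambda>h. 0"] by simp
  then have "(\<lambda>h. mul_deriv (p, 0) (h, 0)) = (\<lambda>h. h)"
    by (simp add: has_derivative_unique[OF _ has_derivative_ident])
  then show ?thesis
    by meson
qed

lemma mul_deriv_zero: "mul_deriv (0, 0) (u, v) = u + v"
proof -
  have "mul_deriv (0, 0) (u, v) = mul_deriv (0, 0) ((u, 0) + (0, v))"
    by simp
  also have "\<dots> = u + v"
    unfolding linear_add[OF linear_mul_deriv] mul_deriv_left mul_deriv_right ..
  finally show ?thesis .
qed

abbreviation proj :: "nat \<Rightarrow> 'a \<Rightarrow> 'a" where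
  "proj i x \<equiv> layer_proj \<kappa> V x i"

abbreviation dil :: "real \<Rightarrow> 'a \<Rightarrow> 'a" where
  "dil \<equiv> dilation \<kappa> V"

lemma layer_proj_props:
  "layer_proj \<kappa> V x \<in> (\<Pi>\<^sub>E i\<in>{1..\<kappa>}. V i)" "x = (\<Sum>i=1..\<kappa>. proj i x)"
  unfolding layer_proj_def using theI'[OF direct_sum[of x]] by blast+

lemma proj_mem: "i \<in> {1..\<kappa>} \<Longrightarrow> proj i x \<in> V i"
  using layer_proj_props(1)[of x] by auto

lemma proj_sum: "(\<Sum>i=1..\<kappa>. proj i x) = x"
  using layer_proj_props(2)[of x] by simp

lemma proj_eqI:
  assumes "\<And>i. i \<in> {1..\<kappa>} \<Longrightarrow> f i \<in> V i" "x = (\<Sum>i=1..\<kappa>. f i)" "j \<in> {1..\<kappa>}"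
  shows "proj j x = f j"
proof -
  \<comment> \<open>Uniqueness in \<open>direct_sum\<close> holds among functions of the extensional
    product, so \<open>f\<close> is made \<open>undefined\<close> off \<open>{1..\<kappa>}\<close>
    before the comparison.\<close>
  let ?f = "restrict f {1..\<kappa>}"
  have "?f \<in> (\<Pi>\<^sub>E i\<in>{1..\<kappa>}. V i) \<and> x = (\<Sum>i=1..\<kappa>. ?f i)"
    using assms(1,2) by auto
  then have "layer_proj \<kappa> V x = ?f"
    using direct_sum[of x] layer_proj_props[of x] by blast
  then show ?thesis
    using assms(3) by simp
qed

lemma linear_proj:
  assumes "i \<in> {1..\<kappa>}"
  shows "linear (proj i)"
proof (rule linearI)
  show "proj i (x + y) = proj i x + proj i y" for x y
    using assms proj_mem layer_subspace proj_sum
    by (intro proj_eqI[where f = "\<lambda>i. proj i x + proj i y"]) (auto simp: sum.distrib subspace_add)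
  show "proj i (c *\<^sub>R x) = c *\<^sub>R proj i x" for c x
    using assms proj_mem layer_subspace proj_sum
    by (intro proj_eqI[where f = "\<lambda>i. c *\<^sub>R proj i x"]) (auto simp: scaleR_sum_right[symmetric] subspace_scale)
qed

lemma proj_layer:
  assumes "v \<in> V i" "i \<in> {1..\<kappa>}" "j \<in> {1..\<kappa>}"
  shows "proj j v = (if j = i then v else 0)"
  using assms layer_subspace
  by (intro proj_eqI[where f = "\<lambda>j. if j = i then v else 0"]) (auto simp: subspace_0)

lemma proj_dil:
  assumes "i \<in> {1..\<kappa>}"
  shows "proj i (dil r x) = r ^ i *\<^sub>R proj i x"
  using assms proj_mem layer_subspace
  by (intro proj_eqI[where f = "\<lambda>i. r ^ i *\<^sub>R proj i x"]) (auto simp: dilation_def subspace_scale)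

lemma linear_dil: "linear (dil r)"
proof (rule linearI)
  show "dil r (x + y) = dil r x + dil r y" for x y
    by (simp add: dilation_def linear_add[OF linear_proj] scaleR_add_right sum.distrib)
  show "dil r (c *\<^sub>R x) = c *\<^sub>R dil r x" for c x
    unfolding dilation_def scaleR_sum_right
    by (intro sum.cong refl) (simp add: linear_scale[OF linear_proj])
qed

lemma dil_layer:
  assumes "v \<in> V i" "i \<in> {1..\<kappa>}"
  shows "dil r v = r ^ i *\<^sub>R v"
proof -
  have "dil r v = (\<Sum>j=1..\<kappa>. if j = i then r ^ i *\<^sub>R v else 0)"
    unfolding dilation_def using assms by (intro sum.cong) (auto simp: proj_layer)
  then show ?thesis
    using assms(2) by simp
qed

lemma dil_dil: "dil r (dil s x) = dil (r * s) x"
  unfolding dilation_def[of \<kappa> V r] dilation_def[of \<kappa> V "r * s"]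
  by (intro sum.cong refl) (simp add: proj_dil power_mult_distrib)

lemma dil_one [simp]: "dil 1 x = x"
  unfolding dilation_def power_one scaleR_one by (rule proj_sum)

lemma dil_zero [simp]: "dil 0 x = 0" "dil r 0 = 0"
  unfolding dilation_def by (auto intro!: sum.neutral simp: linear_0[OF linear_proj])

lemma continuous_on_dil [continuous_intros]:
  assumes "continuous_on S r" "continuous_on S f"
  shows "continuous_on S (\<lambda>x. dil (r x) (f x))"
proof -
  have "continuous_on S (\<lambda>x. proj i (f x))" if "i \<in> {1..\<kappa>}" for i
    using continuous_on_compose2[OF linear_continuous_on assms(2), of "proj i" UNIV]
      linear_proj[OF that] by (simp add: linear_conv_bounded_linear)
  then show ?thesis
    unfolding dilation_def by (intro continuous_intros assms) auto
qed

text \<open>Every \<open>r ^ i\<close> with \<open>i \<le> \<kappa>\<close> is at most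
  \<open>r ^ \<kappa>\<close> when \<open>r \<ge> 1\<close>. The exponent is crude, but it is enough
  to turn homogeneity of \<open>d\<close> into comparisons with the Euclidean norm.\<close>

lemma dil_norm_bound:
  obtains C where "0 < C" "\<And>r x. 1 \<le> r \<Longrightarrow> norm (dil r x) \<le> C * r ^ \<kappa> * norm x"
proof -
  have "\<exists>K>0. \<forall>x. norm (proj i x) \<le> K * norm x" if "i \<in> {1..\<kappa>}" for i
    using linear_bounded_pos[OF linear_proj[OF that]] by blast
  then obtain K where K: "\<And>i. i \<in> {1..\<kappa>} \<Longrightarrow> 0 < K i \<and> (\<forall>x. norm (proj i x) \<le> K i * norm x)"
    by metis
  show ?thesis
  proof
    show "0 < (\<Sum>i=1..\<kappa>. K i)"
      using K step_pos by (intro sum_pos) auto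
    fix r :: real and x :: 'a assume r: "1 \<le> r"
    have "norm (dil r x) \<le> (\<Sum>i=1..\<kappa>. norm (r ^ i *\<^sub>R proj i x))"
      unfolding dilation_def by (rule norm_sum)
    also have "\<dots> \<le> (\<Sum>i=1..\<kappa>. r ^ \<kappa> * (K i * norm x))"
      using K r by (intro sum_mono) (auto intro!: mult_mono power_increasing)
    also have "\<dots> = (\<Sum>i=1..\<kappa>. K i) * r ^ \<kappa> * norm x"
      by (simp add: sum_distrib_left sum_distrib_right mult_ac)
    finally show "norm (dil r x) \<le> (\<Sum>i=1..\<kappa>. K i) * r ^ \<kappa> * norm x" .
  qed
qed

text \<open>Coordinates of the second kind: their derivative at 0 is the identity, so their image is a
  neighbourhood of 0.\<close>

primrec coord_prod :: "('a \<times> nat) list \<Rightarrow> 'a \<Rightarrow> 'a" where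
  "coord_prod [] x = 0"
| "coord_prod (b # L) x = ((x \<bullet> fst b) *\<^sub>R proj (snd b) (fst b)) \<cdot> coord_prod L x"

lemma continuous_on_coord_prod: "continuous_on UNIV (coord_prod L)"
proof (induction L)
  case Nil
  then show ?case
    by (simp add: fun_eq_iff[THEN iffD2, of "coord_prod []" "\<lambda>x. 0"])
next
  case (Cons b L)
  have "coord_prod (b # L) = (\<lambda>x. ((x \<bullet> fst b) *\<^sub>R proj (snd b) (fst b)) \<cdot> coord_prod L x)"
    by auto
  then show ?case
    using Cons by (auto intro!: continuous_intros)
qed

text \<open>The value at 0 is carried through the induction because the derivative of the product is
  plain addition at the pair \<open>(0, 0)\<close>.\<close>

lemma coord_prod_has_derivative:
  "coord_prod L 0 = 0 \<and>
   (coord_prod L has_derivative (\<lambda>x. \<Sum>b\<leftarrow>L. (x \<bullet> fst b) *\<^sub>R proj (snd b) (fst b))) (at 0)"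
proof (induction L)
  case Nil
  then show ?case
    by (simp add: fun_eq_iff[THEN iffD2, of "coord_prod []" "\<lambda>x. 0"])
next
  case (Cons b L)
  have eq: "coord_prod (b # L) = (\<lambda>x. ((x \<bullet> fst b) *\<^sub>R proj (snd b) (fst b)) \<cdot> coord_prod L x)"
    by auto
  have "((\<lambda>x. (x \<bullet> fst b) *\<^sub>R proj (snd b) (fst b)) has_derivative
      (\<lambda>x. (x \<bullet> fst b) *\<^sub>R proj (snd b) (fst b))) (at 0)"
    by (auto intro!: derivative_eq_intros)
  from has_derivative_mul[OF this Cons[THEN conjunct2]] Cons[THEN conjunct1] show ?case
    unfolding eq by (simp add: mul_deriv_zero)
qed

lemma coord_prod_nbhd:
  obtains L where "set L = Basis \<times> {1..\<kappa>}" "\<And>\<rho>. 0 < \<rho> \<Longrightarrow> 0 \<in> interior (coord_prod L ` ball 0 \<rho>)"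
proof -
  obtain L where L: "set L = (Basis :: 'a set) \<times> {1..\<kappa>}" "distinct L"
    using finite_distinct_list[of "(Basis :: 'a set) \<times> {1..\<kappa>}"] by auto
  have "(\<Sum>b\<leftarrow>L. (x \<bullet> fst b) *\<^sub>R proj (snd b) (fst b)) = x" for x
  proof -
    have "(\<Sum>b\<leftarrow>L. (x \<bullet> fst b) *\<^sub>R proj (snd b) (fst b))
        = (\<Sum>b\<in>Basis \<times> {1..\<kappa>}. (x \<bullet> fst b) *\<^sub>R proj (snd b) (fst b))"
      using L by (simp add: sum_list_distinct_conv_sum_set)
    also have "\<dots> = (\<Sum>e\<in>Basis. (x \<bullet> e) *\<^sub>R (\<Sum>i=1..\<kappa>. proj i e))"
      by (simp add: sum.cartesian_product' scaleR_sum_right split_def)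
    also have "\<dots> = x"
      by (simp only: proj_sum euclidean_representation)
    finally show ?thesis .
  qed
  then have der: "(coord_prod L has_derivative id) (at 0)"
    using coord_prod_has_derivative[of L] by (simp add: id_def)
  \<comment> \<open>Sussmann's open mapping theorem asks for continuity and for an invertible
    derivative at the single point 0, which is what has been established.\<close>
  have "0 \<in> interior (coord_prod L ` ball 0 \<rho>)" if "0 < \<rho>" for \<rho>
    using sussmann_open_mapping[OF open_UNIV continuous_on_coord_prod UNIV_I der bounded_linear_ident, of "ball 0 \<rho>"]
      that coord_prod_has_derivative[of L] by (auto simp: fun_eq_iff)
  with L(1) show ?thesis
    using that by blast
qed

end

section \<open>Continuity and properness of a homogeneous distance\<close>

context homogeneous_distance
begin

lemma d_translate: "d x y = d 0 (- x \<cdot> y)"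
  using left_invariant[of "- x" x y] by simp

lemma d_zero_mul: "d 0 (x \<cdot> y) \<le> d 0 x + d 0 y"
  using triangle[of 0 x "x \<cdot> y"] left_invariant[of x 0 y] by simp

lemma d_zero_minus [simp]: "d 0 (- x) = d 0 x"
  using left_invariant[of x "- x" 0] commute[of x 0] commute[of 0 "- x"] by simp

lemma d_dil: "0 < r \<Longrightarrow> d (dil r x) (dil r y) = r * d x y"
  by (rule homogeneous)

lemma d_zero_dil: "0 < r \<Longrightarrow> d 0 (dil r x) = r * d 0 x"
  using homogeneous[of r 0 x] by simp

text \<open>On \<open>V i\<close> the dilation by \<open>root i t\<close> is multiplication by
  \<open>t\<close>, so homogeneity determines \<open>d 0\<close> along a line. Negative
  \<open>t\<close> are covered since the group inverse is negation and leaves \<open>d 0\<close>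
  unchanged.\<close>

lemma d_layer:
  assumes "v \<in> V i" "i \<in> {1..\<kappa>}"
  shows "d 0 (t *\<^sub>R v) = root i \<bar>t\<bar> * d 0 v"
proof -
  have pos: "d 0 (t *\<^sub>R v) = root i t * d 0 v" if "0 < t" for t
    using d_zero_dil[of "root i t" v] dil_layer[OF assms, of "root i t"] that assms(2) by simp
  consider "t = 0" | "0 < t" | "0 < - t"
    by linarith
  then show ?thesis
  proof cases
    case 3
    then show ?thesis
      using pos[OF 3] d_zero_minus[of "(- t) *\<^sub>R v"] by simp
  qed (simp_all add: pos)
qed

lemma d_coord_prod:
  assumes "set L \<subseteq> Basis \<times> {1..\<kappa>}"
  shows "d 0 (coord_prod L x) \<le> (\<Sum>b\<leftarrow>L. root (snd b) \<bar>x \<bullet> fst b\<bar> * d 0 (proj (snd b) (fst b)))"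
  using assms
proof (induction L)
  case (Cons b L)
  have "snd b \<in> {1..\<kappa>}"
    using Cons.prems by auto
  then have "d 0 ((x \<bullet> fst b) *\<^sub>R proj (snd b) (fst b)) = root (snd b) \<bar>x \<bullet> fst b\<bar> * d 0 (proj (snd b) (fst b))"
    by (intro d_layer proj_mem) auto
  with Cons show ?case
    using d_zero_mul[of "(x \<bullet> fst b) *\<^sub>R proj (snd b) (fst b)" "coord_prod L x"] by simp
qed simp

text \<open>A point near 0 is a product of points on lines inside the layers, with small
  coefficients. Subadditivity of \<open>d 0\<close> and \<open>d_layer\<close> bound its distance by
  roots of these coefficients. This is the only place where smallness in norm is converted into
  smallness in \<open>d\<close>.\<close>

lemma d_small:
  assumes "0 < e"
  obtains \<delta> where "0 < \<delta>" "\<And>x. norm x < \<delta> \<Longrightarrow> d 0 x < e"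
proof -
  obtain L where L: "set L = Basis \<times> {1..\<kappa>}"
    and nb: "\<And>\<rho>. 0 < \<rho> \<Longrightarrow> 0 \<in> interior (coord_prod L ` ball 0 \<rho>)"
    using coord_prod_nbhd by blast
  define b where "b x = (\<Sum>b\<leftarrow>L. root (snd b) \<bar>x \<bullet> fst b\<bar> * d 0 (proj (snd b) (fst b)))" for x
  have cont: "continuous_on UNIV (\<lambda>x. \<Sum>b\<leftarrow>M. root (snd b) \<bar>x \<bullet> fst b\<bar> * d 0 (proj (snd b) (fst b)))" for M
    by (induction M) (auto intro!: continuous_intros)
  then have "continuous_on UNIV b"
    by (simp add: b_def)
  then have "(b \<longlongrightarrow> b 0) (at 0)"
    by (simp add: continuous_on_def)
  moreover have "(\<Sum>b\<leftarrow>M. root (snd b) \<bar>0 \<bullet> fst b\<bar> * d 0 (proj (snd b) (fst b))) = 0" for M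
    by (induction M) auto
  then have "b 0 = 0"
    by (simp add: b_def)
  ultimately obtain \<rho> where \<rho>: "0 < \<rho>" "\<And>x. x \<noteq> 0 \<Longrightarrow> dist x 0 < \<rho> \<Longrightarrow> dist (b x) 0 < e"
    using \<open>0 < e\<close> unfolding LIM_def by metis
  then have less: "b x < e" if "x \<in> ball 0 \<rho>" for x
    using that \<open>b 0 = 0\<close> \<open>0 < e\<close> by (cases "x = 0") (force simp: dist_real_def)+
  obtain \<delta> where \<delta>: "0 < \<delta>" "ball 0 \<delta> \<subseteq> coord_prod L ` ball 0 \<rho>"
    using nb[OF \<rho>(1)] by (auto simp: mem_interior)
  have "d 0 x < e" if "norm x < \<delta>" for x
  proof -
    obtain y where "y \<in> ball 0 \<rho>" "x = coord_prod L y"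
      using \<delta>(2) \<open>norm x < \<delta>\<close> by (auto simp: subset_iff image_iff)
    then show ?thesis
      using d_coord_prod[of L y] less[of y] L by (simp add: b_def)
  qed
  with \<delta>(1) show ?thesis
    by (rule that)
qed

lemma tendsto_d_zero:
  assumes "(f \<longlongrightarrow> 0) F"
  shows "((\<lambda>x. d 0 (f x)) \<longlongrightarrow> 0) F"
proof (rule tendstoI)
  fix e :: real assume "0 < e"
  then obtain \<delta> where \<delta>: "0 < \<delta>" "\<And>x. norm x < \<delta> \<Longrightarrow> d 0 x < e"
    by (rule d_small) blast
  have "\<forall>\<^sub>F x in F. dist (f x) 0 < \<delta>"
    using assms \<delta>(1) by (rule tendstoD)
  then show "\<forall>\<^sub>F x in F. dist (d 0 (f x)) 0 < e"
    by eventually_elim (use \<delta>(2) in \<open>auto simp: dist_real_def\<close>)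
qed

text \<open>The variation of \<open>d\<close> is at most the sum of the displacements of its two
  arguments, and left-invariance moves each displacement to 0, where \<open>tendsto_d_zero\<close>
  applies.\<close>

lemma continuous_on_d [continuous_intros]:
  assumes f: "continuous_on S f" and g: "continuous_on S g"
  shows "continuous_on S (\<lambda>x. d (f x) (g x))"
  unfolding continuous_on_def
proof
  fix x assume x: "x \<in> S"
  have 0: "((\<lambda>y. d 0 (- f x \<cdot> f y)) \<longlongrightarrow> 0) (at x within S)"
    if "continuous_on S f" for f :: "'b \<Rightarrow> 'a"
  proof (rule tendsto_d_zero)
    have "continuous_on S (\<lambda>y. - f x \<cdot> f y)"
      by (intro continuous_intros that)
    then show "((\<lambda>y. - f x \<cdot> f y) \<longlongrightarrow> 0) (at x within S)"
      using x unfolding continuous_on_def by force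
  qed
  have "((\<lambda>y. d (f y) (g y) - d (f x) (g x)) \<longlongrightarrow> 0) (at x within S)"
  proof (rule Lim_null_comparison)
    show "((\<lambda>y. d 0 (- f x \<cdot> f y) + d 0 (- g x \<cdot> g y)) \<longlongrightarrow> 0) (at x within S)"
      using tendsto_add[OF 0[OF f] 0[OF g]] by simp
    have "norm (d (f y) (g y) - d (f x) (g x)) \<le> d 0 (- f x \<cdot> f y) + d 0 (- g x \<cdot> g y)" for y
      using triangle[of "f y" "f x" "g y"] triangle[of "f x" "g x" "g y"] triangle[of "f x" "f y" "g x"]
        triangle[of "f y" "g y" "g x"] commute[of "f x" "f y"] commute[of "g x" "g y"]
        d_translate[of "f x" "f y"] d_translate[of "g x" "g y"] by simp
    then show "\<forall>\<^sub>F y in at x within S. norm (d (f y) (g y) - d (f x) (g x))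
        \<le> d 0 (- f x \<cdot> f y) + d 0 (- g x \<cdot> g y)"
      by simp
  qed
  then show "((\<lambda>x. d (f x) (g x)) \<longlongrightarrow> d (f x) (g x)) (at x within S)"
    by (simp add: LIM_zero_iff)
qed

text \<open>A point of norm at least 1 is shrunk by some dilation onto the Euclidean unit sphere,
  where \<open>d 0\<close> has a positive minimum. Homogeneity then bounds the shrinking factor from
  below in terms of \<open>R\<close>, and dilating back bounds the norm.\<close>

lemma d_zero_proper:
  obtains C where "\<And>x. d 0 x \<le> R \<Longrightarrow> norm x \<le> C"
proof -
  have "continuous_on (sphere 0 1) (\<lambda>x. d 0 x)"
    by (intro continuous_intros)
  then obtain u where u: "u \<in> sphere 0 1" "\<And>x. x \<in> sphere 0 1 \<Longrightarrow> d 0 u \<le> d 0 x"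
    using continuous_attains_inf[of "sphere (0::'a) 1" "\<lambda>x. d 0 x"] by auto
  have c: "0 < d 0 u"
    using u(1) by (auto simp: zero_less_dist_iff[symmetric])
  obtain C where C: "0 < C" "\<And>r x. 1 \<le> r \<Longrightarrow> norm (dil r x) \<le> C * r ^ \<kappa> * norm x"
    by (rule dil_norm_bound) blast
  have "norm x \<le> 1 + C * (R / d 0 u) ^ \<kappa>" if x: "d 0 x \<le> R" "1 \<le> norm x" for x
  proof -
    have "continuous_on {0..1} (\<lambda>r. norm (dil r x))"
      by (intro continuous_intros)
    then obtain r where r: "0 \<le> r" "r \<le> 1" "norm (dil r x) = 1"
      using IVT'[of "\<lambda>r. norm (dil r x)" 0 1 1] x(2) by auto
    then have "r \<noteq> 0"
      by auto
    then have "0 < r"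
      using r by simp
    have "d 0 u \<le> r * d 0 x"
      using u(2)[of "dil r x"] r d_zero_dil[OF \<open>0 < r\<close>] by simp
    also have "\<dots> \<le> r * R"
      using x \<open>0 < r\<close> by simp
    finally have 1: "1 / r \<le> R / d 0 u"
      using \<open>0 < r\<close> c by (simp add: field_simps)
    have "norm x = norm (dil (1 / r) (dil r x))"
      using \<open>0 < r\<close> by (simp add: dil_dil)
    also have "\<dots> \<le> C * (1 / r) ^ \<kappa> * norm (dil r x)"
      using r \<open>0 < r\<close> by (intro C) (simp add: field_simps)
    also have "\<dots> \<le> C * (R / d 0 u) ^ \<kappa>"
      using r 1 C(1) \<open>0 < r\<close> by (simp del: power_divide power_one_over) (intro power_mono, auto)
    finally show ?thesis
      by simp
  qed
  moreover have "0 \<le> C * (R / d 0 u) ^ \<kappa>" if "d 0 x \<le> R" for x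
    using that c C(1) nonneg[of 0 x] by (intro mult_nonneg_nonneg zero_le_power divide_nonneg_pos) linarith+
  ultimately have "norm x \<le> 1 + C * (R / d 0 u) ^ \<kappa>" if "d 0 x \<le> R" for x
    using that by (metis add_increasing2 linear)
  then show ?thesis
    by (rule that)
qed

lemma cl_ball_eq: "cl_ball d x r = {y. d x y \<le> r}"
  by (simp add: mcball_def)

lemma closed_cl_ball: "closed (cl_ball d x r)"
  unfolding cl_ball_eq by (intro closed_Collect_le continuous_intros)

lemma compact_cl_ball: "compact (cl_ball d x r)"
proof -
  obtain C where C: "\<And>y. d 0 y \<le> d 0 x + r \<Longrightarrow> norm y \<le> C"
    by (rule d_zero_proper) blast
  have "bounded (cl_ball d x r)"
    unfolding bounded_iff cl_ball_eq
  proof (intro exI ballI)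
    fix y assume "y \<in> {y. d x y \<le> r}"
    then show "norm y \<le> C"
      using triangle[of 0 x y] by (intro C) simp
  qed
  then show ?thesis
    using closed_cl_ball by (simp add: compact_eq_bounded_closed)
qed

end

section \<open>Vague compactness of Radon measures\<close>

text \<open>Each level splits the cells of the previous one along a set of a countable base, so halving a
  code forgets one level.\<close>

primrec cell_code :: "(nat \<Rightarrow> 'a::real_normed_vector set) \<Rightarrow> nat \<Rightarrow> 'a \<Rightarrow> nat" where
  "cell_code A 0 x = nat \<lfloor>norm x\<rfloor>"
| "cell_code A (Suc k) x = 2 * cell_code A k x + of_bool (x \<in> A k)"

lemma cell_code_div: "cell_code A (k + l) x div 2 ^ l = cell_code A k x"
proof (induction l)
  case (Suc l)
  have "cell_code A (k + Suc l) x div 2 ^ Suc l = cell_code A (Suc (k + l)) x div 2 div 2 ^ l"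
    by (simp add: div_mult2_eq)
  also have "cell_code A (Suc (k + l)) x div 2 = cell_code A (k + l) x"
    by simp
  finally show ?case
    using Suc by simp
qed simp

lemma cell_code_eq_mono:
  assumes "cell_code A l x = cell_code A l y" "k \<le> l"
  shows "cell_code A k x = cell_code A k y"
  using assms cell_code_div[of A k "l - k" x] cell_code_div[of A k "l - k" y] by simp

lemma cell_code_eq_mem:
  assumes "cell_code A l x = cell_code A l y" "k < l"
  shows "x \<in> A k \<longleftrightarrow> y \<in> A k"
proof -
  have "cell_code A (Suc k) x = cell_code A (Suc k) y" "cell_code A k x = cell_code A k y"
    using assms cell_code_eq_mono[of A l x y "Suc k"] cell_code_eq_mono[of A l x y k] by simp_all
  then show ?thesis
    by (cases "x \<in> A k"; cases "y \<in> A k") simp_all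
qed

lemma cell_code_measurable [measurable]:
  fixes A :: "nat \<Rightarrow> 'a::euclidean_space set"
  assumes [measurable]: "\<And>n. A n \<in> sets borel"
  shows "cell_code A k \<in> borel \<rightarrow>\<^sub>M count_space UNIV"
proof (induction k)
  case 0
  show ?case
    unfolding cell_code.simps by measurable
next
  case (Suc k)
  note [measurable] = Suc
  have "cell_code A (Suc k) = (\<lambda>x. 2 * cell_code A k x + (if x \<in> A k then 1 else 0))"
    by (auto simp: fun_eq_iff)
  also have "\<dots> \<in> borel \<rightarrow>\<^sub>M count_space UNIV"
    by measurable
  finally show ?case .
qed

lemma cell_code_norm:
  assumes "cell_code A k x = j"
  shows "norm x < real (j div 2 ^ k) + 1"
proof -
  have "j div 2 ^ k = nat \<lfloor>norm x\<rfloor>"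
    using cell_code_div[of A 0 k x] assms by simp
  then show ?thesis
    by simp
qed

text \<open>Finitely many small base sets cover \<open>K\<close>. Once all of them have been used
  for splitting, a point with the same code as \<open>x\<close> lies in the same small set, even if
  it is not in \<open>K\<close>.\<close>

lemma cell_code_fine:
  fixes A :: "nat \<Rightarrow> 'a::real_normed_vector set"
  assumes op: "\<And>n. open (A n)"
    and base: "\<And>U x. open U \<Longrightarrow> x \<in> U \<Longrightarrow> \<exists>n. x \<in> A n \<and> A n \<subseteq> U"
    and K: "compact K" and e: "0 < (e::real)"
  shows "\<exists>k. \<forall>l\<ge>k. \<forall>x\<in>K. \<forall>y. cell_code A l x = cell_code A l y \<longrightarrow> dist x y < e"
proof -
  let ?N = "{n. \<exists>z. A n \<subseteq> ball z (e / 2)}"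
  have "K \<subseteq> (\<Union>n\<in>?N. A n)"
  proof
    fix x assume "x \<in> K"
    show "x \<in> (\<Union>n\<in>?N. A n)"
      using base[of "ball x (e/2)" x] e by auto
  qed
  then obtain F where F: "F \<subseteq> ?N" "finite F" "K \<subseteq> (\<Union>n\<in>F. A n)"
    using compactE_image[OF K, of ?N A] op by metis
  \<comment> \<open>The sum of the finite index set serves as an upper bound of all its
    members.\<close>
  define k where "k = Suc (\<Sum>F)"
  have le: "n < k" if "n \<in> F" for n
    using member_le_sum[of n F id] that F(2) by (auto simp: k_def less_Suc_eq_le)
  have "dist x y < e" if "l \<ge> k" "x \<in> K" "cell_code A l x = cell_code A l y" for l x y
  proof -
    obtain n where n: "n \<in> F" "x \<in> A n"
      using F(3) \<open>x \<in> K\<close> by blast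
    then have "y \<in> A n"
      using cell_code_eq_mem[OF that(3), of n] le[of n] that(1) by simp
    moreover obtain z where "A n \<subseteq> ball z (e / 2)"
      using F(1) n(1) by blast
    ultimately have "dist z x < e / 2" "dist z y < e / 2"
      using n(2) by auto
    then show ?thesis
      by (metis dist_triangle_half_r)
  qed
  then show ?thesis
    by blast
qed

text \<open>Comparison of \<open>g\<close> with the step function of value \<open>w j\<close> on the
  j-th cell. The code \<open>C\<close> is arbitrary because the estimate is used twice: for codes of
  points under the given measures, and for codes of real parameters under Lebesgue measure.\<close>

lemma integral_partition_approx:
  fixes g :: "'x \<Rightarrow> real" and C :: "'x \<Rightarrow> nat" and w :: "nat \<Rightarrow> real"
  assumes C [measurable]: "C \<in> M \<rightarrow>\<^sub>M count_space UNIV"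
    and g [measurable]: "g \<in> borel_measurable M"
    and fin: "emeasure M {x\<in>space M. C x < n} < \<infinity>"
    and zero: "\<And>x. x \<in> space M \<Longrightarrow> \<not> C x < n \<Longrightarrow> g x = 0"
    and approx: "\<And>x. x \<in> space M \<Longrightarrow> C x < n \<Longrightarrow> \<bar>g x - w (C x)\<bar> \<le> e"
  shows "integrable M g"
    and "\<bar>(\<integral>x. g x \<partial>M) - (\<Sum>j<n. w j * measure M {x\<in>space M. C x = j})\<bar>
           \<le> e * measure M {x\<in>space M. C x < n}"
proof -
  let ?D = "{x\<in>space M. C x < n}" and ?C = "\<lambda>j. {x\<in>space M. C x = j}"
  define s where "s x = (\<Sum>j<n. w j * indicator (?C j) x)" for x
  have finC: "emeasure M (?C j) < \<infinity>" if "j < n" for j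
  proof -
    have "emeasure M (?C j) \<le> emeasure M ?D"
      using that by (intro emeasure_mono) auto
    then show ?thesis
      using fin by (simp add: order.strict_trans1)
  qed
  have s_eq: "s x = (if C x < n then w (C x) else 0)" if "x \<in> space M" for x
  proof -
    have "s x = (\<Sum>j<n. if j = C x then w j else 0)"
      using that by (auto simp: s_def indicator_def intro!: sum.cong)
    then show ?thesis
      by simp
  qed
  have s_int: "integrable M s"
    unfolding s_def using finC by (intro Bochner_Integration.integrable_sum integrable_mult_right integrable_real_indicator) auto
  have s_val: "(\<integral>x. s x \<partial>M) = (\<Sum>j<n. w j * measure M (?C j))"
    unfolding s_def using finC
    by (subst Bochner_Integration.integral_sum) (auto intro!: integrable_mult_right integrable_real_indicator sum.cong)
  have D_int: "integrable M (\<lambda>x. e * indicator ?D x)"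
    using fin by (intro integrable_mult_right integrable_real_indicator) auto
  have bd: "\<bar>g x - s x\<bar> \<le> e * indicator ?D x" if "x \<in> space M" for x
    using that zero[of x] approx[of x] by (auto simp: s_eq indicator_def)
  have s_meas: "s \<in> borel_measurable M"
    using s_int by (rule borel_measurable_integrable)
  have diff: "integrable M (\<lambda>x. g x - s x)"
    by (rule Bochner_Integration.integrable_bound[OF D_int])
      (use s_meas bd in \<open>auto intro!: AE_I2 intro: order_trans[OF _ abs_ge_self]\<close>)
  have "integrable M (\<lambda>x. (g x - s x) + s x)"
    using diff s_int by (rule Bochner_Integration.integrable_add)
  then show gi: "integrable M g"
    by simp
  have "\<bar>(\<integral>x. g x \<partial>M) - (\<integral>x. s x \<partial>M)\<bar> = \<bar>\<integral>x. g x - s x \<partial>M\<bar>"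
    using gi s_int by simp
  also have "\<dots> \<le> (\<integral>x. e * indicator ?D x \<partial>M)"
    using integral_abs_bound[of M "\<lambda>x. g x - s x"] integral_mono[OF integrable_abs[OF diff] D_int bd]
    by linarith
  also have "\<dots> = e * measure M ?D"
    by simp
  finally show "\<bar>(\<integral>x. g x \<partial>M) - (\<Sum>j<n. w j * measure M (?C j))\<bar> \<le> e * measure M ?D"
    unfolding s_val .
qed

text \<open>Cantor's diagonal procedure: a tail of the diagonal sequence is a subsequence of the one
  chosen for \<open>q\<close>, and convergence ignores the initial terms.\<close>

lemma bounded_family_convergent_subsequence:
  fixes a :: "nat \<Rightarrow> nat \<Rightarrow> real"
  assumes "\<And>q. Bseq (a q)"
  shows "\<exists>s. strict_mono s \<and> (\<forall>q. convergent (a q \<circ> s))"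
proof -
  interpret subseqs "\<lambda>q s. convergent (a q \<circ> s)"
  proof
    fix q :: nat and s :: "nat \<Rightarrow> nat" assume "strict_mono s"
    have "Bseq (a q \<circ> s)"
      using Bseq_subseq[OF assms[of q], of s] by (simp add: comp_def)
    then have "bounded (range (a q \<circ> s))"
      by (simp add: Bseq_eq_bounded)
    then obtain l r where "strict_mono (r :: nat \<Rightarrow> nat)" "((a q \<circ> s) \<circ> r) \<longlonglongrightarrow> l"
      using bounded_imp_convergent_subsequence by blast
    then show "\<exists>r. strict_mono r \<and> convergent (a q \<circ> (s \<circ> r))"
      by (auto simp: convergent_def comp_assoc)
  qed
  have conv: "convergent (a q \<circ> (diagseq \<circ> (+) (Suc q)))" for q
    by (rule diagseq_holds) (auto simp: comp_assoc[symmetric] intro: convergent_subseq_convergent)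
  have "convergent (a q \<circ> diagseq)" for q
    using convergent_ignore_initial_segment[of "a q \<circ> diagseq" "Suc q"] conv[of q] by (simp add: comp_def add.commute)
  then show ?thesis
    using subseq_diagseq by blast
qed

text \<open>The limiting masses of the cells are laid out as consecutive intervals of the real line, nested
  like the cells. The limit measure is the image of Lebesgue measure under the map sending t to the
  point on which the cells whose intervals contain t close down.\<close>

theorem vague_compactness:
  fixes \<mu> :: "nat \<Rightarrow> 'a::euclidean_space measure"
  assumes radon: "\<And>i. radon_measure (\<mu> i)"
    and bounded: "\<And>K. compact K \<Longrightarrow> Bseq (\<lambda>i. measure (\<mu> i) K)"
  shows "\<exists>s \<nu>. strict_mono s \<and> radon_measure \<nu> \<and> weak_conv_Cc (\<mu> \<circ> s) \<nu>"
proof -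
  obtain A :: "nat \<Rightarrow> 'a set" where opA: "\<And>n. open (A n)"
    and base: "\<And>U x. open U \<Longrightarrow> x \<in> U \<Longrightarrow> \<exists>n. x \<in> A n \<and> A n \<subseteq> U"
  proof -
    obtain \<B> :: "'a set set" where "countable \<B>" "topological_basis \<B>"
      using ex_countable_basis by blast
    moreover from this have "\<B> \<noteq> {}"
      by (metis UNIV_I empty_iff open_UNIV topological_basisE)
    ultimately show ?thesis
      using that[of "from_nat_into \<B>"]
      by (metis from_nat_into from_nat_into_surj topological_basisE topological_basis_open)
  qed
  have [measurable]: "A n \<in> sets borel" for n
    using opA by simp
  have fine: "\<exists>k. \<forall>l\<ge>k. \<forall>x\<in>K. \<forall>y. cell_code A l x = cell_code A l y \<longrightarrow> dist x y < e"
    if "compact K" "0 < e" for K e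
    using opA base that by (rule cell_code_fine)
  have sets_mu [measurable_cong]: "sets (\<mu> i) = sets borel" for i
    using radon by (simp add: radon_measure_def)
  have space_mu: "space (\<mu> i) = UNIV" for i
    using sets_eq_imp_space_eq[OF sets_mu] by simp
  define cell where "cell k j = {x. cell_code A k x = j}" for k j
  have cell_sets [measurable]: "cell k j \<in> sets borel" for k j
    unfolding cell_def by measurable
  have cell_sub: "cell k j \<subseteq> cball 0 (real (j div 2 ^ k) + 1)" for k j
    unfolding cell_def by (auto intro: less_imp_le[OF cell_code_norm[of A k]])
  have fin_bdd: "emeasure (\<mu> i) B < \<infinity>" if "B \<subseteq> cball 0 R" for i B R
  proof -
    have "emeasure (\<mu> i) B \<le> emeasure (\<mu> i) (cball 0 R)"
      using that by (intro emeasure_mono) (auto simp: sets_mu)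
    then show ?thesis
      using radon[of i] by (auto simp: radon_measure_def less_top[symmetric] top_unique)
  qed
  have meas_mono: "measure (\<mu> i) B \<le> measure (\<mu> i) (cball 0 R)"
    if "B \<subseteq> cball 0 R" "B \<in> sets borel" for i B R
    using that fin_bdd[of "cball 0 R" R i]
    by (intro measure_mono_fmeasurable) (auto simp: fmeasurable_def sets_mu)
  \<comment> \<open>All cells of all levels are listed in one sequence, so that a single diagonal
    extraction makes all their masses converge.\<close>
  define a where "a q i = (case prod_decode q of (k, j) \<Rightarrow> measure (\<mu> i) (cell k j))" for q i
  have "Bseq (a q)" for q
  proof -
    obtain k j where q: "prod_decode q = (k, j)"
      by fastforce
    obtain M where M: "\<And>i. norm (measure (\<mu> i) (cball 0 (real (j div 2 ^ k) + 1))) \<le> M" "0 < M"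
      using bounded[OF compact_cball] by (meson BseqE)
    have "norm (a q i) \<le> M" for i
      using meas_mono[OF cell_sub[of k j] cell_sets, of i] M(1)[of i] by (simp add: a_def q)
    then show ?thesis
      using M(2) by (auto intro: BseqI)
  qed
  then obtain s where s: "strict_mono s" "\<And>q. convergent (a q \<circ> s)"
    using bounded_family_convergent_subsequence by blast
  define m where "m k j = lim (\<lambda>i. measure (\<mu> (s i)) (cell k j))" for k j
  have m: "(\<lambda>i. measure (\<mu> (s i)) (cell k j)) \<longlonglongrightarrow> m k j" for k j
    using s(2)[of "prod_encode (k, j)"] unfolding m_def by (simp add: a_def comp_def convergent_LIMSEQ_iff)
  have m_nonneg: "0 \<le> m k j" for k j
    using m by (rule LIMSEQ_le_const) auto
  \<comment> \<open>Additivity along the tree of cells survives the limit. No more than that can be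
    expected: mass may escape to the boundary of a cell, so \<open>m k j\<close> may differ from the
    mass that the limit measure gives to \<open>cell k j\<close>.\<close>
  have m_split: "m (Suc k) (2 * j) + m (Suc k) (Suc (2 * j)) = m k j" for k j
  proof -
    have "cell k j = cell (Suc k) (2 * j) \<union> cell (Suc k) (Suc (2 * j))"
      by (auto simp: cell_def split: if_splits)
    moreover have "cell (Suc k) (2 * j) \<inter> cell (Suc k) (Suc (2 * j)) = {}"
      by (auto simp: cell_def)
    ultimately have "measure (\<mu> (s i)) (cell k j)
        = measure (\<mu> (s i)) (cell (Suc k) (2 * j)) + measure (\<mu> (s i)) (cell (Suc k) (Suc (2 * j)))" for i
      using fin_bdd[OF cell_sub] by (simp add: measure_Union[symmetric] sets_mu less_top)
    then show ?thesis
      using LIMSEQ_unique[OF m[of k j]] tendsto_add[OF m[of "Suc k" "2 * j"] m[of "Suc k" "Suc (2 * j)"]] by simp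
  qed
  have m_pos_ne: "cell k j \<noteq> {}" if "m k j \<noteq> 0" for k j
  proof
    assume "cell k j = {}"
    then have "m k j = 0"
      using LIMSEQ_unique[OF m[of k j], of 0] by simp
    with that show False
      by simp
  qed

  \<comment> \<open>\<open>F k j\<close> is the left end of the interval reserved for cell
    \<open>j\<close> of level \<open>k\<close>. As the children of \<open>j\<close> are
    \<open>2 * j\<close> and \<open>Suc (2 * j)\<close>, the intervals of the next level subdivide
    those of level \<open>k\<close> in order, which is \<open>F_double\<close>.\<close>
  define F where "F k j = (\<Sum>i<j. m k i)" for k j
  have F_0 [simp]: "F k 0 = 0" for k
    by (simp add: F_def)
  have F_Suc: "F k (Suc j) = F k j + m k j" for k j
    by (simp add: F_def)
  have F_mono: "F k i \<le> F k j" if "i \<le> j" for k i j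
    unfolding F_def using that m_nonneg by (intro sum_mono2) auto
  have F_double: "F (Suc k) (2 * j) = F k j" for k j
  proof (induction j)
    case (Suc j)
    then show ?case
      using m_split[of k j] by (simp add: F_Suc)
  qed simp
  have F_power: "F (k + n) (2 ^ n * j) = F k j" for k n j
    by (induction n) (simp_all add: F_double mult.assoc)
  \<comment> \<open>\<open>T\<close> is the union of all intervals of level 0, and
    \<open>J k t\<close> is the number of the interval of level \<open>k\<close> that contains
    \<open>t\<close>. Taking the least index with a strict inequality skips intervals of length
    0.\<close>
  define T where "T = {t. 0 \<le> t \<and> (\<exists>j. t < F 0 j)}"
  define J where "J k t = (LEAST j. t < F k (Suc j))" for k and t :: real
  have J: "F k (J k t) \<le> t" "t < F k (Suc (J k t))" if "t \<in> T" for k t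
  proof -
    obtain j where "t < F 0 j" "0 \<le> t"
      using \<open>t \<in> T\<close> by (auto simp: T_def)
    then have "t < F k (2 ^ k * j)"
      using F_power[of 0 k j] by simp
    then have ex: "t < F k (Suc (2 ^ k * j))"
      using F_mono[of "2 ^ k * j" "Suc (2 ^ k * j)" k] by simp
    show "t < F k (Suc (J k t))"
      unfolding J_def using ex by (rule LeastI)
    show "F k (J k t) \<le> t"
    proof (cases "J k t")
      case 0
      then show ?thesis
        using \<open>0 \<le> t\<close> by simp
    next
      case (Suc n)
      then have "\<not> t < F k (Suc n)"
        using not_less_Least[of n "\<lambda>j. t < F k (Suc j)"] by (simp add: J_def)
      then show ?thesis
        using Suc by simp
    qed
  qed
  have J_unique: "J k t = j" if "t \<in> T" "F k j \<le> t" "t < F k (Suc j)" for k t j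
  proof (rule ccontr)
    assume "J k t \<noteq> j"
    then consider "Suc (J k t) \<le> j" | "Suc j \<le> J k t"
      by linarith
    then show False
      by cases (use J[OF that(1), of k] that F_mono[of "Suc (J k t)" j k] F_mono[of "Suc j" "J k t" k] in linarith)+
  qed
  have J_div: "J (k + n) t div 2 ^ n = J k t" if "t \<in> T" for k n t
  proof -
    have "F k (J (k + n) t div 2 ^ n) = F (k + n) (2 ^ n * (J (k + n) t div 2 ^ n))"
      by (simp add: F_power)
    also have "\<dots> \<le> F (k + n) (J (k + n) t)"
      by (intro F_mono) simp
    finally have 1: "F k (J (k + n) t div 2 ^ n) \<le> t"
      using J(1)[OF that, of "k + n"] by simp
    have "Suc (J (k + n) t) \<le> 2 ^ n * Suc (J (k + n) t div 2 ^ n)"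
      by (simp add: Suc_le_eq dividend_less_times_div)
    then have "F (k + n) (Suc (J (k + n) t)) \<le> F k (Suc (J (k + n) t div 2 ^ n))"
      using F_mono F_power by metis
    then have "t < F k (Suc (J (k + n) t div 2 ^ n))"
      using J(2)[OF that, of "k + n"] by simp
    with 1 that show ?thesis
      using J_unique by metis
  qed
  have J_less: "J k t < 2 ^ k * N \<longleftrightarrow> t < F 0 N" if "t \<in> T" for k t N
  proof -
    have "J k t < 2 ^ k * N \<longleftrightarrow> t < F k (2 ^ k * N)"
      using J[OF that, of k] F_mono[of "Suc (J k t)" "2 ^ k * N" k] F_mono[of "2 ^ k * N" "J k t" k]
      by (force simp: not_less Suc_le_eq)
    then show ?thesis
      using F_power[of 0 k N] by simp
  qed

  \<comment> \<open>An empty cell gets an arbitrary point, but no \<open>t\<close> in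
    \<open>T\<close> leads to one: its interval has positive length, and cells with positive
    limiting mass are nonempty.\<close>
  define p where "p k j = (SOME x. x \<in> cell k j)" for k j
  define X where "X k t = p k (J k t)" for k t
  have code_X: "cell_code A k (X n t) = J k t" if "t \<in> T" "k \<le> n" for k n t
  proof -
    have "m n (J n t) \<noteq> 0"
      using J[OF that(1), of n] by (auto simp: F_Suc)
    then have "cell n (J n t) \<noteq> {}"
      by (rule m_pos_ne)
    then have "X n t \<in> cell n (J n t)"
      unfolding X_def p_def by (metis someI_ex ex_in_conv)
    then have "cell_code A n (X n t) = J n t"
      by (simp add: cell_def)
    then show ?thesis
      using cell_code_div[of A k "n - k" "X n t"] J_div[OF that(1), of k "n - k"] that(2) by simp
  qed
  have X_norm: "norm (X n t) < real (J 0 t) + 1" "real (J 0 t) \<le> norm (X n t)" if "t \<in> T" for n t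
    using code_X[OF that, of 0 n] of_nat_floor[of "norm (X n t)"] real_of_int_floor_add_one_gt[of "norm (X n t)"]
    by (auto simp del: real_of_int_floor_add_one_gt)
  have X_Cauchy: "Cauchy (\<lambda>n. X n t)" if "t \<in> T" for t
  proof (rule metric_CauchyI)
    fix e :: real assume "0 < e"
    then obtain k where k: "\<forall>l\<ge>k. \<forall>x\<in>cball 0 (real (J 0 t) + 1). \<forall>y. cell_code A l x = cell_code A l y \<longrightarrow> dist x y < e"
      using fine[OF compact_cball] by blast
    have "dist (X i t) (X j t) < e" if "i \<ge> k" "j \<ge> k" for i j
      using k[rule_format, of k "X i t" "X j t"] X_norm[OF \<open>t \<in> T\<close>, of i]
        code_X[OF \<open>t \<in> T\<close> that(1)] code_X[OF \<open>t \<in> T\<close> that(2)]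
      by simp
    then show "\<exists>M. \<forall>m\<ge>M. \<forall>n\<ge>M. dist (X m t) (X n t) < e"
      by blast
  qed
  define Y where "Y t = lim (\<lambda>n. X n t)" for t
  have Y: "(\<lambda>n. X n t) \<longlonglongrightarrow> Y t" if "t \<in> T" for t
    unfolding Y_def using X_Cauchy[OF that] by (simp add: Cauchy_convergent convergent_LIMSEQ_iff[symmetric])
  have Y_norm: "real (J 0 t) \<le> norm (Y t)" if "t \<in> T" for t
    using tendsto_norm[OF Y[OF that]] by (rule LIMSEQ_le_const) (use X_norm[OF that] in auto)

  define \<Omega> where "\<Omega> = restrict_space lborel T"
  have T_sets [measurable]: "T \<in> sets borel"
    unfolding T_def by measurable
  have space_Om: "space \<Omega> = T"
    by (simp add: \<Omega>_def space_restrict_space)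
  have J_meas: "J k \<in> borel \<rightarrow>\<^sub>M count_space UNIV" for k
    unfolding J_def by measurable
  then have J_meas' [measurable]: "J k \<in> \<Omega> \<rightarrow>\<^sub>M count_space UNIV" for k
    unfolding \<Omega>_def by (intro measurable_restrict_space1) simp
  have X_meas [measurable]: "X k \<in> \<Omega> \<rightarrow>\<^sub>M borel" for k
    unfolding X_def by measurable
  have Y_meas [measurable]: "Y \<in> \<Omega> \<rightarrow>\<^sub>M borel"
    by (rule borel_measurable_LIMSEQ_metric[where f = X]) (auto simp: space_Om Y)
  define \<nu> where "\<nu> = distr \<Omega> borel Y"
  have meas_Om: "emeasure \<Omega> {t\<in>T. P t} = emeasure lborel {t\<in>T. P t}" for P
    unfolding \<Omega>_def by (rule emeasure_restrict_space) auto
  \<comment> \<open>Parameters whose code stays below \<open>2 ^ k * N\<close> are the same at every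
    level \<open>k\<close>. They carry the finite mass \<open>F 0 N\<close>, which bounds the error
    at all levels at once.\<close>
  have T_less: "{t\<in>T. J k t < 2 ^ k * N} = {0..<F 0 N}" for k N
  proof (rule Set.set_eqI)
    show "t \<in> {t\<in>T. J k t < 2 ^ k * N} \<longleftrightarrow> t \<in> {0..<F 0 N}" for t
      using J_less[of t k N] by (cases "t \<in> T") (auto simp: T_def)
  qed
  have meas_less: "emeasure \<Omega> {t\<in>T. J k t < 2 ^ k * N} = ennreal (F 0 N)" for k N
    using F_mono[of 0 N 0] meas_Om[of "\<lambda>t. J k t < 2 ^ k * N"] unfolding T_less by simp
  have T_eq: "{t\<in>T. J k t = j} = {F k j..<F k (Suc j)}" for k j
  proof -
    have "t \<in> T" if "F k j \<le> t" "t < F k (Suc j)" for t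
    proof -
      have "F k (Suc j) \<le> F k (2 ^ k * Suc j)"
        using mult_le_mono1[of 1 "2 ^ k" "Suc j"] by (intro F_mono) simp
      then have "t < F 0 (Suc j)"
        using that F_power[of 0 k "Suc j"] by simp
      moreover have "0 \<le> t"
        using that F_mono[of 0 j k] by simp
      ultimately show ?thesis
        by (auto simp: T_def)
    qed
    then have "t \<in> {t\<in>T. J k t = j} \<longleftrightarrow> t \<in> {F k j..<F k (Suc j)}" for t
      using J[of t k] J_unique[of t k j] by auto
    then show ?thesis
      by blast
  qed
  have meas_eq: "measure \<Omega> {t\<in>T. J k t = j} = m k j" for k j
    using F_mono[of j "Suc j" k] meas_Om[of "\<lambda>t. J k t = j"] unfolding T_eq measure_def
    by (simp add: F_Suc m_nonneg)

  have "radon_measure \<nu>"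
    unfolding radon_measure_def
  proof (intro conjI allI impI)
    show "sets \<nu> = sets borel"
      by (simp add: \<nu>_def)
    fix K :: "'a set" assume "compact K"
    then obtain R where R: "\<forall>x\<in>K. norm x \<le> R"
      using compact_imp_bounded bounded_iff by blast
    define N where "N = Suc (nat \<lceil>R\<rceil>)"
    have "emeasure \<nu> K = emeasure \<Omega> (Y -` K \<inter> T)"
      unfolding \<nu>_def using \<open>compact K\<close> by (subst emeasure_distr) (auto simp: space_Om compact_imp_closed)
    also have "\<dots> \<le> emeasure \<Omega> {t\<in>T. J 0 t < 2 ^ 0 * N}"
    proof (rule emeasure_mono)
      show "Y -` K \<inter> T \<subseteq> {t \<in> T. J 0 t < 2 ^ 0 * N}"
      proof
        fix t assume t: "t \<in> Y -` K \<inter> T"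
        then have "real (J 0 t) \<le> R"
          using Y_norm[of t] R by force
        then have "J 0 t < N"
          unfolding N_def by linarith
        then show "t \<in> {t \<in> T. J 0 t < 2 ^ 0 * N}"
          using t by simp
      qed
      have "{t \<in> space \<Omega>. J 0 t < 2 ^ 0 * N} \<in> sets \<Omega>"
        by measurable
      then show "{t \<in> T. J 0 t < 2 ^ 0 * N} \<in> sets \<Omega>"
        by (simp add: space_Om)
    qed
    also have "\<dots> < \<infinity>"
      unfolding meas_less by simp
    finally show "emeasure \<nu> K < \<infinity>" .
  qed

  moreover have "weak_conv_Cc (\<mu> \<circ> s) \<nu>"
    unfolding weak_conv_Cc_def comp_def
  proof (intro allI impI, elim conjE)
    fix f :: "'a \<Rightarrow> real"
    assume f: "continuous_on UNIV f" and supp: "compact (closure {x. f x \<noteq> 0})"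
    have f_meas [measurable]: "f \<in> borel_measurable borel"
      using f by (rule borel_measurable_continuous_onI)
    obtain R where "\<forall>x\<in>closure {x. f x \<noteq> 0}. norm x \<le> R"
      using compact_imp_bounded[OF supp] bounded_iff by blast
    then have R: "norm x \<le> R" if "f x \<noteq> 0" for x
      using that subsetD[OF closure_subset, of x "{x. f x \<noteq> 0}"] by simp
    define N where "N = nat \<lceil>R\<rceil> + 2"
    have N: "R + 1 < real N"
      unfolding N_def by linarith
    have f0: "f x = 0" if "real N - 1 \<le> norm x" for x
      by (rule ccontr) (use R[of x] N that in linarith)
    have unif: "uniformly_continuous_on (cball 0 (real N + 1)) f"
      by (intro compact_uniformly_continuous continuous_on_subset[OF f]) auto
    have approx: "\<exists>k. \<forall>x y n. n \<ge> k \<longrightarrow> cell_code A n x = cell_code A n y \<longrightarrow> \<bar>f x - f y\<bar> \<le> e" if "0 < e" for e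
    proof -
      obtain \<delta> where "\<delta> > 0" and \<delta>: "\<And>x y. x \<in> cball 0 (real N + 1) \<Longrightarrow> y \<in> cball 0 (real N + 1) \<Longrightarrow> dist y x < \<delta> \<Longrightarrow> dist (f y) (f x) < e"
        using unif \<open>0 < e\<close> unfolding uniformly_continuous_on_def by metis
      \<comment> \<open>The minimum with 1 keeps a point with the same code as \<open>x\<close>
        inside the ball of radius \<open>real N + 1\<close>, on which \<open>f\<close> is uniformly
        continuous.\<close>
      have "0 < min \<delta> 1"
        using \<open>\<delta> > 0\<close> by simp
      from fine[OF compact_cball this] obtain k where
        k: "\<forall>n\<ge>k. \<forall>x\<in>cball 0 (real N). \<forall>y. cell_code A n x = cell_code A n y \<longrightarrow> dist x y < min \<delta> 1"
        by blast
      have "\<bar>f x - f y\<bar> \<le> e" if n: "n \<ge> k" and eq: "cell_code A n x = cell_code A n y" and x: "norm x \<le> real N" for n x y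
      proof -
        have "dist x y < min \<delta> 1"
          using k n eq x by simp
        moreover from this have "norm y \<le> real N + 1"
          using x norm_triangle_ineq2[of y x] by (simp add: dist_norm norm_minus_commute)
        ultimately show ?thesis
          using \<delta>[of x y] x by (simp add: dist_norm norm_minus_commute less_imp_le abs_minus_commute)
      qed
      moreover have "\<bar>f x - f y\<bar> \<le> e" if "\<not> norm x \<le> real N" "\<not> norm y \<le> real N" for x y
        using f0[of x] f0[of y] that \<open>0 < e\<close> by simp
      ultimately show ?thesis
        by (metis abs_minus_commute)
    qed
    obtain C where C: "\<And>i. norm (measure (\<mu> i) (cball 0 (real N))) \<le> C" "C > 0"
      using bounded[OF compact_cball] by (meson BseqE)
    show "(\<lambda>i. \<integral>x. f x \<partial>\<mu> (s i)) \<longlonglongrightarrow> (\<integral>x. f x \<partial>\<nu>)"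
    proof (rule LIMSEQ_I)
      fix r :: real assume "0 < r"
      \<comment> \<open>The two partition errors are at most \<open>e * C\<close> and
        \<open>e * F 0 N\<close>. Together they stay strictly below \<open>r / 2\<close>, thanks to
        the summand 1; the other half is left for the convergence of the finite sums.\<close>
      define e where "e = r / (2 * (C + F 0 N + 1))"
      have FN: "0 \<le> F 0 N"
        using F_mono[of 0 N 0] by simp
      have "e > 0"
        using \<open>0 < r\<close> C(2) FN by (simp add: e_def)
      obtain k where k: "\<And>x y n. n \<ge> k \<Longrightarrow> cell_code A n x = cell_code A n y \<Longrightarrow> \<bar>f x - f y\<bar> \<le> e"
        using approx[OF \<open>e > 0\<close>] by blast
      \<comment> \<open>Codes of level \<open>k\<close> below this number are those of the points of
        norm less than \<open>real N\<close>, because division by \<open>2 ^ k\<close> recovers the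
        integer part of the norm.\<close>
      let ?n = "2 ^ k * N"
      let ?w = "\<lambda>j. f (p k j)"
      have low: "cell_code A k x < ?n \<longleftrightarrow> norm x < real N" for x
      proof -
        have "cell_code A k x < ?n \<longleftrightarrow> cell_code A k x div 2 ^ k < N"
          by (metis div_less_iff_less_mult mult.commute pos2 zero_less_power)
        also have "cell_code A k x div 2 ^ k = nat \<lfloor>norm x\<rfloor>"
          using cell_code_div[of A 0 k x] by simp
        also have "nat \<lfloor>norm x\<rfloor> < N \<longleftrightarrow> norm x < real N"
          by (simp add: nat_less_iff floor_less_iff)
        finally show ?thesis .
      qed
      have pk: "cell_code A k (p k (cell_code A k x)) = cell_code A k x" for x
      proof -
        have "p k (cell_code A k x) \<in> cell k (cell_code A k x)"
          unfolding p_def by (rule someI[of _ x]) (simp add: cell_def)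
        then show ?thesis
          by (simp add: cell_def)
      qed
      have 1: "\<bar>(\<integral>x. f x \<partial>\<mu> i) - (\<Sum>j<?n. ?w j * measure (\<mu> i) (cell k j))\<bar> \<le> e * C" for i
      proof -
        have "\<bar>(\<integral>x. f x \<partial>\<mu> i) - (\<Sum>j<?n. ?w j * measure (\<mu> i) {x\<in>space (\<mu> i). cell_code A k x = j})\<bar>
            \<le> e * measure (\<mu> i) {x\<in>space (\<mu> i). cell_code A k x < ?n}"
        proof (rule integral_partition_approx)
          show "cell_code A k \<in> \<mu> i \<rightarrow>\<^sub>M count_space UNIV" "f \<in> borel_measurable (\<mu> i)"
            by measurable
          show "emeasure (\<mu> i) {x \<in> space (\<mu> i). cell_code A k x < ?n} < \<infinity>"
            by (rule fin_bdd[of _ "real N"]) (auto simp: low)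
          show "f x = 0" if "\<not> cell_code A k x < ?n" for x
            using that f0[of x] by (simp add: low)
          show "\<bar>f x - ?w (cell_code A k x)\<bar> \<le> e" for x
            using k[of k x] pk by simp
        qed
        also have "measure (\<mu> i) {x\<in>space (\<mu> i). cell_code A k x < ?n} \<le> C"
        proof -
          have "{x\<in>space (\<mu> i). cell_code A k x < ?n} \<subseteq> cball 0 (real N)"
            by (auto simp: low)
          moreover have "{x\<in>space (\<mu> i). cell_code A k x < ?n} \<in> sets (\<mu> i)"
            by measurable
          then have "{x\<in>space (\<mu> i). cell_code A k x < ?n} \<in> sets borel"
            by (simp only: sets_mu)
          ultimately have "measure (\<mu> i) {x\<in>space (\<mu> i). cell_code A k x < ?n} \<le> measure (\<mu> i) (cball 0 (real N))"
            by (rule meas_mono)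
          then show ?thesis
            using C(1)[of i] by simp
        qed
        finally show ?thesis
          using \<open>e > 0\<close> by (simp add: space_mu cell_def)
      qed
      have 2: "\<bar>(\<integral>x. f x \<partial>\<nu>) - (\<Sum>j<?n. ?w j * m k j)\<bar> \<le> e * F 0 N"
      proof -
        have "\<bar>(\<integral>t. f (Y t) \<partial>\<Omega>) - (\<Sum>j<?n. ?w j * measure \<Omega> {t\<in>space \<Omega>. J k t = j})\<bar>
            \<le> e * measure \<Omega> {t\<in>space \<Omega>. J k t < ?n}"
        proof (rule integral_partition_approx)
          show "J k \<in> \<Omega> \<rightarrow>\<^sub>M count_space UNIV" "(\<lambda>t. f (Y t)) \<in> borel_measurable \<Omega>"
            by measurable
          show "emeasure \<Omega> {t \<in> space \<Omega>. J k t < ?n} < \<infinity>"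
            unfolding space_Om meas_less by simp
          fix t assume t: "t \<in> space \<Omega>"
          then have T: "t \<in> T"
            by (simp add: space_Om)
          show "f (Y t) = 0" if "\<not> J k t < ?n"
          proof (rule f0)
            have "N \<le> J 0 t"
              using that J_less[OF T, of k N] J_less[OF T, of 0 N] by simp
            then show "real N - 1 \<le> norm (Y t)"
              using Y_norm[OF T] by linarith
          qed
          \<comment> \<open>\<open>Y t\<close> itself may lie in a different cell. From level
            \<open>k\<close> on, the approximants \<open>X n t\<close> share the code of
            \<open>X k t\<close>, and the bound by \<open>e\<close> passes to their limit.\<close>
          have "(\<lambda>n. f (X n t)) \<longlonglongrightarrow> f (Y t)"
            by (rule continuous_on_tendsto_compose[OF f Y[OF T]]) auto
          then have "(\<lambda>n. \<bar>f (X n t) - f (X k t)\<bar>) \<longlonglongrightarrow> \<bar>f (Y t) - f (X k t)\<bar>"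
            by (intro tendsto_intros)
          then have "\<bar>f (Y t) - f (X k t)\<bar> \<le> e"
          proof (rule LIMSEQ_le_const2)
            show "\<exists>M. \<forall>n\<ge>M. \<bar>f (X n t) - f (X k t)\<bar> \<le> e"
              using k[of k] code_X[OF T] by (metis order_refl)
          qed
          then show "\<bar>f (Y t) - ?w (J k t)\<bar> \<le> e"
            by (simp add: X_def)
        qed
        moreover have "(\<integral>t. f (Y t) \<partial>\<Omega>) = (\<integral>x. f x \<partial>\<nu>)"
          unfolding \<nu>_def by (rule integral_distr[symmetric]) measurable
        moreover have "measure \<Omega> {t\<in>space \<Omega>. J k t < ?n} = F 0 N"
          unfolding space_Om measure_def meas_less using FN by simp
        ultimately show ?thesis
          by (simp add: space_Om meas_eq)
      qed
      have "(\<lambda>i. \<Sum>j<?n. ?w j * measure (\<mu> (s i)) (cell k j)) \<longlonglongrightarrow> (\<Sum>j<?n. ?w j * m k j)"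
        by (intro tendsto_intros m)
      then obtain i0 where i0: "\<And>i. i \<ge> i0 \<Longrightarrow> \<bar>(\<Sum>j<?n. ?w j * measure (\<mu> (s i)) (cell k j)) - (\<Sum>j<?n. ?w j * m k j)\<bar> < r / 2"
        using \<open>0 < r\<close> unfolding LIMSEQ_def dist_real_def by (meson half_gt_zero)
      have small: "e * C + e * F 0 N < r / 2"
      proof -
        have "e * C + e * F 0 N < e * (C + F 0 N + 1)"
          using \<open>e > 0\<close> by (simp add: algebra_simps)
        also have "\<dots> = r / 2"
          using C(2) FN by (simp add: e_def field_simps)
        finally show ?thesis .
      qed
      have "norm ((\<integral>x. f x \<partial>\<mu> (s i)) - (\<integral>x. f x \<partial>\<nu>)) < r" if "i \<ge> i0" for i
        using i0[OF that] 1[of "s i"] 2 small unfolding real_norm_def by linarith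
      then show "\<exists>no. \<forall>n\<ge>no. norm ((\<integral>x. f x \<partial>\<mu> (s n)) - (\<integral>x. f x \<partial>\<nu>)) < r"
        by blast
    qed
  qed
  ultimately show ?thesis
    using s by blast
qed

section \<open>Covering by cone sets\<close>

text \<open>Radii in a cover must be positive, so even the empty set has covers of positive cost
  only. Geometrically decreasing radii make this cost arbitrarily small, provided that
  \<open>h\<close> is not 0.\<close>

lemma spherical_measure_empty:
  assumes "1 \<le> h"
  shows "spherical_measure d h {} = 0"
proof -
  have "(INF (x, r)\<in>{(x :: nat \<Rightarrow> 'a, r :: nat \<Rightarrow> real). {} \<subseteq> (\<Union>j. cl_ball d (x j) (r j)) \<and> (\<forall>j. 0 < r j \<and> r j \<le> \<delta>)}.
      \<Sum>j. ennreal (r j ^ h)) \<le> 0" (is "?I \<le> 0") if "0 < \<delta>" for \<delta> :: real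
  proof (rule ennreal_le_epsilon)
    fix e :: real assume "0 < e"
    define q where "q = min \<delta> (min 1 e)"
    have q: "0 < q" "q \<le> \<delta>" "q \<le> 1" "q \<le> e"
      using \<open>0 < e\<close> \<open>0 < \<delta>\<close> by (auto simp: q_def)
    define r :: "nat \<Rightarrow> real" where "r j = q * (1 / 2) ^ Suc j" for j
    have r: "0 < r j" "r j \<le> q" for j
    proof -
      have "(1 / 2 :: real) ^ Suc j \<le> 1"
        by (rule power_le_one) auto
      then show "r j \<le> q"
        using q(1) unfolding r_def by (intro mult_left_le) auto
    qed (use q in \<open>simp add: r_def\<close>)
    have "?I \<le> (\<Sum>j. ennreal (r j ^ h))"
      using r q by (intro INF_lower2[of "(\<lambda>_. undefined, r)"]) (auto intro: order_trans)
    also have "\<dots> \<le> (\<Sum>j. ennreal (r j))"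
    proof (intro suminf_le ennreal_leI summableI)
      fix j
      have "r j ^ h \<le> r j ^ 1"
        using r[of j] q assms by (intro power_decreasing) auto
      then show "r j ^ h \<le> r j"
        by simp
    qed
    also have "\<dots> = ennreal q"
    proof (rule suminf_ennreal_eq)
      have "(\<lambda>j. q * (1 / 2) ^ Suc j) sums (q * 1)"
        by (intro sums_mult power_half_series)
      then show "r sums q"
        unfolding r_def[abs_def] by (simp only: mult_1_right)
      show "0 \<le> r j" for j
        using r(1)[of j] by linarith
    qed
    also have "\<dots> \<le> ennreal e"
      using q by (intro ennreal_leI)
    finally show "?I \<le> 0 + ennreal e"
      by simp
  qed
  then show ?thesis
    unfolding spherical_measure_def by (auto intro!: antisym SUP_least)
qed

section \<open>Distance to a homogeneous subgroup, and the mass away from it\<close>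

context homogeneous_distance
begin

lemma GrD:
  assumes "H \<in> Gr G \<kappa> V d h"
  shows "0 \<in> H" "0 < r \<Longrightarrow> v \<in> H \<Longrightarrow> dil r v \<in> H"
  using assms one_zero subgroup.one_closed[of H G]
  by (auto simp: Gr_def homogeneous_subgroup_def lie_subgroup_def)

definition hdist :: "'a set \<Rightarrow> 'a \<Rightarrow> real" where
  "hdist H w = (INF v\<in>H. d w v)"

lemma hdist_le: "v \<in> H \<Longrightarrow> hdist H w \<le> d w v"
  unfolding hdist_def by (intro cINF_lower bdd_belowI2[of _ 0]) auto

lemma hdist_nonneg: "H \<noteq> {} \<Longrightarrow> 0 \<le> hdist H w"
  unfolding hdist_def by (intro cINF_greatest) auto

lemma hdist_lessE:
  assumes "hdist H w < e" "H \<noteq> {}"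
  obtains v where "v \<in> H" "d w v < e"
  using assms unfolding hdist_def by (subst (asm) cINF_less_iff) (auto intro: bdd_belowI2[of _ 0])

lemma hdist_triangle:
  assumes "H \<noteq> {}"
  shows "hdist H w \<le> d w w' + hdist H w'"
proof -
  have "hdist H w - d w w' \<le> hdist H w'"
    unfolding hdist_def[of H w'] using assms
  proof (rule cINF_greatest)
    show "hdist H w - d w w' \<le> d w' v" if "v \<in> H" for v
      using hdist_le[OF that, of w] triangle[of w w' v] by simp
  qed
  then show ?thesis
    by simp
qed

lemma continuous_on_hdist [continuous_intros]:
  assumes f: "continuous_on S f" and "H \<noteq> {}"
  shows "continuous_on S (\<lambda>x. hdist H (f x))"
  unfolding continuous_on_def
proof
  fix x assume x: "x \<in> S"
  have "((\<lambda>y. hdist H (f y) - hdist H (f x)) \<longlongrightarrow> 0) (at x within S)"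
  proof (rule Lim_null_comparison)
    have "continuous_on S (\<lambda>y. d (f x) (f y))"
      by (intro continuous_intros f)
    then show "((\<lambda>y. d (f x) (f y)) \<longlongrightarrow> 0) (at x within S)"
      using x unfolding continuous_on_def by force
    have "norm (hdist H (f y) - hdist H (f x)) \<le> d (f x) (f y)" for y
      using hdist_triangle[OF assms(2), of "f x" "f y"] hdist_triangle[OF assms(2), of "f y" "f x"]
        commute[of "f x" "f y"] by simp
    then show "\<forall>\<^sub>F y in at x within S. norm (hdist H (f y) - hdist H (f x)) \<le> d (f x) (f y)"
      by simp
  qed
  then show "((\<lambda>x. hdist H (f x)) \<longlongrightarrow> hdist H (f x)) (at x within S)"
    by (simp add: LIM_zero_iff)
qed

text \<open>The dilations by \<open>r\<close> and by \<open>1 / r\<close> both map \<open>H\<close>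
  into itself, so one inequality used for both factors gives equality.\<close>

lemma hdist_dil:
  assumes "H \<in> Gr G \<kappa> V d h" "0 < r"
  shows "hdist H (dil r w) = r * hdist H w"
proof -
  have le: "hdist H (dil r w) \<le> r * hdist H w" if "0 < r" for r w
  proof -
    have "hdist H (dil r w) / r \<le> hdist H w"
      unfolding hdist_def[of H w]
    proof (rule cINF_greatest)
      show "H \<noteq> {}"
        using GrD(1)[OF assms(1)] by auto
      fix v assume "v \<in> H"
      then have "hdist H (dil r w) \<le> d (dil r w) (dil r v)"
        using GrD(2)[OF assms(1) that] by (intro hdist_le)
      then show "hdist H (dil r w) / r \<le> d w v"
        using that by (simp add: d_dil field_simps)
    qed
    then show ?thesis
      using that by (simp add: field_simps)
  qed
  have "hdist H w = hdist H (dil (1 / r) (dil r w))"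
    using assms(2) by (simp add: dil_dil)
  also have "\<dots> \<le> 1 / r * hdist H (dil r w)"
    using assms(2) by (intro le) simp
  finally show ?thesis
    using le[OF assms(2), of w] assms(2) by (simp add: field_simps)
qed

lemma radon_cl_ball:
  assumes "radon_measure \<phi>"
  shows "emeasure \<phi> (cl_ball d x r) = ennreal (measure \<phi> (cl_ball d x r))"
  using assms compact_cl_ball[of x r]
  by (intro emeasure_eq_ennreal_measure) (auto simp: radon_measure_def)

lemma radon_measure_mono:
  assumes "radon_measure \<phi>" "A \<subseteq> B" "B \<subseteq> cl_ball d x r" "A \<in> sets borel" "B \<in> sets borel"
  shows "measure \<phi> A \<le> measure \<phi> B"
proof -
  have sets: "sets \<phi> = sets borel"
    using assms(1) by (simp add: radon_measure_def)
  have "emeasure \<phi> B \<le> emeasure \<phi> (cl_ball d x r)"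
    using assms sets closed_cl_ball by (intro emeasure_mono) auto
  then have "emeasure \<phi> B < \<infinity>"
    using assms(1) compact_cl_ball[of x r] by (auto simp: radon_measure_def intro: order.strict_trans1)
  then show ?thesis
    using assms sets by (intro measure_mono_fmeasurable) (auto simp: fmeasurable_def)
qed

lemma cone_complement_closed:
  assumes "H \<noteq> {}"
  shows "closed {y. d x y \<le> R \<and> s \<le> hdist H (- x \<cdot> y)}"
  using assms by (intro closed_Collect_conj closed_Collect_le continuous_intros) auto

text \<open>Otherwise there are radii tending to 0 at which the blow-ups have mass above
  \<open>e\<close> in a fixed compact region away from \<open>H\<close>. Finite upper density bounds
  the blow-ups on compact sets, so a subsequence converges to a tangent measure, which is
  concentrated on \<open>H\<close>. A continuous function that dominates the indicator of the region
  and vanishes on \<open>H\<close> contradicts this.\<close>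

lemma small_mass_off_tangent:
  assumes radon: "radon_measure \<phi>" and upper: "upper_density d h \<phi> x < \<infinity>"
    and H: "H \<in> Gr G \<kappa> V d h" and tan: "tangent_measures G \<kappa> V h \<phi> x \<subseteq> flat_measures d h H"
    and h: "1 \<le> h" and \<eta>: "0 < \<eta>" and e: "0 < e"
  shows "\<exists>r0>0. \<forall>r. 0 < r \<and> r < r0 \<longrightarrow>
    measure \<phi> {y. d x y \<le> 2 * r \<and> \<eta> * r \<le> hdist H (- x \<cdot> y)} \<le> e * r ^ h"
proof (rule ccontr)
  let ?F = "\<lambda>r. {y. d x y \<le> 2 * r \<and> \<eta> * r \<le> hdist H (- x \<cdot> y)}"
  have Hne: "H \<noteq> {}"
    using GrD(1)[OF H] by auto
  assume "\<not> ?thesis"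
  then have "\<forall>n. \<exists>r. 0 < r \<and> r < inverse (real (Suc n)) \<and> e * r ^ h < measure \<phi> (?F r)"
    by (meson inverse_positive_iff_positive not_le of_nat_0_less_iff zero_less_Suc)
  from choice[OF this] obtain r
    where "\<forall>n. 0 < r n \<and> r n < inverse (real (Suc n)) \<and> e * r n ^ h < measure \<phi> (?F (r n))" ..
  then have r: "\<And>n. 0 < r n" "\<And>n. r n < inverse (real (Suc n))"
      "\<And>n. e * r n ^ h < measure \<phi> (?F (r n))"
    by blast+
  have r0: "r \<longlonglongrightarrow> 0"
    using r(1,2) by (intro tendsto_sandwich[OF _ _ tendsto_const LIMSEQ_inverse_real_of_nat])
      (auto intro!: always_eventually less_imp_le)
  have sets_phi [measurable_cong]: "sets \<phi> = sets borel"
    using radon by (simp add: radon_measure_def)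
  have space_phi: "space \<phi> = UNIV"
    using sets_eq_imp_space_eq[OF sets_phi] by simp
  define T where "T i y = dil (1 / r i) (- x \<cdot> y)" for i y
  have T_cont: "continuous_on UNIV (T i)" for i
    unfolding T_def by (intro continuous_intros)
  have T_meas [measurable]: "T i \<in> borel \<rightarrow>\<^sub>M borel" for i
    using T_cont by (rule borel_measurable_continuous_onI)
  define \<mu> where "\<mu> i = scale_measure (ennreal (1 / r i ^ h)) (blow_up G \<kappa> V \<phi> x (r i))" for i
  have sets_mu [measurable_cong]: "sets (\<mu> i) = sets borel" for i
    by (simp add: \<mu>_def blow_up_def)
  have em: "emeasure (\<mu> i) A = ennreal (1 / r i ^ h) * emeasure \<phi> (T i -` A)" if "A \<in> sets borel" for i A
  proof -
    have "emeasure (distr \<phi> borel (T i)) A = emeasure \<phi> (T i -` A)"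
      using that by (subst emeasure_distr) (auto simp: space_phi)
    then show ?thesis
      by (simp add: \<mu>_def blow_up_def T_def inv_eq_minus[symmetric] cong: distr_cong)
  qed
  have d_T: "d 0 (T i y) = d x y / r i" for i y
    using r(1)[of i] by (simp add: T_def d_zero_dil d_translate[of x y])
  have hdist_T: "hdist H (T i y) = hdist H (- x \<cdot> y) / r i" for i y
    using r(1)[of i] hdist_dil[OF H, of "1 / r i"] by (simp add: T_def)
  have vimage_sub: "T i -` K \<subseteq> cl_ball d x (R * r i)" if "\<And>w. w \<in> K \<Longrightarrow> d 0 w \<le> R" for i K R
  proof
    fix y assume "y \<in> T i -` K"
    then have "d x y / r i \<le> R"
      using that[of "T i y"] d_T[of i y] by simp
    then show "y \<in> cl_ball d x (R * r i)"
      using r(1)[of i] by (simp add: cl_ball_eq field_simps)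
  qed
  have compact_bdd: "\<exists>R>0. \<forall>w\<in>K. d 0 w \<le> R" if "compact K" for K
  proof -
    have "compact ((\<lambda>w. d 0 w) ` K)"
      using that by (intro compact_continuous_image continuous_intros)
    then obtain B where "\<forall>t\<in>(\<lambda>w. d 0 w) ` K. norm t \<le> B"
      using compact_imp_bounded bounded_iff by blast
    then have "\<forall>w\<in>K. d 0 w \<le> max B 1"
      by fastforce
    then show ?thesis
      by (intro exI[of _ "max B 1"]) auto
  qed
  have radon_mu: "radon_measure (\<mu> i)" for i
    unfolding radon_measure_def
  proof (intro conjI allI impI)
    fix K :: "'a set" assume K: "compact K"
    then obtain R where R: "\<And>w. w \<in> K \<Longrightarrow> d 0 w \<le> R"
      using compact_bdd by blast
    have "emeasure \<phi> (T i -` K) \<le> emeasure \<phi> (cl_ball d x (R * r i))"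
      using vimage_sub[OF R] closed_cl_ball by (intro emeasure_mono) (auto simp: sets_phi)
    also have "\<dots> < \<infinity>"
      by (simp add: radon_cl_ball[OF radon])
    finally show "emeasure (\<mu> i) K < \<infinity>"
      using K by (subst em) (auto simp: ennreal_mult_less_top compact_imp_closed)
  qed (rule sets_mu)
  have meas: "measure (\<mu> i) A = measure \<phi> (T i -` A) / r i ^ h" if "A \<in> sets borel" for i A
    using r(1)[of i] by (simp add: measure_def em[OF that] enn2real_mult)
  \<comment> \<open>A compact set lies in a ball of some radius \<open>R\<close>. Its mass under a
    blow-up is controlled by the density quotient of \<open>\<phi>\<close> at radius
    \<open>R * r i\<close>, times \<open>R ^ h\<close>.\<close>
  have bseq: "Bseq (\<lambda>i. measure (\<mu> i) K)" if K: "compact K" for K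
  proof -
    obtain R where R: "0 < R" "\<And>w. w \<in> K \<Longrightarrow> d 0 w \<le> R"
      using compact_bdd[OF K] by blast
    obtain u where u: "upper_density d h \<phi> x = ennreal u" "0 \<le> u"
      using upper by (cases "upper_density d h \<phi> x") auto
    define C where "C = u + 1"
    have C: "upper_density d h \<phi> x < ennreal C"
      using u by (simp add: C_def ennreal_less_iff)
    have ev: "\<forall>\<^sub>F s in at_right 0. emeasure \<phi> (cl_ball d x s) / ennreal (s ^ h) < ennreal C"
      using C unfolding upper_density_def by (rule Limsup_lessD)
    have lim0: "(\<lambda>i. R * r i) \<longlonglongrightarrow> 0"
      using tendsto_mult[OF tendsto_const r0, of R] by simp
    have "R * r i \<in> {0<..} \<and> R * r i \<noteq> 0" for i
      using R(1) r(1)[of i] by simp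
    then have "\<forall>\<^sub>F i in sequentially. R * r i \<in> {0<..} \<and> R * r i \<noteq> 0"
      by simp
    with lim0 have "filterlim (\<lambda>i. R * r i) (at_right 0) sequentially"
      by (simp only: filterlim_at simp_thms)
    with ev have "\<forall>\<^sub>F i in sequentially. emeasure \<phi> (cl_ball d x (R * r i)) / ennreal ((R * r i) ^ h) < ennreal C"
      by (rule eventually_compose_filterlim)
    then have "\<forall>\<^sub>F i in sequentially. norm (measure (\<mu> i) K) \<le> C * R ^ h"
    proof eventually_elim
      case (elim i)
      have pos: "0 < (R * r i) ^ h"
        using R(1) r(1)[of i] by simp
      have "ennreal (measure \<phi> (cl_ball d x (R * r i)) / (R * r i) ^ h) < ennreal C"
        using elim pos by (simp add: radon_cl_ball[OF radon] divide_ennreal)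
      then have 1: "measure \<phi> (cl_ball d x (R * r i)) / (R * r i) ^ h < C"
        by (subst (asm) ennreal_less_iff) (use pos in auto)
      have "measure (\<mu> i) K = measure \<phi> (T i -` K) / r i ^ h"
        using K by (intro meas) (simp add: compact_imp_closed)
      also have "\<dots> \<le> measure \<phi> (cl_ball d x (R * r i)) / r i ^ h"
        using vimage_sub[OF R(2)] r(1)[of i] K measurable_sets[OF T_meas, of K i]
        by (intro divide_right_mono radon_measure_mono[OF radon, of _ _ x "R * r i"])
          (auto simp: compact_imp_closed closed_cl_ball borel_closed)
      also have "\<dots> = measure \<phi> (cl_ball d x (R * r i)) / (R * r i) ^ h * R ^ h"
        using R(1) by (simp add: power_mult_distrib)
      also have "\<dots> \<le> C * R ^ h"
        using 1 R(1) by (intro mult_right_mono) auto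
      finally show ?case
        by simp
    qed
    then show ?thesis
      by (rule BfunI)
  qed
  obtain s \<nu> where s: "strict_mono s" and nu: "radon_measure \<nu>" and conv: "weak_conv_Cc (\<mu> \<circ> s) \<nu>"
    using vague_compactness[of \<mu>] radon_mu bseq by blast
  have "\<nu> \<in> tangent_measures G \<kappa> V h \<phi> x"
    unfolding tangent_measures_def
  proof (intro CollectI conjI exI[of _ "r \<circ> s"] allI nu)
    show "(r \<circ> s) \<longlonglongrightarrow> 0"
      using r0 s by (rule LIMSEQ_subseq_LIMSEQ)
    show "0 < (r \<circ> s) i" for i
      using r(1) by simp
    show "weak_conv_Cc (\<lambda>i. scale_measure (ennreal (1 / (r \<circ> s) i ^ h)) (blow_up G \<kappa> V \<phi> x ((r \<circ> s) i))) \<nu>"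
      using conv by (simp add: \<mu>_def comp_def)
  qed
  then obtain c where sets_nu [measurable_cong]: "sets \<nu> = sets borel"
    and c: "\<And>A. A \<in> sets borel \<Longrightarrow> emeasure \<nu> A = ennreal c * spherical_measure d h (A \<inter> H)"
    using tan unfolding flat_measures_def by blast

  \<comment> \<open>The first factor is 0 on \<open>H\<close> and 1 at distance at least
    \<open>\<eta>\<close> from it. The second cuts off between the radii 2 and 3, which makes the
    support compact.\<close>
  define f where "f w = min 1 (hdist H w / \<eta>) * max 0 (min 1 (3 - d 0 w))" for w
  have f_cont: "continuous_on UNIV f"
    unfolding f_def using Hne \<eta> by (intro continuous_intros) auto
  have f_meas [measurable]: "f \<in> borel_measurable borel"
    using f_cont by (rule borel_measurable_continuous_onI)
  have f_bounds: "0 \<le> f w" "f w \<le> 1" for w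
    using hdist_nonneg[OF Hne, of w] \<eta> by (auto simp: f_def intro!: mult_nonneg_nonneg mult_le_one)
  have f_supp: "{w. f w \<noteq> 0} \<subseteq> cl_ball d 0 3"
    by (auto simp: f_def cl_ball_eq)
  have "compact (closure {w. f w \<noteq> 0})"
    using bounded_subset[OF compact_imp_bounded[OF compact_cl_ball] f_supp] by simp
  then have lim: "(\<lambda>i. \<integral>w. f w \<partial>\<mu> (s i)) \<longlonglongrightarrow> (\<integral>w. f w \<partial>\<nu>)"
    using conv f_cont unfolding weak_conv_Cc_def by simp
  have "{w. f w \<noteq> 0} \<inter> H = {}"
  proof -
    have "f w = 0" if "w \<in> H" for w
      using hdist_le[OF that, of w] hdist_nonneg[OF Hne, of w] by (simp add: f_def)
    then show ?thesis
      by auto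
  qed
  then have "emeasure \<nu> {w. f w \<noteq> 0} = 0"
    by (subst c) (auto simp: spherical_measure_empty[OF h])
  then have "AE w in \<nu>. f w = 0"
    using sets_eq_imp_space_eq[OF sets_nu] by (subst AE_iff_measurable[OF _ refl]) (auto simp: sets_nu)
  then have "(\<integral>w. f w \<partial>\<nu>) = 0"
    by (rule integral_eq_zero_AE)
  moreover have "e \<le> (\<integral>w. f w \<partial>\<mu> i)" for i
  proof -
    let ?A = "{w. d 0 w \<le> 2 \<and> \<eta> \<le> hdist H w}"
    have A_sets: "?A \<in> sets borel"
      using cone_complement_closed[OF Hne, of 0 2 \<eta>] by simp
    have int_ball: "integrable (\<mu> i) (indicator (cl_ball d 0 3) :: 'a \<Rightarrow> real)"
      using radon_mu[of i] compact_cl_ball[of 0 3] closed_cl_ball[of 0 3]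
      by (intro integrable_real_indicator) (auto simp: sets_mu radon_measure_def)
    have int_f: "integrable (\<mu> i) f"
    proof (rule Bochner_Integration.integrable_bound[OF int_ball])
      show "f \<in> borel_measurable (\<mu> i)"
        by measurable
      show "AE w in \<mu> i. norm (f w) \<le> norm (indicator (cl_ball d 0 3) w :: real)"
      proof (rule AE_I2)
      show "norm (f w) \<le> norm (indicator (cl_ball d 0 3) w :: real)" for w
          using f_bounds[of w] f_supp by (cases "w \<in> cl_ball d 0 3") auto
      qed
    qed
    have int_A: "integrable (\<mu> i) (indicator ?A :: 'a \<Rightarrow> real)"
    proof (rule Bochner_Integration.integrable_bound[OF int_ball])
      show "(indicator ?A :: 'a \<Rightarrow> real) \<in> borel_measurable (\<mu> i)"
        by (rule borel_measurable_indicator) (simp only: sets_mu A_sets)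
      show "AE w in \<mu> i. norm (indicator ?A w :: real) \<le> norm (indicator (cl_ball d 0 3) w :: real)"
        by (rule AE_I2) (simp add: indicator_def cl_ball_eq)
    qed
    have "T i -` ?A = ?F (r i)"
    proof (rule Set.set_eqI)
      show "y \<in> T i -` ?A \<longleftrightarrow> y \<in> ?F (r i)" for y
        using r(1)[of i] by (simp add: d_T hdist_T pos_divide_le_eq pos_le_divide_eq)
    qed
    then have "e < measure (\<mu> i) ?A"
      using r(1)[of i] r(3)[of i] by (simp add: meas[OF A_sets] pos_less_divide_eq)
    also have "\<dots> = (\<integral>w. indicator ?A w \<partial>\<mu> i)"
      using A_sets sets_eq_imp_space_eq[OF sets_mu[of i]] by simp
    also have "\<dots> \<le> (\<integral>w. f w \<partial>\<mu> i)"
    proof (rule integral_mono[OF int_A int_f])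
      show "indicator ?A w \<le> f w" for w
      proof (cases "w \<in> ?A")
        case True
        then have "f w = 1"
          using \<eta> by (simp add: f_def)
        then show ?thesis
          using True by simp
      next
        case False
        then show ?thesis
          using f_bounds(1)[of w] by (simp del: mem_Collect_eq)
      qed
    qed
    finally show ?thesis
      by simp
  qed
  then have "e \<le> (\<integral>w. f w \<partial>\<nu>)"
    using lim by (intro LIMSEQ_le_const[OF lim]) auto
  ultimately show False
    using e by simp
qed

text \<open>A subgroup is recorded by the set of those points of a finite net for the ball of radius
  3 that lie within \<open>\<eta> / 2\<close> of it. There are finitely many records, and
  \<open>D\<close> keeps one subgroup for each. Radius 3 leaves room for a point at distance at most
  2 from 0 plus an error of at most 1.\<close>

lemma finite_approximating_family:
  assumes "0 < \<eta>"
  obtains D where "finite D" "D \<subseteq> Gr G \<kappa> V d h"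
    "\<And>H. H \<in> Gr G \<kappa> V d h \<Longrightarrow> \<exists>W\<in>D. \<forall>v\<in>H. d 0 v \<le> 3 \<longrightarrow> (\<exists>v'\<in>W. d v v' \<le> \<eta>)"
proof -
  let ?U = "\<lambda>q. {y. d q y < \<eta> / 2}"
  have "open (?U q)" for q
    by (intro open_Collect_less continuous_intros)
  moreover have "cl_ball d 0 3 \<subseteq> (\<Union>q\<in>UNIV. ?U q)"
  proof
    show "y \<in> (\<Union>q\<in>UNIV. ?U q)" for y
      using assms by (intro UN_I[of y]) auto
  qed
  ultimately obtain N where N: "finite N" "cl_ball d 0 3 \<subseteq> (\<Union>q\<in>N. ?U q)"
    using compactE_image[OF compact_cl_ball, of UNIV ?U 0 3] by metis
  define P where "P H = {q\<in>N. \<exists>v\<in>H. d q v < \<eta> / 2}" for H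
  have "finite (P ` Gr G \<kappa> V d h)"
    by (rule finite_subset[of _ "Pow N"]) (auto simp: P_def N(1))
  then obtain D where D: "D \<subseteq> Gr G \<kappa> V d h" "finite D" "P ` Gr G \<kappa> V d h = P ` D"
    by (meson finite_subset_image order_refl)
  show ?thesis
  proof (rule that[OF D(2,1)])
    fix H assume "H \<in> Gr G \<kappa> V d h"
    then obtain W where W: "W \<in> D" "P H = P W"
      using D(3) by (metis imageE imageI)
    have "\<exists>v'\<in>W. d v v' \<le> \<eta>" if v: "v \<in> H" "d 0 v \<le> 3" for v
    proof -
      obtain q where q: "q \<in> N" "d q v < \<eta> / 2"
        using v(2) N(2) by (auto simp: cl_ball_eq)
      then have "q \<in> P W"
        using v(1) W(2) by (auto simp: P_def)
      then obtain v' where "v' \<in> W" "d q v' < \<eta> / 2"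
        by (auto simp: P_def)
      then show ?thesis
        using q(2) triangle[of v q v'] commute[of v q] by force
    qed
    with W(1) show "\<exists>W\<in>D. \<forall>v\<in>H. d 0 v \<le> 3 \<longrightarrow> (\<exists>v'\<in>W. d v v' \<le> \<eta>)"
      by blast
  qed
qed

text \<open>The lower bound guarantees mass \<open>(\<alpha> / 2 * r) ^ h / real (Suc k)\<close> to
  a ball of radius \<open>\<alpha> / 2 * r\<close> around such a point. The mass allowed off the
  cone is half of this, so that no such ball fits there.\<close>

definition flat_points :: "'a measure \<Rightarrow> nat \<Rightarrow> real \<Rightarrow> 'a set \<Rightarrow> nat \<Rightarrow> nat \<Rightarrow> 'a set" where
  "flat_points \<phi> h \<alpha> W k l = {x. \<forall>r. 0 < r \<and> r < 1 / real (Suc l) \<longrightarrow>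
     r ^ h / real (Suc k) \<le> measure \<phi> (cl_ball d x r) \<and>
     measure \<phi> {y. d x y \<le> 2 * r \<and> \<alpha> / 2 * r \<le> hdist W (- x \<cdot> y)} \<le> (\<alpha> / 2) ^ h / (2 * real (Suc k)) * r ^ h}"

text \<open>If y left the cone of opening \<open>\<alpha>\<close> at x, a ball around y of radius comparable to
  the distance of x and y would lie far from the translate of W by x, where there is too little mass.\<close>

lemma flat_points_cone:
  assumes radon: "radon_measure \<phi>" and \<alpha>: "0 < \<alpha>" "\<alpha> \<le> 1" and W: "W \<in> Gr G \<kappa> V d h'"
    and x: "x \<in> flat_points \<phi> h \<alpha> W k l" and y: "y \<in> flat_points \<phi> h \<alpha> W k l"
    and near: "d x y < 1 / real (Suc l)"
  shows "hdist W (- x \<cdot> y) \<le> \<alpha> * d x y"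
proof (rule ccontr)
  assume "\<not> ?thesis"
  then have far: "\<alpha> * d x y < hdist W (- x \<cdot> y)"
    by simp
  have Wne: "W \<noteq> {}"
    using GrD(1)[OF W] by auto
  define r where "r = d x y"
  have "x \<noteq> y"
    using far hdist_le[OF GrD(1)[OF W], of 0] by auto
  then have r: "0 < r"
    by (simp add: r_def)
  let ?A = "{z. d x z \<le> 2 * r \<and> \<alpha> / 2 * r \<le> hdist W (- x \<cdot> z)}"
  \<comment> \<open>Moving from \<open>y\<close> by at most \<open>\<alpha> / 2 * r\<close> loses at
    most half of the distance \<open>\<alpha> * r\<close> to the subgroup. As
    \<open>\<alpha> \<le> 1\<close>, it also stays within \<open>2 * r\<close> of
    \<open>x\<close>.\<close>
  have "cl_ball d y (\<alpha> / 2 * r) \<subseteq> ?A"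
  proof
    fix z assume "z \<in> cl_ball d y (\<alpha> / 2 * r)"
    then have z: "d y z \<le> \<alpha> / 2 * r"
      by (simp add: cl_ball_eq)
    have "\<alpha> / 2 * r \<le> r"
      using \<alpha> r by simp
    then have "d x z \<le> 2 * r"
      using triangle[of x y z] z by (simp add: r_def)
    moreover have "\<alpha> / 2 * r \<le> hdist W (- x \<cdot> z)"
      using hdist_triangle[OF Wne, of "- x \<cdot> y" "- x \<cdot> z"] left_invariant[of "- x" y z] z far
      by (simp add: r_def)
    ultimately show "z \<in> ?A"
      by simp
  qed
  then have "measure \<phi> (cl_ball d y (\<alpha> / 2 * r)) \<le> measure \<phi> ?A"
  proof (rule radon_measure_mono[OF radon])
    show "?A \<subseteq> cl_ball d x (2 * r)"
      by (auto simp: cl_ball_eq)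
    show "cl_ball d y (\<alpha> / 2 * r) \<in> sets borel"
      by (rule borel_closed[OF closed_cl_ball])
    show "?A \<in> sets borel"
      by (rule borel_closed[OF cone_complement_closed[OF Wne]])
  qed
  also have "\<dots> \<le> (\<alpha> / 2) ^ h / (2 * real (Suc k)) * r ^ h"
    using x near r unfolding flat_points_def r_def by blast
  also have "\<dots> < (\<alpha> / 2) ^ h / real (Suc k) * r ^ h"
    using \<alpha> r by (intro mult_strict_right_mono divide_strict_left_mono) auto
  also have "\<dots> = (\<alpha> / 2 * r) ^ h / real (Suc k)"
    unfolding power_mult_distrib by (rule times_divide_eq_left)
  also have "\<dots> \<le> measure \<phi> (cl_ball d y (\<alpha> / 2 * r))"
  proof -
    have "\<alpha> / 2 * r \<le> 1 * r"
      using \<alpha> r by (intro mult_right_mono) auto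
    moreover have "r < 1 / real (Suc l)"
      using near by (simp only: r_def)
    moreover have "0 < \<alpha> / 2 * r"
      using \<alpha> r by simp
    ultimately have "0 < \<alpha> / 2 * r \<and> \<alpha> / 2 * r < 1 / real (Suc l)"
      by linarith
    then show ?thesis
      using y unfolding flat_points_def by blast
  qed
  finally show False
    by simp
qed

lemma closure_cone_set:
  assumes W: "W \<noteq> {}" and cone: "\<And>x y. x \<in> S \<Longrightarrow> y \<in> S \<Longrightarrow> hdist W (- x \<cdot> y) \<le> \<alpha> * d x y"
  shows "cone_set G d W \<alpha> (closure S)"
  unfolding cone_set_def
proof (intro ballI subsetI)
  fix p y assume py: "p \<in> closure S" "y \<in> closure S"
  \<comment> \<open>Vertex and point are treated as one pair, so that both may be limits of points
    of \<open>S\<close> at the same time.\<close>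
  let ?C = "{z. hdist W (- fst z \<cdot> snd z) \<le> \<alpha> * d (fst z) (snd z)}"
  have "closed ?C"
    using W by (intro closed_Collect_le continuous_intros)
  then have "closure (S \<times> S) \<subseteq> ?C"
    using cone by (intro closure_minimal) auto
  then have "hdist W (- p \<cdot> y) \<le> \<alpha> * d p y"
    using py by (auto simp: closure_Times)
  also have "d p y = d (- p \<cdot> y) 0"
    using d_translate[of p y] commute[of 0 "- p \<cdot> y"] by simp
  finally have "- p \<cdot> y \<in> cone_around d W \<alpha>"
    by (simp add: cone_around_def hdist_def)
  then show "y \<in> p <#\<^bsub>G\<^esub> cone_around d W \<alpha>"
    unfolding l_coset_def by (auto intro!: bexI[of _ "- p \<cdot> y"])
qed

text \<open>Positive lower density provides \<open>k\<close>. This fixes the admissible mass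
  \<open>e\<close>, for which the tangent condition along \<open>H\<close> provides a radius, and
  then \<open>l\<close>. Replacing \<open>H\<close> by \<open>W\<close> is safe: a point within
  \<open>\<alpha> / 8 * r\<close> of \<open>H\<close> is, after rescaling to unit size, within
  \<open>\<alpha> / 4 * r\<close> of \<open>W\<close>. Hence points far from \<open>W\<close> are
  far from \<open>H\<close>.\<close>

lemma flat_points_exhaust:
  assumes radon: "radon_measure \<phi>" and h: "1 \<le> h" and \<alpha>: "0 < \<alpha>" "\<alpha> \<le> 1"
    and lower: "0 < lower_density d h \<phi> x" and upper: "upper_density d h \<phi> x < \<infinity>"
    and H: "H \<in> Gr G \<kappa> V d h" and tan: "tangent_measures G \<kappa> V h \<phi> x \<subseteq> flat_measures d h H"
    and W: "W \<in> Gr G \<kappa> V d h"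
    and HW: "\<forall>v\<in>H. d 0 v \<le> 3 \<longrightarrow> (\<exists>v'\<in>W. d v v' \<le> \<alpha> / 8)"
  shows "\<exists>k l. x \<in> flat_points \<phi> h \<alpha> W k l"
proof -
  have Hne: "H \<noteq> {}"
    using GrD(1)[OF H] by auto
  have Wne: "W \<noteq> {}"
    using GrD(1)[OF W] by auto
  obtain c where c: "0 < c" "c < lower_density d h \<phi> x"
    using dense[OF lower] by blast
  then have "c < \<infinity>"
    by (auto simp: less_top intro: order.strict_trans2)
  then obtain c' where c': "c = ennreal c'" "0 < c'"
    using c(1) by (cases c) auto
  obtain k where k: "1 / real (Suc k) < c'"
    using c'(2) nat_approx_posE by blast
  have "\<forall>\<^sub>F r in at_right 0. c < emeasure \<phi> (cl_ball d x r) / ennreal (r ^ h)"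
    using c(2) unfolding lower_density_def by (rule less_LiminfD)
  then obtain b where b: "0 < b" "\<And>r. 0 < r \<Longrightarrow> r < b \<Longrightarrow> c < emeasure \<phi> (cl_ball d x r) / ennreal (r ^ h)"
    unfolding eventually_at_right_field by auto
  have low: "r ^ h / real (Suc k) \<le> measure \<phi> (cl_ball d x r)" if "0 < r" "r < b" for r
  proof -
    have "ennreal c' < ennreal (measure \<phi> (cl_ball d x r) / r ^ h)"
      using b(2)[OF that] that(1) by (simp add: c' radon_cl_ball[OF radon] divide_ennreal)
    then have "c' < measure \<phi> (cl_ball d x r) / r ^ h"
      using c'(2) by (subst (asm) ennreal_less_iff) auto
    then have "1 / real (Suc k) < measure \<phi> (cl_ball d x r) / r ^ h"
      using k by linarith
    then have "1 / real (Suc k) * r ^ h < measure \<phi> (cl_ball d x r)"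
      using that(1) by (subst (asm) pos_less_divide_eq) auto
    then show ?thesis
      by simp
  qed
  define e where "e = (\<alpha> / 2) ^ h / (2 * real (Suc k))"
  have "0 < e"
    using \<alpha> by (simp add: e_def)
  obtain r0 where r0: "0 < r0" "\<And>r. 0 < r \<Longrightarrow> r < r0 \<Longrightarrow>
      measure \<phi> {y. d x y \<le> 2 * r \<and> \<alpha> / 8 * r \<le> hdist H (- x \<cdot> y)} \<le> e * r ^ h"
    using small_mass_off_tangent[OF radon upper H tan h _ \<open>0 < e\<close>, of "\<alpha> / 8"] \<alpha> by auto
  obtain l where l: "1 / real (Suc l) < min b r0"
    using b(1) r0(1) nat_approx_posE[of "min b r0"] by auto
  have "measure \<phi> {y. d x y \<le> 2 * r \<and> \<alpha> / 2 * r \<le> hdist W (- x \<cdot> y)} \<le> e * r ^ h"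
    if r: "0 < r" "r < r0" for r
  proof -
    have "{y. d x y \<le> 2 * r \<and> \<alpha> / 2 * r \<le> hdist W (- x \<cdot> y)}
        \<subseteq> {y. d x y \<le> 2 * r \<and> \<alpha> / 8 * r \<le> hdist H (- x \<cdot> y)}"
    proof (intro subsetI CollectI conjI; elim CollectE conjE)
      fix y assume y: "d x y \<le> 2 * r" "\<alpha> / 2 * r \<le> hdist W (- x \<cdot> y)"
      show "\<alpha> / 8 * r \<le> hdist H (- x \<cdot> y)"
      proof (rule ccontr)
        let ?u = "- x \<cdot> y"
        assume "\<not> \<alpha> / 8 * r \<le> hdist H ?u"
        then have "hdist H ?u < \<alpha> / 8 * r"
          by simp
        then obtain v where v: "v \<in> H" "d ?u v < \<alpha> / 8 * r"
          using Hne by (rule hdist_lessE)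
        let ?v = "dil (1 / r) v"
        have "\<alpha> / 8 * r \<le> 1 * r"
          using r \<alpha> by (intro mult_right_mono) auto
        then have "d 0 v \<le> 3 * r"
          using triangle[of 0 ?u v, OF UNIV_I UNIV_I UNIV_I] v(2) y(1) r(1) d_translate[of x y] by linarith
        then have "d 0 ?v \<le> 3"
          using r(1) by (simp add: d_zero_dil field_simps)
        moreover have "?v \<in> H"
          using GrD(2)[OF H _ v(1)] r(1) by simp
        ultimately obtain v' where v': "v' \<in> W" "d ?v v' \<le> \<alpha> / 8"
          using HW by blast
        have "d v (dil r v') = r * d ?v v'"
          using d_dil[OF r(1), of ?v v'] r(1) by (simp add: dil_dil)
        also have "\<dots> \<le> \<alpha> / 8 * r"
          using v'(2) r(1) by simp
        finally have "d ?u (dil r v') < \<alpha> / 4 * r"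
          using triangle[of ?u v "dil r v'"] v(2) by simp
        moreover have "dil r v' \<in> W"
          using GrD(2)[OF W r(1) v'(1)] .
        moreover have "\<alpha> / 4 * r \<le> \<alpha> / 2 * r"
          using \<alpha> r by simp
        ultimately show False
          using hdist_le[of "dil r v'" W ?u] y(2) by linarith
      qed
    qed
    then have "measure \<phi> {y. d x y \<le> 2 * r \<and> \<alpha> / 2 * r \<le> hdist W (- x \<cdot> y)}
        \<le> measure \<phi> {y. d x y \<le> 2 * r \<and> \<alpha> / 8 * r \<le> hdist H (- x \<cdot> y)}"
    proof (rule radon_measure_mono[OF radon])
      show "{y. d x y \<le> 2 * r \<and> \<alpha> / 8 * r \<le> hdist H (- x \<cdot> y)} \<subseteq> cl_ball d x (2 * r)"
        by (auto simp: cl_ball_eq)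
      show "{y. d x y \<le> 2 * r \<and> \<alpha> / 2 * r \<le> hdist W (- x \<cdot> y)} \<in> sets borel"
        by (rule borel_closed[OF cone_complement_closed[OF Wne]])
      show "{y. d x y \<le> 2 * r \<and> \<alpha> / 8 * r \<le> hdist H (- x \<cdot> y)} \<in> sets borel"
        by (rule borel_closed[OF cone_complement_closed[OF Hne]])
    qed
    also have "\<dots> \<le> e * r ^ h"
      using r by (rule r0(2))
    finally show ?thesis .
  qed
  then have "x \<in> flat_points \<phi> h \<alpha> W k l"
    using low l unfolding flat_points_def e_def by auto
  then show ?thesis
    by blast
qed

theorem P_rectifiable_cone_cover:
  assumes h: "1 \<le> h" and rect: "P_rectifiable G \<kappa> V d h \<phi>" and Gr_ne: "Gr G \<kappa> V d h \<noteq> {}"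
    and "0 < \<alpha>"
  shows "\<exists>H \<Gamma>. (\<forall>i::nat. H i \<in> Gr G \<kappa> V d h \<and> compact (\<Gamma> i) \<and> cone_set G d (H i) \<alpha> (\<Gamma> i)) \<and>
           emeasure \<phi> (UNIV - (\<Union>i. \<Gamma> i)) = 0"
proof -
  \<comment> \<open>The mass comparison is made for openings at most 1, and cones grow with their
    opening.\<close>
  define \<beta> where "\<beta> = min \<alpha> 1"
  have \<beta>: "0 < \<beta>" "\<beta> \<le> 1" "\<beta> \<le> \<alpha>"
    using \<open>0 < \<alpha>\<close> by (auto simp: \<beta>_def)
  have radon: "radon_measure \<phi>"
    using rect by (simp add: P_rectifiable_def)
  have sets_phi: "sets \<phi> = sets borel"
    using radon by (simp add: radon_measure_def)
  obtain D where D: "finite D" "D \<subseteq> Gr G \<kappa> V d h"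
    "\<And>H. H \<in> Gr G \<kappa> V d h \<Longrightarrow> \<exists>W\<in>D. \<forall>v\<in>H. d 0 v \<le> 3 \<longrightarrow> (\<exists>v'\<in>W. d v v' \<le> \<beta> / 8)"
    using finite_approximating_family[of "\<beta> / 8" h] \<beta> by auto
  obtain Q :: "'a set" where Q: "countable Q" "\<And>X. open X \<Longrightarrow> X \<noteq> {} \<Longrightarrow> \<exists>q\<in>Q. q \<in> X"
    using countable_dense_setE by blast
  \<comment> \<open>Two points of one piece are at most \<open>2 / (3 * real (Suc l))\<close> apart,
    which is inside the range where \<open>flat_points_cone\<close> applies. Centres from a
    countable dense set reach every point.\<close>
  define piece where "piece = (\<lambda>(W, k, l, q).
    (W, closure (flat_points \<phi> h \<beta> W k l \<inter> cl_ball d q (1 / (3 * real (Suc l))))))"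
  obtain W0 where W0: "W0 \<in> Gr G \<kappa> V d h"
    using Gr_ne by blast
  \<comment> \<open>The pair with the empty set makes the family visibly nonempty, as its
    enumeration by the natural numbers requires; the empty set is a cone set for every
    subgroup.\<close>
  define \<S> where "\<S> = insert (W0, {}) (piece ` (D \<times> UNIV \<times> UNIV \<times> Q))"
  have "countable (D \<times> (UNIV :: nat set) \<times> (UNIV :: nat set) \<times> Q)"
    by (simp add: countable_finite[OF D(1)] Q(1))
  then have "countable \<S>"
    unfolding \<S>_def by (intro countable_insert countable_image)
  have good: "fst s \<in> Gr G \<kappa> V d h \<and> compact (snd s) \<and> cone_set G d (fst s) \<alpha> (snd s)" if "s \<in> \<S>" for s
  proof -
    consider "s = (W0, {})" | W k l q where "W \<in> D" "s = piece (W, k, l, q)"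
      using \<open>s \<in> \<S>\<close> by (auto simp: \<S>_def)
    then show ?thesis
    proof cases
      case 1
      then show ?thesis
        using W0 by (simp add: cone_set_def)
    next
      case 2
      let ?S = "flat_points \<phi> h \<beta> W k l \<inter> cl_ball d q (1 / (3 * real (Suc l)))"
      have W: "W \<in> Gr G \<kappa> V d h"
        using 2 D(2) by blast
      have "compact (closure ?S)"
        using bounded_subset[OF compact_imp_bounded[OF compact_cl_ball], of ?S q "1 / (3 * real (Suc l))"] by simp
      moreover have "cone_set G d W \<alpha> (closure ?S)"
      proof (rule closure_cone_set)
        show "W \<noteq> {}"
          using GrD(1)[OF W] by auto
        fix x y assume xy: "x \<in> ?S" "y \<in> ?S"
        have "d x y \<le> 1 / (3 * real (Suc l)) + 1 / (3 * real (Suc l))"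
          using xy triangle[of x q y] commute[of x q] by (simp add: cl_ball_eq)
        also have "\<dots> < 1 / real (Suc l)"
          by (simp add: field_simps)
        finally have "hdist W (- x \<cdot> y) \<le> \<beta> * d x y"
          using xy by (intro flat_points_cone[OF radon \<beta>(1,2) W]) auto
        also have "\<dots> \<le> \<alpha> * d x y"
          using \<beta>(3) by (intro mult_right_mono) auto
        finally show "hdist W (- x \<cdot> y) \<le> \<alpha> * d x y" .
      qed
      ultimately show ?thesis
        using 2(2) W by (simp add: piece_def)
    qed
  qed
  define s where "s = from_nat_into \<S>"
  have s: "range s = \<S>"
    unfolding s_def using \<open>countable \<S>\<close> by (intro range_from_nat_into) (auto simp: \<S>_def)
  have cover: "x \<in> (\<Union>i. snd (s i))"
    if x: "0 < lower_density d h \<phi> x" "upper_density d h \<phi> x < \<infinity>"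
      "\<exists>H\<in>Gr G \<kappa> V d h. tangent_measures G \<kappa> V h \<phi> x \<subseteq> flat_measures d h H" for x
  proof -
    obtain H where H: "H \<in> Gr G \<kappa> V d h" "tangent_measures G \<kappa> V h \<phi> x \<subseteq> flat_measures d h H"
      using x(3) by blast
    obtain W where W: "W \<in> D" "\<forall>v\<in>H. d 0 v \<le> 3 \<longrightarrow> (\<exists>v'\<in>W. d v v' \<le> \<beta> / 8)"
      using D(3)[OF H(1)] by blast
    then obtain k l where kl: "x \<in> flat_points \<phi> h \<beta> W k l"
      using flat_points_exhaust[OF radon h \<beta>(1,2) x(1,2) H _ W(2)] D(2) by blast
    let ?U = "{q. d q x < 1 / (3 * real (Suc l))}"
    have "open ?U"
      by (intro open_Collect_less continuous_intros)
    moreover have "x \<in> ?U"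
      by simp
    ultimately obtain q where q: "q \<in> Q" "q \<in> ?U"
      using Q(2) by blast
    have "x \<in> snd (piece (W, k, l, q))"
      using kl q(2) closure_subset by (force simp: piece_def cl_ball_eq)
    moreover have "piece (W, k, l, q) \<in> \<S>"
      using W(1) q(1) by (auto simp: \<S>_def)
    ultimately show ?thesis
      using s by (metis UN_iff UNIV_I imageE)
  qed
  have "AE x in \<phi>. x \<in> (\<Union>i. snd (s i))"
    using rect[unfolded P_rectifiable_def, THEN conjunct2] by eventually_elim (use cover in blast)
  moreover have "UNIV - (\<Union>i. snd (s i)) \<in> sets \<phi>"
  proof -
    have "snd (s i) \<in> sets borel" for i
      using good[of "s i"] s by (auto simp: compact_imp_closed)
    then show ?thesis
      unfolding sets_phi by auto
  qed
  moreover have "{x \<in> space \<phi>. x \<notin> (\<Union>i. snd (s i))} = UNIV - (\<Union>i. snd (s i))"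
    using sets_eq_imp_space_eq[OF sets_phi] by auto
  ultimately have "emeasure \<phi> (UNIV - (\<Union>i. snd (s i))) = 0"
    using AE_iff_measurable by metis
  moreover have "fst (s i) \<in> Gr G \<kappa> V d h \<and> compact (snd (s i)) \<and> cone_set G d (fst (s i)) \<alpha> (snd (s i))" for i
    using good[of "s i"] s by blast
  ultimately show ?thesis
    by (intro exI[of _ "\<lambda>i. fst (s i)"] exI[of _ "\<lambda>i. snd (s i)"]) blast
qed

end

section \<open>The group law modulo higher layers\<close>

text \<open>The inner product with a vector orthogonal to \<open>S\<close> is constant along the
  curve. This does the work of integrating the derivative and asks for no continuity of it.\<close>

lemma curve_diff_in_subspace:
  fixes \<gamma> :: "real \<Rightarrow> 'a::euclidean_space"
  assumes S: "subspace S" and der: "\<And>t. (\<gamma> has_vector_derivative \<gamma>' t) (at t)" and mem: "\<And>t. \<gamma>' t \<in> S"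
  shows "\<gamma> b - \<gamma> a \<in> S"
proof -
  obtain y z where y: "y \<in> span S" and z: "\<And>w. w \<in> span S \<Longrightarrow> orthogonal z w" and eq: "\<gamma> b - \<gamma> a = y + z"
    using orthogonal_subspace_decomp_exists by blast
  have "((\<lambda>t. z \<bullet> \<gamma> t) has_real_derivative 0) (at t)" for t
  proof -
    have "((\<lambda>t. z \<bullet> \<gamma> t) has_vector_derivative z \<bullet> \<gamma>' t) (at t)"
      using der[of t] by (rule bounded_linear.has_vector_derivative[OF bounded_linear_inner_right])
    moreover have "z \<bullet> \<gamma>' t = 0"
      using z[OF span_base[OF mem[of t]]] by (simp add: orthogonal_def)
    ultimately show ?thesis
      by (simp add: has_real_derivative_iff_has_vector_derivative)
  qed
  then have "z \<bullet> \<gamma> b = z \<bullet> \<gamma> a"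
    by (intro DERIV_isconst_all) auto
  then have "z \<bullet> (y + z) = 0"
    unfolding eq[symmetric] by (simp add: inner_diff_right)
  moreover have "z \<bullet> y = 0"
    using z[OF y] by (simp add: orthogonal_def)
  ultimately have "z = 0"
    by (simp add: inner_add_right)
  with eq have "\<gamma> b - \<gamma> a = y"
    by simp
  moreover have "span S = S"
    using S by (simp only: span_eq_iff)
  ultimately show ?thesis
    using y by metis
qed

text \<open>Along a one-parameter subgroup derivatives are computed at parameter 0, and the group
  law moves them to \<open>t\<close>.\<close>

lemma has_vector_derivative_unshift:
  fixes f :: "real \<Rightarrow> 'a::real_normed_vector"
  assumes "((\<lambda>s. f (s + t)) has_vector_derivative f') (at 0)"
  shows "(f has_vector_derivative f') (at t)"
proof -
  have 1: "((\<lambda>u. u - t) has_vector_derivative 1) (at t)"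
    unfolding has_real_derivative_iff_has_vector_derivative[symmetric]
    by (auto intro!: derivative_eq_intros)
  have 2: "((\<lambda>s. f (s + t)) has_vector_derivative f') (at (t - t))"
    using assms by simp
  show ?thesis
    using vector_diff_chain_at[OF 1 2] by (simp add: comp_def)
qed

lemma has_derivative_along_ray:
  assumes "(f has_derivative f') (at 0)"
  shows "((\<lambda>t. f (t *\<^sub>R w)) has_vector_derivative f' w) (at 0)"
proof -
  have 1: "((\<lambda>t. t *\<^sub>R w) has_derivative (\<lambda>h. h *\<^sub>R w)) (at (0::real))"
    by (auto intro!: derivative_eq_intros)
  have 2: "(f has_derivative f') (at ((0::real) *\<^sub>R w))"
    using assms by simp
  have "((\<lambda>t. f (t *\<^sub>R w)) has_derivative (\<lambda>h. f' (h *\<^sub>R w))) (at 0)"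
    by (rule has_derivative_compose[OF 1 2])
  moreover have "f' (h *\<^sub>R w) = h *\<^sub>R f' w" for h
    using has_derivative_linear[OF assms] by (rule linear_scale)
  ultimately show ?thesis
    unfolding has_vector_derivative_def by simp
qed

section \<open>Translations, conjugation and the bracket\<close>

context carnot_group
begin

text \<open>The differential at 0 of left translation by \<open>p\<close>, that is, the value at
  \<open>p\<close> of the left-invariant field of \<open>v\<close>.\<close>

definition left_deriv :: "'a \<Rightarrow> 'a \<Rightarrow> 'a" where
  "left_deriv p v = mul_deriv (p, 0) (0, v)"

lemma mul_deriv_add: "mul_deriv z (u + u') = mul_deriv z u + mul_deriv z u'"
  by (rule linear_add[OF linear_mul_deriv])

lemma mul_deriv_snd_linear: "linear (\<lambda>v. mul_deriv z (0, v))"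
proof (rule linearI)
  show "mul_deriv z (0, u + v) = mul_deriv z (0, u) + mul_deriv z (0, v)" for u v
    using mul_deriv_add[of z "(0, u)" "(0, v)"] by simp
  show "mul_deriv z (0, c *\<^sub>R v) = c *\<^sub>R mul_deriv z (0, v)" for c v
    using linear_scale[OF linear_mul_deriv, of z c "(0, v)"] by simp
qed

lemma linear_left_deriv: "linear (left_deriv p)"
  using mul_deriv_snd_linear unfolding left_deriv_def .

lemma left_inv_field_eq: "left_inv_field G v p = left_deriv p v"
proof -
  have "((\<lambda>q. p \<cdot> q) has_derivative (\<lambda>h. mul_deriv (p, 0) (0, h))) (at 0)"
    using has_derivative_mul[of "\<lambda>q. p" "\<lambda>h. 0" 0 UNIV "\<lambda>q. q" "\<lambda>h. h"] by simp
  from frechet_derivative_at[OF this] show ?thesis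
    by (simp add: left_inv_field_def left_deriv_def fun_eq_iff)
qed

lemma mul_vector_derivative:
  assumes "(f has_vector_derivative f') (at t)" "(g has_vector_derivative g') (at t)"
  shows "((\<lambda>t. f t \<cdot> g t) has_vector_derivative mul_deriv (f t, g t) (f', g')) (at t)"
proof -
  have "((\<lambda>t. f t \<cdot> g t) has_derivative (\<lambda>h. mul_deriv (f t, g t) (h *\<^sub>R f', h *\<^sub>R g'))) (at t)"
    using assms unfolding has_vector_derivative_def by (rule has_derivative_mul)
  then show ?thesis
    unfolding has_vector_derivative_def
    using linear_scale[OF linear_mul_deriv, of "(f t, g t)" _ "(f', g')"] by simp
qed

lemma ray_vector_derivative: "((\<lambda>s. s *\<^sub>R v) has_vector_derivative v) (at t)"
  by (auto intro!: derivative_eq_intros simp: has_vector_derivative_def)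

lemma left_deriv_ray: "((\<lambda>s. p \<cdot> (s *\<^sub>R v)) has_vector_derivative left_deriv p v) (at 0)"
  using mul_vector_derivative[OF has_vector_derivative_const[of p] ray_vector_derivative[of v 0]]
  by (simp add: left_deriv_def)

text \<open>Since the inverse is negation, right translation by \<open>p\<close> is left translation
  by \<open>- p\<close> with negation applied before and after. Right translations thus need no
  separate calculus.\<close>

lemma right_deriv_ray: "((\<lambda>s. (s *\<^sub>R v) \<cdot> p) has_vector_derivative left_deriv (- p) v) (at 0)"
proof -
  have "((\<lambda>s. - (- p \<cdot> (s *\<^sub>R (- v)))) has_vector_derivative - left_deriv (- p) (- v)) (at 0)"
    by (intro has_vector_derivative_minus left_deriv_ray)
  then show ?thesis
    by (simp add: minus_mul_distrib linear_neg[OF linear_left_deriv])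
qed

lemma left_deriv_zero [simp]: "left_deriv 0 v = v"
  by (simp add: left_deriv_def mul_deriv_left)

lemma mul_deriv_differentiable: "(\<lambda>z. mul_deriv z v) differentiable (at z)"
proof -
  have "smooth_on (\<lambda>z. mul_deriv z v) UNIV"
    unfolding mul_deriv_def using smooth_mult by (rule smooth_on_frechet_derivative)
  then show ?thesis
    using smooth_on_has_derivative differentiableI by blast
qed

text \<open>The mixed second derivative of the product at \<open>(0, 0)\<close>. In exponential
  coordinates it is half of the Lie bracket, as \<open>lie_bracket_eq\<close> shows.\<close>

definition second_deriv :: "'a \<Rightarrow> 'a \<Rightarrow> 'a" where
  "second_deriv u v = frechet_derivative (\<lambda>p. left_deriv p v) (at 0) u"

lemma left_deriv_has_derivative:
  "((\<lambda>p. left_deriv p v) has_derivative (\<lambda>u. second_deriv u v)) (at 0)"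
proof -
  have "(\<lambda>p::'a. (p, 0::'a)) differentiable (at 0)"
    by (intro differentiableI[of _ "\<lambda>h. (h, 0)"]) (auto intro!: derivative_eq_intros)
  then have "(\<lambda>p. left_deriv p v) differentiable (at 0)"
    unfolding left_deriv_def using differentiable_compose[OF mul_deriv_differentiable] by blast
  then show ?thesis
    unfolding second_deriv_def by (simp add: frechet_derivative_works[symmetric])
qed

lemma left_deriv_ray_derivative:
  "((\<lambda>t. left_deriv (t *\<^sub>R w) v) has_vector_derivative second_deriv w v) (at 0)"
  using left_deriv_has_derivative by (rule has_derivative_along_ray)

lemma bilinear_second_deriv: "bilinear second_deriv"
  unfolding bilinear_def
proof (intro conjI allI)
  show "linear (\<lambda>u. second_deriv u v)" for v
    using left_deriv_has_derivative by (rule has_derivative_linear)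
  show "linear (second_deriv u)" for u
  proof (rule linearI)
    fix v w c
    have "((\<lambda>p. left_deriv p (v + w)) has_derivative (\<lambda>u. second_deriv u v + second_deriv u w)) (at 0)"
      unfolding linear_add[OF linear_left_deriv]
      by (intro has_derivative_add left_deriv_has_derivative)
    from has_derivative_unique[OF left_deriv_has_derivative this]
    show "second_deriv u (v + w) = second_deriv u v + second_deriv u w"
      by meson
    have "((\<lambda>p. left_deriv p (c *\<^sub>R v)) has_derivative (\<lambda>u. c *\<^sub>R second_deriv u v)) (at 0)"
      unfolding linear_scale[OF linear_left_deriv]
      by (intro has_derivative_scaleR_right left_deriv_has_derivative)
    from has_derivative_unique[OF left_deriv_has_derivative this]
    show "second_deriv u (c *\<^sub>R v) = c *\<^sub>R second_deriv u v"
      by meson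
  qed
qed

text \<open>Lines are one-parameter subgroups, so the left-invariant field of \<open>u\<close> is
  constant along the line of \<open>u\<close>. Antisymmetry then follows by polarization.\<close>

lemma second_deriv_self: "second_deriv u u = 0"
proof -
  have "left_deriv (t *\<^sub>R u) u = u" for t
  proof -
    have "((\<lambda>s. (t *\<^sub>R u) \<cdot> (s *\<^sub>R u)) has_vector_derivative u) (at 0)"
      unfolding exp_coords by (auto intro!: derivative_eq_intros simp: has_vector_derivative_def)
    from vector_derivative_unique_at[OF left_deriv_ray this] show ?thesis .
  qed
  then have "((\<lambda>t. left_deriv (t *\<^sub>R u) u) has_vector_derivative 0) (at 0)"
    by simp
  from vector_derivative_unique_at[OF left_deriv_ray_derivative this] show ?thesis .
qed

lemma second_deriv_antisym: "second_deriv u v = - second_deriv v u"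
proof -
  have "second_deriv (u + v) (u + v) = (second_deriv u u + second_deriv v u) + (second_deriv u v + second_deriv v v)"
    by (simp only: bilinear_ladd[OF bilinear_second_deriv] bilinear_radd[OF bilinear_second_deriv])
  then have "second_deriv v u + second_deriv u v = 0"
    by (simp only: second_deriv_self add_0_left add_0_right)
  then show ?thesis
    by (rule add_eq_0_iff[THEN iffD1])
qed

lemma lie_bracket_eq: "lie_bracket G u v = 2 *\<^sub>R second_deriv u v"
proof -
  have "lie_bracket G u v = second_deriv u v - second_deriv v u"
  proof -
    have "left_inv_field G w = (\<lambda>p. left_deriv p w)" for w
      by (simp add: fun_eq_iff left_inv_field_eq)
    then show ?thesis
      by (simp add: lie_bracket_def vf_bracket_def second_deriv_def)
  qed
  also have "\<dots> = second_deriv u v + second_deriv u v"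
    by (subst second_deriv_antisym[of v u]) (rule diff_minus_eq_add)
  finally show ?thesis
    by (simp only: scaleR_2)
qed

text \<open>Being linear in exponential coordinates, conjugation coincides here with the adjoint
  representation.\<close>

definition conjg :: "'a \<Rightarrow> 'a \<Rightarrow> 'a" where
  "conjg p v = p \<cdot> v \<cdot> - p"

lemma conjg_mul: "conjg p (x \<cdot> y) = conjg p x \<cdot> conjg p y"
  by (simp add: conjg_def mul_assoc)

lemma conjg_zero [simp]: "conjg p 0 = 0" "conjg 0 v = v"
  by (simp_all add: conjg_def)

lemma conjg_conjg: "conjg (p \<cdot> q) v = conjg p (conjg q v)"
  by (simp add: conjg_def mul_assoc minus_mul_distrib)

text \<open>A one-parameter subgroup is additive in exponential coordinates, hence equal to its
  derivative at 0.\<close>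

lemma linear_conjg: "linear (conjg p)"
proof -
  have nat: "conjg p (real n *\<^sub>R v) = real n *\<^sub>R conjg p v" for n v
  proof (induction n)
    case (Suc n)
    have "conjg p (real (Suc n) *\<^sub>R v) = conjg p ((real n *\<^sub>R v) \<cdot> (1 *\<^sub>R v))"
      unfolding exp_coords by (simp add: algebra_simps)
    also have "\<dots> = (real n *\<^sub>R conjg p v) \<cdot> (1 *\<^sub>R conjg p v)"
      using Suc by (simp add: conjg_mul)
    also have "\<dots> = real (Suc n) *\<^sub>R conjg p v"
      unfolding exp_coords by (simp add: algebra_simps)
    finally show ?case .
  qed simp
  have "\<exists>L. (conjg p has_derivative L) (at 0)"
  proof -
    have "((\<lambda>v. conjg p v) has_derivative
        (\<lambda>h. mul_deriv (p \<cdot> 0, - p) (mul_deriv (p, 0) (0, h), 0))) (at 0)"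
      unfolding conjg_def by (intro has_derivative_mul has_derivative_const has_derivative_ident)
    then show ?thesis
      by blast
  qed
  then obtain L where L: "(conjg p has_derivative L) (at 0)"
    by blast
  have lin: "linear L"
    using L by (rule has_derivative_linear)
  have "conjg p v = L v" for v
  proof -
    have "((\<lambda>t. conjg p (t *\<^sub>R v)) has_vector_derivative L v) (at 0)"
      using L by (rule has_derivative_along_ray)
    then have "((\<lambda>t. (1 / t) *\<^sub>R conjg p (t *\<^sub>R v)) \<longlongrightarrow> L v) (at 0)"
      unfolding has_vector_derivative_def has_derivative_at
    proof (elim conjE)
      assume "(\<lambda>h. norm (conjg p ((0 + h) *\<^sub>R v) - conjg p (0 *\<^sub>R v) - h *\<^sub>R L v) / norm h) \<midarrow>0\<rightarrow> 0"
      then have "(\<lambda>h. norm ((1 / h) *\<^sub>R conjg p (h *\<^sub>R v) - L v)) \<midarrow>0\<rightarrow> 0"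
      proof (rule Lim_transform_eventually)
        have "norm (conjg p ((0 + h) *\<^sub>R v) - conjg p (0 *\<^sub>R v) - h *\<^sub>R L v) / norm h
            = norm ((1 / h) *\<^sub>R conjg p (h *\<^sub>R v) - L v)" if "h \<noteq> 0" for h
        proof -
          have "(1 / h) *\<^sub>R conjg p (h *\<^sub>R v) - L v = (1 / h) *\<^sub>R (conjg p (h *\<^sub>R v) - h *\<^sub>R L v)"
            using that by (simp add: scaleR_diff_right)
          then show ?thesis
            by simp
        qed
        then show "\<forall>\<^sub>F h in at 0. norm (conjg p ((0 + h) *\<^sub>R v) - conjg p (0 *\<^sub>R v) - h *\<^sub>R L v) / norm h
            = norm ((1 / h) *\<^sub>R conjg p (h *\<^sub>R v) - L v)"
          by (simp add: eventually_at_filter)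
      qed
      then show ?thesis
        by (simp add: tendsto_norm_zero_iff LIM_zero_iff)
    qed
    moreover have "filterlim (\<lambda>n. inverse (real (Suc n))) (at 0) sequentially"
      unfolding filterlim_at using LIMSEQ_inverse_real_of_nat by (auto intro!: always_eventually)
    ultimately have "(\<lambda>n. (1 / inverse (real (Suc n))) *\<^sub>R conjg p (inverse (real (Suc n)) *\<^sub>R v)) \<longlonglongrightarrow> L v"
      by (rule filterlim_compose)
    \<comment> \<open>By \<open>nat\<close> the difference quotients do not change along the
      parameters \<open>inverse (real (Suc n))\<close>, so their limit is the value itself.\<close>
    moreover have "(1 / inverse (real (Suc n))) *\<^sub>R conjg p (inverse (real (Suc n)) *\<^sub>R v) = conjg p v" for n
      using nat[of "Suc n" "inverse (real (Suc n)) *\<^sub>R v"] by (simp add: divide_inverse del: of_nat_Suc)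
    ultimately show ?thesis
      by (simp add: LIMSEQ_const_iff)
  qed
  then have "conjg p = L"
    by auto
  with lin show ?thesis
    by simp
qed

lemma conjg_vector_derivative:
  "(f has_vector_derivative f') F \<Longrightarrow> ((\<lambda>t. conjg p (f t)) has_vector_derivative conjg p f') F"
  by (rule bounded_linear.has_vector_derivative[OF linear_conjg[unfolded linear_conv_bounded_linear]])

text \<open>Left translation of a line by \<open>p\<close> is right translation by \<open>p\<close>
  of the conjugated line; the right side is the derivative of the latter.\<close>

lemma left_deriv_conjg: "left_deriv p v = left_deriv (- p) (conjg p v)"
proof -
  have "p \<cdot> (s *\<^sub>R v) = (s *\<^sub>R conjg p v) \<cdot> p" for s
    unfolding linear_scale[OF linear_conjg, symmetric] by (simp add: conjg_def mul_assoc)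
  then have "((\<lambda>s. p \<cdot> (s *\<^sub>R v)) has_vector_derivative left_deriv (- p) (conjg p v)) (at 0)"
    using right_deriv_ray[of "conjg p v" p] by simp
  from vector_derivative_unique_at[OF left_deriv_ray this] show ?thesis .
qed

text \<open>The infinitesimal conjugation is the bracket. The identity
  \<open>left_deriv_conjg\<close> is differentiated along the line of \<open>w\<close>: the left
  side gives \<open>second_deriv w v\<close>, the right side the derivative sought minus
  \<open>second_deriv w v\<close>.\<close>

lemma conjg_ray_derivative:
  "((\<lambda>t. conjg (t *\<^sub>R w) v) has_vector_derivative 2 *\<^sub>R second_deriv w v) (at 0)"
proof -
  let ?f = "\<lambda>t. conjg (t *\<^sub>R w) v"
  have "\<exists>a. (?f has_vector_derivative a) (at 0)"
  proof -
    have "((\<lambda>t. (t *\<^sub>R w) \<cdot> v) has_vector_derivative mul_deriv (0 *\<^sub>R w, v) (w, 0)) (at 0)"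
      by (rule mul_vector_derivative[OF ray_vector_derivative has_vector_derivative_const])
    from mul_vector_derivative[OF this has_vector_derivative_minus[OF ray_vector_derivative[of w]]] show ?thesis
      unfolding conjg_def by blast
  qed
  then obtain a where a: "(?f has_vector_derivative a) (at 0)"
    by blast
  \<comment> \<open>On the right side both the base point and the vector depend on \<open>t\<close>.
    Expanding the vector in a basis reduces the derivative to the product rule.\<close>
  have exp: "left_deriv (t *\<^sub>R w) v = (\<Sum>b\<in>Basis. (?f t \<bullet> b) *\<^sub>R left_deriv (t *\<^sub>R (- w)) b)" for t
  proof -
    have "left_deriv (t *\<^sub>R w) v = left_deriv (t *\<^sub>R (- w)) (\<Sum>b\<in>Basis. (?f t \<bullet> b) *\<^sub>R b)"
      using left_deriv_conjg[of "t *\<^sub>R w" v] by (simp add: euclidean_representation)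
    then show ?thesis
      by (simp add: linear_sum[OF linear_left_deriv] linear_scale[OF linear_left_deriv])
  qed
  have "((\<lambda>t. \<Sum>b\<in>Basis. (?f t \<bullet> b) *\<^sub>R left_deriv (t *\<^sub>R (- w)) b) has_vector_derivative
      (\<Sum>b\<in>Basis. (?f 0 \<bullet> b) *\<^sub>R second_deriv (- w) b + (a \<bullet> b) *\<^sub>R left_deriv (0 *\<^sub>R (- w)) b)) (at 0)"
  proof (intro has_vector_derivative_sum has_vector_derivative_scaleR left_deriv_ray_derivative)
    show "((\<lambda>t. ?f t \<bullet> b) has_field_derivative a \<bullet> b) (at 0)" for b
      unfolding has_real_derivative_iff_has_vector_derivative
      using a by (rule bounded_linear.has_vector_derivative[OF bounded_linear_inner_left])
  qed
  then have "((\<lambda>t. left_deriv (t *\<^sub>R w) v) has_vector_derivative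
      (\<Sum>b\<in>Basis. (v \<bullet> b) *\<^sub>R second_deriv (- w) b) + (\<Sum>b\<in>Basis. (a \<bullet> b) *\<^sub>R b)) (at 0)"
    unfolding exp by (simp add: sum.distrib)
  from vector_derivative_unique_at[OF left_deriv_ray_derivative this]
  have "second_deriv w v = (\<Sum>b\<in>Basis. (v \<bullet> b) *\<^sub>R second_deriv (- w) b) + a"
    by (simp add: euclidean_representation)
  also have "(\<Sum>b\<in>Basis. (v \<bullet> b) *\<^sub>R second_deriv (- w) b) = second_deriv (- w) (\<Sum>b\<in>Basis. (v \<bullet> b) *\<^sub>R b)"
    using bilinear_second_deriv[unfolded bilinear_def]
    by (simp add: linear_sum linear_scale)
  also have "\<dots> = - second_deriv w v"
    by (simp add: euclidean_representation bilinear_lneg[OF bilinear_second_deriv])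
  finally have "second_deriv w v + second_deriv w v = second_deriv w v + (- second_deriv w v + a)"
    by (rule arg_cong)
  also have "\<dots> = a"
    by simp
  finally have "a = 2 *\<^sub>R second_deriv w v"
    by (simp only: scaleR_2)
  with a show ?thesis
    by simp
qed

lemma conjg_second_deriv: "conjg p (second_deriv u v) = second_deriv (conjg p u) (conjg p v)"
proof -
  have 1: "conjg p (left_deriv x v) = left_deriv (conjg p x) (conjg p v)" for x
  proof -
    have "((\<lambda>s. conjg p (x \<cdot> (s *\<^sub>R v))) has_vector_derivative conjg p (left_deriv x v)) (at 0)"
      by (rule conjg_vector_derivative[OF left_deriv_ray])
    moreover have "((\<lambda>s. conjg p (x \<cdot> (s *\<^sub>R v))) has_vector_derivative left_deriv (conjg p x) (conjg p v)) (at 0)"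
      unfolding conjg_mul linear_scale[OF linear_conjg] by (rule left_deriv_ray)
    ultimately show ?thesis
      by (rule vector_derivative_unique_at)
  qed
  have "((\<lambda>t. conjg p (left_deriv (t *\<^sub>R u) v)) has_vector_derivative conjg p (second_deriv u v)) (at 0)"
    by (rule conjg_vector_derivative[OF left_deriv_ray_derivative])
  moreover have "((\<lambda>t. conjg p (left_deriv (t *\<^sub>R u) v)) has_vector_derivative second_deriv (conjg p u) (conjg p v)) (at 0)"
    unfolding 1 linear_scale[OF linear_conjg] by (rule left_deriv_ray_derivative)
  ultimately show ?thesis
    by (rule vector_derivative_unique_at)
qed

text \<open>Conjugation is an automorphism and preserves \<open>second_deriv\<close>. The Jacobi
  identity is the derivative of this fact along the line of \<open>w\<close>.\<close>

lemma second_deriv_jacobi: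
  "second_deriv w (second_deriv u v) = second_deriv u (second_deriv w v) + second_deriv (second_deriv w u) v"
proof -
  have bb: "bounded_bilinear second_deriv"
    using bilinear_second_deriv by (simp add: bilinear_conv_bounded_bilinear)
  have "((\<lambda>t. second_deriv (conjg (t *\<^sub>R w) u) (conjg (t *\<^sub>R w) v)) has_vector_derivative
      (second_deriv (conjg (0 *\<^sub>R w) u) (2 *\<^sub>R second_deriv w v) + second_deriv (2 *\<^sub>R second_deriv w u) (conjg (0 *\<^sub>R w) v))) (at 0)"
    by (rule bounded_bilinear.has_vector_derivative[OF bb conjg_ray_derivative conjg_ray_derivative])
  then have "((\<lambda>t. conjg (t *\<^sub>R w) (second_deriv u v)) has_vector_derivative
      (second_deriv u (2 *\<^sub>R second_deriv w v) + second_deriv (2 *\<^sub>R second_deriv w u) v)) (at 0)"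
    by (simp add: conjg_second_deriv)
  from vector_derivative_unique_at[OF conjg_ray_derivative this]
  have "2 *\<^sub>R second_deriv w (second_deriv u v)
      = 2 *\<^sub>R (second_deriv u (second_deriv w v) + second_deriv (second_deriv w u) v)"
    by (simp only: bilinear_lmul[OF bilinear_second_deriv] bilinear_rmul[OF bilinear_second_deriv] scaleR_add_right)
  then show ?thesis
    by (simp only: scaleR_cancel_left numeral_neq_zero simp_thms)
qed

section \<open>The descending filtration by layers of index at least \<open>k\<close>\<close>

definition filt :: "nat \<Rightarrow> 'a set" where
  "filt k = {x. \<forall>i\<in>{1..\<kappa>}. i < k \<longrightarrow> proj i x = 0}"

lemma subspace_filt: "subspace (filt k)"
  unfolding filt_def
  by (rule subspaceI)
    (auto simp: linear_0[OF linear_proj] linear_add[OF linear_proj] linear_scale[OF linear_proj])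

lemma filt_mono: "k \<le> l \<Longrightarrow> filt l \<subseteq> filt k"
  by (auto simp: filt_def)

lemma layer_filt: "i \<in> {1..\<kappa>} \<Longrightarrow> k \<le> i \<Longrightarrow> V i \<subseteq> filt k"
  by (auto simp: filt_def proj_layer)

lemma filt_top: "\<kappa> < k \<Longrightarrow> filt k = {0}"
proof -
  assume "\<kappa> < k"
  then have "x = 0" if "x \<in> filt k" for x
    using proj_sum[of x] that unfolding filt_def by (auto intro: sum.neutral)
  then show ?thesis
    using subspace_0[OF subspace_filt] by auto
qed

lemma filt_induct:
  assumes "x \<in> filt k" and S: "subspace S" and "\<And>i v. i \<in> {1..\<kappa>} \<Longrightarrow> k \<le> i \<Longrightarrow> v \<in> V i \<Longrightarrow> f v \<in> S"
    and "linear f"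
  shows "f x \<in> S"
proof -
  have "f x = (\<Sum>i=1..\<kappa>. f (proj i x))"
    using linear_sum[OF \<open>linear f\<close>, of "\<lambda>i. proj i x" "{1..\<kappa>}"] by (simp only: proj_sum)
  also have "\<dots> \<in> S"
  proof (rule subspace_sum[OF S])
    fix i assume i: "i \<in> {1..\<kappa>}"
    show "f (proj i x) \<in> S"
    proof (cases "k \<le> i")
      case True
      then show ?thesis
        using assms(3)[OF i True proj_mem[OF i]] by simp
    next
      case False
      then have "proj i x = 0"
        using assms(1) i by (simp add: filt_def)
      then show ?thesis
        using subspace_0[OF S] linear_0[OF \<open>linear f\<close>] by simp
    qed
  qed
  finally show ?thesis .
qed

lemma second_deriv_linear_right: "linear (second_deriv u)"
  and second_deriv_linear_left: "linear (\<lambda>u. second_deriv u v)"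
  using bilinear_second_deriv by (simp_all add: bilinear_def)

lemma second_deriv_layer:
  assumes "u \<in> V 1" "v \<in> V i" "i \<in> {1..\<kappa>}"
  shows "second_deriv u v \<in> filt (Suc i)"
proof -
  have mem: "lie_bracket G u v \<in> bracket_span G (V 1) (V i)"
    unfolding bracket_span_def using assms by (intro span_base) auto
  have "lie_bracket G u v \<in> filt (Suc i)"
  proof (cases "i < \<kappa>")
    case True
    then have "lie_bracket G u v \<in> V (i + 1)"
      using mem bracket_layer[of i] assms(3) by simp
    then show ?thesis
      using layer_filt[of "i + 1" "Suc i"] True by auto
  next
    case False
    then have "i = \<kappa>"
      using assms(3) by simp
    then have "lie_bracket G u v = 0"
      using mem bracket_last by simp
    then show ?thesis
      using subspace_0[OF subspace_filt] by simp
  qed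
  then have "(1 / 2) *\<^sub>R lie_bracket G u v \<in> filt (Suc i)"
    by (rule subspace_scale[OF subspace_filt])
  then show ?thesis
    by (simp add: lie_bracket_eq)
qed

text \<open>The axioms describe only brackets with \<open>V 1\<close>. The elements whose bracket
  raises the filtration form a subspace, and the Jacobi identity shows that with \<open>V i\<close>
  it also contains the brackets of \<open>V 1\<close> with \<open>V i\<close>, hence the next
  layer.\<close>

lemma second_deriv_filt:
  assumes "v \<in> filt k"
  shows "second_deriv w v \<in> filt (Suc k)"
proof -
  \<comment> \<open>The index \<open>k\<close> is quantified inside the set because the Jacobi
    identity uses the property at two consecutive levels.\<close>
  let ?J = "{w. \<forall>k. \<forall>v\<in>filt k. second_deriv w v \<in> filt (Suc k)}"
  have J: "subspace ?J"
    by (rule subspaceI)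
      (auto simp: linear_0[OF second_deriv_linear_left] linear_add[OF second_deriv_linear_left]
        linear_scale[OF second_deriv_linear_left] subspace_0[OF subspace_filt]
        subspace_add[OF subspace_filt] subspace_scale[OF subspace_filt])
  have V1: "u \<in> ?J" if u: "u \<in> V 1" for u
  proof (intro CollectI allI ballI)
    fix k v assume "v \<in> filt k"
    then show "second_deriv u v \<in> filt (Suc k)"
    proof (rule filt_induct[OF _ subspace_filt _ second_deriv_linear_right])
      fix i v assume "i \<in> {1..\<kappa>}" "k \<le> i" "v \<in> V i"
      then have "second_deriv u v \<in> filt (Suc i)" "filt (Suc i) \<subseteq> filt (Suc k)"
        using second_deriv_layer[OF u, of v i] filt_mono[of "Suc k" "Suc i"] by simp_all
      then show "second_deriv u v \<in> filt (Suc k)"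
        by blast
    qed
  qed
  have V_sub: "i \<in> {1..\<kappa>} \<Longrightarrow> V i \<subseteq> ?J" for i
  proof (induction i)
    case (Suc i)
    show ?case
    proof (cases "i = 0")
      case True
      then show ?thesis
        using V1 by auto
    next
      case False
      then have i: "i \<in> {1..<\<kappa>}"
        using Suc.prems by simp
      then have IH: "V i \<subseteq> ?J"
        using Suc.IH by simp
      have "lie_bracket G u v \<in> ?J" if u: "u \<in> V 1" and v: "v \<in> V i" for u v
      proof -
        have "second_deriv u v \<in> ?J"
        proof (intro CollectI allI ballI)
          fix k x assume x: "x \<in> filt k"
          have v1: "second_deriv v y \<in> filt (Suc k)" if "y \<in> filt k" for y k
            using IH v that by blast
          have u1: "second_deriv u y \<in> filt (Suc k)" if "y \<in> filt k" for y k
            using V1[OF u] that by blast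
          have "second_deriv (second_deriv u v) x = second_deriv u (second_deriv v x) - second_deriv v (second_deriv u x)"
            using second_deriv_jacobi[of u v x] by simp
          also have "\<dots> \<in> filt (Suc (Suc k))"
            by (intro subspace_diff[OF subspace_filt] u1 v1 x)
          finally show "second_deriv (second_deriv u v) x \<in> filt (Suc k)"
            using filt_mono[of "Suc k" "Suc (Suc k)"] by auto
        qed
        then show ?thesis
          unfolding lie_bracket_eq by (rule subspace_scale[OF J])
      qed
      then have "bracket_span G (V 1) (V i) \<subseteq> ?J"
        unfolding bracket_span_def by (intro span_minimal J) auto
      then show ?thesis
        using bracket_layer[OF i] by simp
    qed
  qed simp
  have "(\<Sum>i=1..\<kappa>. proj i w) \<in> ?J"
    by (rule subspace_sum[OF J]) (rule subsetD[OF V_sub proj_mem])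
  then have "w \<in> ?J"
    by (simp only: proj_sum)
  then show ?thesis
    using assms by simp
qed

text \<open>Descending induction on \<open>k\<close> from above the top, where the filtration is 0.
  The derivative of conjugation by \<open>t *\<^sub>R p\<close> is a conjugate of
  \<open>2 *\<^sub>R second_deriv p v\<close>. This vector lies one level deeper, and the induction
  hypothesis keeps its conjugates there.\<close>

lemma conjg_filt:
  assumes "v \<in> filt k"
  shows "conjg p v - v \<in> filt (Suc k)"
  using assms
proof (induction "Suc \<kappa> - k" arbitrary: k v p)
  case 0
  then have "v = 0"
    using filt_top[of k] by auto
  then show ?case
    using subspace_0[OF subspace_filt] by simp
next
  case (Suc n)
  have stable: "conjg q w \<in> filt (Suc k)" if "w \<in> filt (Suc k)" for q w
  proof -
    have "conjg q w - w \<in> filt (Suc (Suc k))"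
      using Suc.hyps that by (intro Suc.hyps(1)) auto
    then have "conjg q w - w + w \<in> filt (Suc k)"
      using filt_mono[of "Suc k" "Suc (Suc k)"] that by (intro subspace_add[OF subspace_filt]) auto
    then show ?thesis
      by simp
  qed
  have der: "((\<lambda>t. conjg (t *\<^sub>R p) v) has_vector_derivative conjg (t *\<^sub>R p) (2 *\<^sub>R second_deriv p v)) (at t)" for t
  proof -
    have "((\<lambda>s. conjg (t *\<^sub>R p) (conjg (s *\<^sub>R p) v)) has_vector_derivative conjg (t *\<^sub>R p) (2 *\<^sub>R second_deriv p v)) (at 0)"
      by (rule conjg_vector_derivative[OF conjg_ray_derivative])
    then have "((\<lambda>s. conjg ((s + t) *\<^sub>R p) v) has_vector_derivative conjg (t *\<^sub>R p) (2 *\<^sub>R second_deriv p v)) (at 0)"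
      by (simp only: conjg_conjg[symmetric] exp_coords add.commute[of t])
    then show ?thesis
      by (rule has_vector_derivative_unshift)
  qed
  have "conjg (1 *\<^sub>R p) v - conjg (0 *\<^sub>R p) v \<in> filt (Suc k)"
    by (rule curve_diff_in_subspace[OF subspace_filt der])
      (intro stable subspace_scale[OF subspace_filt] second_deriv_filt Suc.prems)
  then show ?case
    by simp
qed

text \<open>The Maurer-Cartan form: the vector \<open>v\<close> at \<open>q\<close> is moved back to
  0 by left translation. It is inverse to \<open>left_deriv q\<close>.\<close>

definition log_deriv :: "'a \<Rightarrow> 'a \<Rightarrow> 'a" where
  "log_deriv q v = mul_deriv (- q, q) (0, v)"

lemma log_deriv_curve:
  assumes "(f has_vector_derivative v) (at t)"
  shows "((\<lambda>s. - f t \<cdot> f s) has_vector_derivative log_deriv (f t) v) (at t)"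
  using mul_vector_derivative[OF has_vector_derivative_const assms, of "- f t"]
  by (simp add: log_deriv_def)

text \<open>Writing \<open>p \<cdot> (q + s *\<^sub>R v)\<close> as
  \<open>(p \<cdot> q) \<cdot> (- q \<cdot> (q + s *\<^sub>R v))\<close> separates the effect of the
  base point from that of the moving factor.\<close>

lemma mul_deriv_snd: "mul_deriv (p, q) (0, v) = left_deriv (p \<cdot> q) (log_deriv q v)"
proof -
  have f: "((\<lambda>s. q + s *\<^sub>R v) has_vector_derivative v) (at 0)"
    by (auto intro!: derivative_eq_intros simp: has_vector_derivative_def)
  have "((\<lambda>s. p \<cdot> (q + s *\<^sub>R v)) has_vector_derivative mul_deriv (p, q) (0, v)) (at 0)"
    using mul_vector_derivative[OF has_vector_derivative_const[of p] f] by simp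
  moreover have "((\<lambda>s. (p \<cdot> q) \<cdot> (- q \<cdot> (q + s *\<^sub>R v))) has_vector_derivative
      mul_deriv (p \<cdot> q, - q \<cdot> q) (0, log_deriv q v)) (at 0)"
    using mul_vector_derivative[OF has_vector_derivative_const[of "p \<cdot> q"] log_deriv_curve[OF f]] by simp
  then have "((\<lambda>s. p \<cdot> (q + s *\<^sub>R v)) has_vector_derivative left_deriv (p \<cdot> q) (log_deriv q v)) (at 0)"
    by (simp add: mul_assoc left_deriv_def)
  ultimately show ?thesis
    by (rule vector_derivative_unique_at)
qed

lemma linear_log_deriv: "linear (log_deriv q)"
  unfolding log_deriv_def by (rule mul_deriv_snd_linear)

text \<open>The law \<open>exp_coords\<close> for the line of \<open>p + e *\<^sub>R v\<close> is
  differentiated in \<open>e\<close> at 0. The result plays the part of the differential equation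
  for the derivative of the exponential map.\<close>

lemma log_deriv_cocycle:
  "(s + t) *\<^sub>R log_deriv ((s + t) *\<^sub>R p) v
     = conjg (- (t *\<^sub>R p)) (s *\<^sub>R log_deriv (s *\<^sub>R p) v) + t *\<^sub>R log_deriv (t *\<^sub>R p) v"
proof -
  let ?f = "\<lambda>t e. - (t *\<^sub>R p) \<cdot> (t *\<^sub>R (p + e *\<^sub>R v))"
  have der: "((\<lambda>e. ?f t e) has_vector_derivative t *\<^sub>R log_deriv (t *\<^sub>R p) v) (at 0)" for t
  proof -
    have "((\<lambda>e. t *\<^sub>R (p + e *\<^sub>R v)) has_vector_derivative t *\<^sub>R v) (at 0)"
      by (auto intro!: derivative_eq_intros simp: has_vector_derivative_def)
    from log_deriv_curve[OF this] show ?thesis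
      by (simp add: linear_scale[OF linear_log_deriv])
  qed
  have "?f (s + t) e = conjg (- (t *\<^sub>R p)) (?f s e) \<cdot> ?f t e" for e
  proof -
    have 1: "(s + t) *\<^sub>R (p + e *\<^sub>R v) = (s *\<^sub>R (p + e *\<^sub>R v)) \<cdot> (t *\<^sub>R (p + e *\<^sub>R v))"
      by (simp only: exp_coords)
    have 2: "- ((s + t) *\<^sub>R p) = - (t *\<^sub>R p) \<cdot> - (s *\<^sub>R p)"
      using exp_coords[of "- t" p "- s"] by (simp add: algebra_simps)
    show ?thesis
      unfolding 1 2 conjg_def by (simp add: mul_assoc)
  qed
  moreover have "((\<lambda>e. conjg (- (t *\<^sub>R p)) (?f s e) \<cdot> ?f t e) has_vector_derivative
      mul_deriv (conjg (- (t *\<^sub>R p)) (?f s 0), ?f t 0)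
        (conjg (- (t *\<^sub>R p)) (s *\<^sub>R log_deriv (s *\<^sub>R p) v), t *\<^sub>R log_deriv (t *\<^sub>R p) v)) (at 0)"
    by (rule mul_vector_derivative[OF conjg_vector_derivative[OF der] der])
  ultimately have "((\<lambda>e. ?f (s + t) e) has_vector_derivative
      conjg (- (t *\<^sub>R p)) (s *\<^sub>R log_deriv (s *\<^sub>R p) v) + t *\<^sub>R log_deriv (t *\<^sub>R p) v) (at 0)"
    by (simp add: mul_deriv_zero)
  from vector_derivative_unique_at[OF der this] show ?thesis .
qed

text \<open>By the cocycle identity the function \<open>?Z\<close> has derivative
  \<open>conjg (- (t *\<^sub>R p)) v\<close>, which is \<open>v\<close> up to the next level of the
  filtration. The claim compares its values at 0 and 1.\<close>

lemma log_deriv_filt: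
  assumes "v \<in> filt k"
  shows "log_deriv p v - v \<in> filt (Suc k)"
proof -
  let ?Z = "\<lambda>t. t *\<^sub>R log_deriv (t *\<^sub>R p) v"
  have der0: "(?Z has_vector_derivative v) (at 0)"
  proof -
    have "(\<lambda>t. log_deriv (t *\<^sub>R p) v) differentiable (at (0::real))"
    proof -
      have "(\<lambda>t::real. (- (t *\<^sub>R p), t *\<^sub>R p)) differentiable (at 0)"
        by (intro differentiableI[of _ "\<lambda>h. (- (h *\<^sub>R p), h *\<^sub>R p)"]) (auto intro!: derivative_eq_intros)
      from differentiable_compose[OF mul_deriv_differentiable this] show ?thesis
        unfolding log_deriv_def .
    qed
    then obtain D where D: "((\<lambda>t. log_deriv (t *\<^sub>R p) v) has_vector_derivative D) (at 0)"
      using vector_derivative_works by blast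
    have "((\<lambda>t::real. t) has_field_derivative 1) (at 0)"
      by (rule DERIV_ident)
    from has_vector_derivative_scaleR[OF this D] show ?thesis
      by (simp add: log_deriv_def mul_deriv_left)
  qed
  have der: "((\<lambda>t. ?Z t - t *\<^sub>R v) has_vector_derivative conjg (- (t *\<^sub>R p)) v - v) (at t)" for t
  proof -
    have "((\<lambda>s. conjg (- (t *\<^sub>R p)) (?Z s) + ?Z t) has_vector_derivative conjg (- (t *\<^sub>R p)) v + 0) (at 0)"
      by (rule has_vector_derivative_add[OF conjg_vector_derivative[OF der0] has_vector_derivative_const])
    then have "((\<lambda>s. ?Z (s + t)) has_vector_derivative conjg (- (t *\<^sub>R p)) v) (at 0)"
      unfolding log_deriv_cocycle by simp
    then have "(?Z has_vector_derivative conjg (- (t *\<^sub>R p)) v) (at t)"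
      by (rule has_vector_derivative_unshift)
    then show ?thesis
      by (intro has_vector_derivative_diff ray_vector_derivative)
  qed
  have "(?Z 1 - 1 *\<^sub>R v) - (?Z 0 - 0 *\<^sub>R v) \<in> filt (Suc k)"
    by (rule curve_diff_in_subspace[OF subspace_filt der]) (rule conjg_filt[OF assms])
  then show ?thesis
    by simp
qed

text \<open>\<open>left_deriv p\<close> inverts \<open>log_deriv p\<close>, so its deviation from
  the identity at \<open>v\<close> is, up to sign, its value at the deviation of
  \<open>log_deriv p\<close>. That vector lies one level deeper, where the descending induction
  applies.\<close>

lemma left_deriv_filt:
  assumes "v \<in> filt k"
  shows "left_deriv p v - v \<in> filt (Suc k)"
  using assms
proof (induction "Suc \<kappa> - k" arbitrary: k v)
  case 0
  then have "v = 0"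
    using filt_top[of k] by auto
  then show ?case
    using subspace_0[OF subspace_filt] by (simp add: linear_0[OF linear_left_deriv])
next
  case (Suc n)
  let ?n = "log_deriv p v - v"
  have n: "?n \<in> filt (Suc k)"
    by (rule log_deriv_filt[OF Suc.prems])
  have "left_deriv p ?n - ?n \<in> filt (Suc (Suc k))"
    using Suc.hyps n by (intro Suc.hyps(1)) auto
  then have "left_deriv p ?n - ?n + ?n \<in> filt (Suc k)"
    using n filt_mono[of "Suc k" "Suc (Suc k)"] by (intro subspace_add[OF subspace_filt]) auto
  then have An: "left_deriv p ?n \<in> filt (Suc k)"
    by simp
  have "left_deriv p (log_deriv p v) = v"
    using mul_deriv_snd[of 0 p v] by (simp add: mul_deriv_left)
  then have "left_deriv p v - v = - left_deriv p ?n"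
    by (simp add: linear_diff[OF linear_left_deriv])
  then show ?case
    using subspace_neg[OF subspace_filt An] by simp
qed

text \<open>While the second factor moves from \<open>q\<close> to \<open>q + v\<close> along a
  segment, the velocity of the product is \<open>v\<close> up to the next level, by the estimates
  for \<open>log_deriv\<close> and \<open>left_deriv\<close>.\<close>

theorem mul_filt_right:
  assumes "v \<in> filt k"
  shows "p \<cdot> (q + v) - p \<cdot> q - v \<in> filt (Suc k)"
proof -
  have "((\<lambda>t. p \<cdot> (q + t *\<^sub>R v) - t *\<^sub>R v) has_vector_derivative mul_deriv (p, q + t *\<^sub>R v) (0, v) - v) (at t)" for t
  proof -
    have "((\<lambda>t. q + t *\<^sub>R v) has_vector_derivative v) (at t)"
      by (auto intro!: derivative_eq_intros simp: has_vector_derivative_def)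
    then show ?thesis
      by (intro has_vector_derivative_diff ray_vector_derivative mul_vector_derivative has_vector_derivative_const)
  qed
  moreover have "mul_deriv (p, y) (0, v) - v \<in> filt (Suc k)" for y
  proof -
    let ?w = "log_deriv y v"
    have 1: "?w - v \<in> filt (Suc k)"
      by (rule log_deriv_filt[OF assms])
    then have "?w - v + v \<in> filt k"
      using assms filt_mono[of k "Suc k"] by (intro subspace_add[OF subspace_filt]) auto
    then have "left_deriv (p \<cdot> y) ?w - ?w \<in> filt (Suc k)"
      by (intro left_deriv_filt) simp
    from subspace_add[OF subspace_filt this 1] show ?thesis
      by (simp add: mul_deriv_snd)
  qed
  ultimately have "(p \<cdot> (q + 1 *\<^sub>R v) - 1 *\<^sub>R v) - (p \<cdot> (q + 0 *\<^sub>R v) - 0 *\<^sub>R v) \<in> filt (Suc k)"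
    by (rule curve_diff_in_subspace[OF subspace_filt])
  then show ?thesis
    by (simp add: algebra_simps)
qed

lemma mul_filt_left:
  assumes "v \<in> filt k"
  shows "(p + v) \<cdot> q - p \<cdot> q - v \<in> filt (Suc k)"
proof -
  have "- q \<cdot> (- p + - v) - - q \<cdot> - p - - v \<in> filt (Suc k)"
    by (intro mul_filt_right subspace_neg[OF subspace_filt] assms)
  moreover have "- q \<cdot> (- p + - v) - - q \<cdot> - p - - v = - ((p + v) \<cdot> q - p \<cdot> q - v)"
  proof -
    have "(p + v) \<cdot> q = - (- q \<cdot> (- p + - v))" "p \<cdot> q = - (- q \<cdot> - p)"
      by (simp_all add: minus_mul_distrib add.commute)
    then show ?thesis
      by simp
  qed
  ultimately show ?thesis
    using subspace_neg[OF subspace_filt] by (metis minus_minus)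
qed

text \<open>The parts of both factors in \<open>filt k\<close> enter the product additively up to
  \<open>filt (Suc k)\<close>, which \<open>W\<close> contains. What remains is a product of two
  multiples of \<open>x\<close>, again a multiple of \<open>x\<close>.\<close>

lemma mul_closed_line_filt:
  assumes W: "subspace W" and x: "x \<in> W" and top: "filt (Suc k) \<subseteq> W"
    and dec: "\<And>a. a \<in> W \<Longrightarrow> \<exists>s u. a = s *\<^sub>R x + u \<and> u \<in> W \<inter> filt k"
    and a: "a \<in> W" and b: "b \<in> W"
  shows "a \<cdot> b \<in> W"
proof -
  obtain s u where u: "a = s *\<^sub>R x + u" "u \<in> W" "u \<in> filt k"
    using dec[OF a] by blast
  obtain t v where v: "b = t *\<^sub>R x + v" "v \<in> W" "v \<in> filt k"
    using dec[OF b] by blast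
  have "a \<cdot> b - a \<cdot> (t *\<^sub>R x) - v \<in> W"
    using mul_filt_right[OF v(3), of a "t *\<^sub>R x"] top v(1) by auto
  moreover have "a \<cdot> (t *\<^sub>R x) - (s *\<^sub>R x) \<cdot> (t *\<^sub>R x) - u \<in> W"
    using mul_filt_left[OF u(3), of "s *\<^sub>R x" "t *\<^sub>R x"] top u(1) by auto
  moreover have "(s *\<^sub>R x) \<cdot> (t *\<^sub>R x) \<in> W"
    unfolding exp_coords by (rule subspace_scale[OF W x])
  ultimately have "(a \<cdot> b - a \<cdot> (t *\<^sub>R x) - v) + v + (a \<cdot> (t *\<^sub>R x) - (s *\<^sub>R x) \<cdot> (t *\<^sub>R x) - u) + u + (s *\<^sub>R x) \<cdot> (t *\<^sub>R x) \<in> W"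
    using u(2) v(2) by (intro subspace_add[OF W])
  then show ?thesis
    by simp
qed

lemma subgroup_of_subspace:
  assumes "subspace W" "\<And>a b. a \<in> W \<Longrightarrow> b \<in> W \<Longrightarrow> a \<cdot> b \<in> W"
  shows "subgroup W G"
proof
  show "W \<subseteq> carrier G"
    by (simp add: carrier_UNIV)
  show "\<one>\<^bsub>G\<^esub> \<in> W"
    using assms by (simp add: one_zero subspace_0)
  show "inv\<^bsub>G\<^esub> x \<in> W" if "x \<in> W" for x
    using that assms by (simp add: inv_eq_minus subspace_neg)
qed (rule assms)

end

section \<open>Hausdorff dimension of graded subgroups\<close>

text \<open>Covering sets of diameter \<open>t\<close> will be replaced by open balls of slightly
  larger radius at small extra cost. The case \<open>t = 0\<close> of one-point sets is
  included.\<close>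

lemma powr_near:
  assumes "0 \<le> (t::real)" "0 < s" "0 < e" "t < u"
  obtains D where "t < D" "D < u" "D powr s < t powr s + e"
proof -
  have "((\<lambda>x. x powr s) \<longlongrightarrow> t powr s) (at_right t)"
  proof (rule tendsto_powr')
    show "t \<noteq> 0 \<or> 0 < s \<and> (\<forall>\<^sub>F x in at_right t. 0 \<le> x)"
      using assms by (auto simp: eventually_at_right_less eventually_at_filter)
  qed (auto intro: tendsto_ident_at)
  then have "\<forall>\<^sub>F x in at_right t. x powr s < t powr s + e"
    using assms(3) by (intro order_tendstoD(2)) auto
  moreover have "\<forall>\<^sub>F x in at_right t. t < x \<and> x < u"
    using assms(4) by (auto simp: eventually_at_right_field)
  ultimately have "\<forall>\<^sub>F x in at_right t. x powr s < t powr s + e \<and> t < x \<and> x < u"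
    by eventually_elim auto
  from eventually_happens'[OF trivial_limit_at_right_real this]
  obtain D where "D powr s < t powr s + e \<and> t < D \<and> D < u"
    by blast
  then show ?thesis
    using that by blast
qed

section \<open>Comparison of translations and \<open>d\<close> with the Euclidean norm\<close>

context carnot_group
begin

text \<open>The derivative in the second factor is bounded on a compact set of pairs. Since the
  inverse of a left translation is one too, Euclidean separation survives translation up to a
  constant.\<close>

lemma mul_lipschitz:
  obtains \<Lambda> where "0 < \<Lambda>"
    "\<And>x y z. norm x \<le> R \<Longrightarrow> norm y \<le> R \<Longrightarrow> norm z \<le> R \<Longrightarrow> norm (x \<cdot> y - x \<cdot> z) \<le> \<Lambda> * norm (y - z)"
proof -
  have "\<exists>C. \<forall>z\<in>cball 0 R \<times> cball 0 R. norm (mul_deriv z (0, b)) \<le> C" for b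
  proof -
    have "compact ((\<lambda>z. mul_deriv z (0, b)) ` (cball 0 R \<times> cball 0 R))"
      by (intro compact_continuous_image continuous_on_subset[OF continuous_mul_deriv] compact_Times) auto
    then obtain C where "\<forall>w\<in>(\<lambda>z. mul_deriv z (0, b)) ` (cball 0 R \<times> cball 0 R). norm w \<le> C"
      using compact_imp_bounded bounded_iff by blast
    then show ?thesis
      by blast
  qed
  then obtain C where C: "\<And>b z. z \<in> cball 0 R \<times> cball 0 R \<Longrightarrow> norm (mul_deriv z (0, b)) \<le> C b"
    by metis
  define \<Lambda> where "\<Lambda> = (\<Sum>b\<in>Basis. \<bar>C b\<bar>) + 1"
  have "0 < \<Lambda>"
    unfolding \<Lambda>_def by (intro add_nonneg_pos sum_nonneg) auto
  moreover have "norm (x \<cdot> y - x \<cdot> z) \<le> \<Lambda> * norm (y - z)" if "norm x \<le> R" "norm y \<le> R" "norm z \<le> R" for x y z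
  proof (rule differentiable_bound[of "cball 0 R" "\<lambda>y. x \<cdot> y" "\<lambda>y h. mul_deriv (x, y) (0, h)"])
    show "((\<lambda>y. x \<cdot> y) has_derivative (\<lambda>h. mul_deriv (x, y) (0, h))) (at y within cball 0 R)" for y
      by (intro has_derivative_mul has_derivative_const has_derivative_ident)
    show "onorm (\<lambda>h. mul_deriv (x, y) (0, h)) \<le> \<Lambda>" if y: "y \<in> cball 0 R" for y
    proof (rule onorm_le)
      fix h :: 'a
      have lin: "linear (\<lambda>h. mul_deriv (x, y) (0, h))"
        using linear_compose[OF _ linear_mul_deriv, of "\<lambda>h. (0, h)" "(x, y)"]
        by (simp add: comp_def linear_iff)
      have "mul_deriv (x, y) (0, h) = (\<Sum>b\<in>Basis. (h \<bullet> b) *\<^sub>R mul_deriv (x, y) (0, b))"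
        using linear_sum[OF lin, of "\<lambda>b. (h \<bullet> b) *\<^sub>R b" Basis]
        by (simp add: euclidean_representation linear_scale[OF lin])
      also have "norm \<dots> \<le> (\<Sum>b\<in>Basis. norm h * \<bar>C b\<bar>)"
      proof (rule sum_norm_le)
        fix b :: 'a assume b: "b \<in> Basis"
        have "norm (mul_deriv (x, y) (0, b)) \<le> \<bar>C b\<bar>"
          using C[of "(x, y)" b] y \<open>norm x \<le> R\<close> by force
        then show "norm ((h \<bullet> b) *\<^sub>R mul_deriv (x, y) (0, b)) \<le> norm h * \<bar>C b\<bar>"
          using Basis_le_norm[OF b, of h] by (simp add: mult_mono)
      qed
      also have "\<dots> \<le> \<Lambda> * norm h"
        by (simp add: \<Lambda>_def sum_distrib_left[symmetric] algebra_simps)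
      finally show "norm (mul_deriv (x, y) (0, h)) \<le> \<Lambda> * norm h" .
    qed
  qed (use that in auto)
  ultimately show ?thesis
    by (rule that)
qed

end

context homogeneous_distance
begin

lemma d_zero_bounded:
  obtains M where "0 < M" "\<And>x. norm x \<le> R \<Longrightarrow> d 0 x \<le> M"
proof -
  have "compact ((\<lambda>w. d 0 w) ` cball 0 R)"
    by (intro compact_continuous_image continuous_intros) auto
  then obtain M where M: "\<forall>t\<in>(\<lambda>w. d 0 w) ` cball 0 R. norm t \<le> M"
    using compact_imp_bounded bounded_iff by blast
  have "d 0 x \<le> \<bar>M\<bar> + 1" if "norm x \<le> R" for x
  proof -
    have "norm (d 0 x) \<le> M"
      using M that by simp
    then show ?thesis
      by simp
  qed
  then show ?thesis
    by (intro that[of "\<bar>M\<bar> + 1"]) auto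
qed

lemma diameter_cl_ball: "diameter_wrt d (cl_ball d x e) \<le> ennreal (2 * e)"
  unfolding diameter_wrt_def
proof (intro SUP_least ennreal_leI)
  show "d y z \<le> 2 * e" if "y \<in> cl_ball d x e" "z \<in> cl_ball d x e" for y z
    using that triangle[of y x z] commute[of x y] by (simp add: cl_ball_eq)
qed

text \<open>Dilation by \<open>1 / e\<close> enlarges norms at most by a constant times
  \<open>(1 / e) ^ \<kappa>\<close>. If \<open>x\<close> and \<open>y\<close> were closer in norm,
  the dilated \<open>- x \<cdot> y\<close> would still lie where \<open>d 0\<close> is below
  1/2.\<close>

lemma norm_separated_of_d:
  obtains c where "0 < c"
    "\<And>x y e. norm x \<le> R \<Longrightarrow> norm y \<le> R \<Longrightarrow> 0 < e \<Longrightarrow> e \<le> 1 \<Longrightarrow> e / 2 \<le> d x y \<Longrightarrow> c * e ^ \<kappa> \<le> norm (x - y)"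
proof -
  obtain C where C: "0 < C" "\<And>r x. 1 \<le> r \<Longrightarrow> norm (dil r x) \<le> C * r ^ \<kappa> * norm x"
    using dil_norm_bound by blast
  obtain \<Lambda> where \<Lambda>: "0 < \<Lambda>"
    "\<And>x y z. norm x \<le> R \<Longrightarrow> norm y \<le> R \<Longrightarrow> norm z \<le> R \<Longrightarrow> norm (x \<cdot> y - x \<cdot> z) \<le> \<Lambda> * norm (y - z)"
    using mul_lipschitz[of R] by blast
  obtain \<delta> where \<delta>: "0 < \<delta>" "\<And>x. norm x < \<delta> \<Longrightarrow> d 0 x < 1 / 2"
    using d_small[of "1 / 2"] by auto
  define c where "c = \<delta> / (C * \<Lambda>)"
  have "c * e ^ \<kappa> \<le> norm (x - y)"
    if xy: "norm x \<le> R" "norm y \<le> R" and e: "0 < e" "e \<le> 1" and sep: "e / 2 \<le> d x y" for x y e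
  proof (rule ccontr)
    assume "\<not> c * e ^ \<kappa> \<le> norm (x - y)"
    then have "norm (y - x) < c * e ^ \<kappa>"
      by (simp add: norm_minus_commute)
    then have less: "norm (y - x) / e ^ \<kappa> < c"
      using e by (simp add: pos_divide_less_eq)
    have "norm (- x \<cdot> y) \<le> \<Lambda> * norm (y - x)"
      using \<Lambda>(2)[of "- x" y x] xy by simp
    then have "norm (dil (1 / e) (- x \<cdot> y)) \<le> C * (1 / e) ^ \<kappa> * (\<Lambda> * norm (y - x))"
      using C(2)[of "1 / e" "- x \<cdot> y"] e C(1)
      by (meson le_divide_eq_1_pos mult_left_mono mult_nonneg_nonneg less_imp_le order_trans zero_le_divide_1_iff zero_le_power)
    also have "\<dots> = C * \<Lambda> * (norm (y - x) / e ^ \<kappa>)"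
      by (simp add: power_divide)
    also have "\<dots> < C * \<Lambda> * c"
      using less C(1) \<Lambda>(1) by (intro mult_strict_left_mono) auto
    also have "\<dots> = \<delta>"
      using C(1) \<Lambda>(1) by (simp add: c_def)
    finally have "d 0 (dil (1 / e) (- x \<cdot> y)) < 1 / 2"
      by (rule \<delta>(2))
    then have "d x y / e < 1 / 2"
      using e by (simp add: d_zero_dil d_translate[of x y])
    then show False
      using sep e by (simp add: field_simps)
  qed
  moreover have "0 < c"
    using \<delta>(1) C(1) \<Lambda>(1) by (simp add: c_def)
  ultimately show ?thesis
    using that by blast
qed

end

section \<open>Coordinates and lattices in a graded subgroup\<close>

locale graded_subgroup = homogeneous_distance G \<kappa> V d
  for G :: "'a::euclidean_space monoid" and \<kappa> :: nat and V :: "nat \<Rightarrow> 'a set" and d :: "'a \<Rightarrow> 'a \<Rightarrow> real" +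
  fixes B :: "'a set" and wt :: "'a \<Rightarrow> nat"
  assumes finite_B: "finite B" and independent_B: "independent B"
    and wt: "b \<in> B \<Longrightarrow> wt b \<in> {1..\<kappa>}" and layer: "b \<in> B \<Longrightarrow> b \<in> V (wt b)"
    and mul_closed: "x \<in> span B \<Longrightarrow> y \<in> span B \<Longrightarrow> x \<otimes>\<^bsub>G\<^esub> y \<in> span B"
begin

definition comb :: "('a \<Rightarrow> real) \<Rightarrow> 'a" where
  "comb c = (\<Sum>b\<in>B. c b *\<^sub>R b)"

definition coord :: "'a \<Rightarrow> 'a \<Rightarrow> real" where
  "coord b = (SOME g. linear g \<and> (\<forall>b'\<in>B. g b' = of_bool (b' = b)))"

lemma coord: "linear (coord b)" "b' \<in> B \<Longrightarrow> coord b b' = of_bool (b' = b)"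
proof -
  have "\<exists>g :: 'a \<Rightarrow> real. linear g \<and> (\<forall>b'\<in>B. g b' = of_bool (b' = b))"
    using linear_independent_extend[OF independent_B, of "\<lambda>b'. of_bool (b' = b) :: real"] by blast
  then have "linear (coord b) \<and> (\<forall>b'\<in>B. coord b b' = of_bool (b' = b))"
    unfolding coord_def by (rule someI_ex)
  then show "linear (coord b)" "b' \<in> B \<Longrightarrow> coord b b' = of_bool (b' = b)"
    by auto
qed

lemma coord_comb:
  assumes "b \<in> B"
  shows "coord b (comb c) = c b"
proof -
  have "coord b (comb c) = (\<Sum>b'\<in>B. c b' * of_bool (b' = b))"
    unfolding comb_def by (simp add: linear_sum[OF coord(1)] linear_scale[OF coord(1)] coord(2))
  also have "\<dots> = c b"
    using assms finite_B by (simp add: of_bool_def if_distrib[of "(*) _"] cong: if_cong)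
  finally show ?thesis .
qed

lemma comb_mem: "comb c \<in> span B"
  unfolding comb_def by (intro span_sum span_scale span_base)

lemma comb_coord:
  assumes "x \<in> span B"
  shows "comb (\<lambda>b. coord b x) = x"
proof -
  obtain c where x: "x = comb c"
    using assms span_finite[OF finite_B] by (auto simp: comb_def)
  show ?thesis
    unfolding x using coord_comb[of _ c] by (simp add: comb_def)
qed

lemma dil_comb: "dil r (comb c) = comb (\<lambda>b. r ^ wt b * c b)"
  unfolding comb_def linear_sum[OF linear_dil]
  by (intro sum.cong refl) (simp add: linear_scale[OF linear_dil] dil_layer[OF layer wt] mult.commute)

lemma dil_mem:
  assumes "x \<in> span B"
  shows "dil r x \<in> span B"
proof -
  have "dil r x = dil r (comb (\<lambda>b. coord b x))"
    using assms by (simp add: comb_coord)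
  then show ?thesis
    by (simp add: dil_comb comb_mem)
qed

lemma minus_mul_mem: "x \<in> span B \<Longrightarrow> y \<in> span B \<Longrightarrow> - x \<cdot> y \<in> span B"
  by (simp add: mul_closed span_neg)

lemma coord_dil:
  assumes "x \<in> span B" "b \<in> B"
  shows "coord b (dil r x) = r ^ wt b * coord b x"
  using dil_comb[of r "\<lambda>b. coord b x"] assms by (simp add: comb_coord coord_comb)

lemma coord_bound:
  obtains K where "0 < K" "\<And>b x. b \<in> B \<Longrightarrow> \<bar>coord b x\<bar> \<le> K * norm x"
proof -
  have "\<exists>K>0. \<forall>x. norm (coord b x) \<le> K * norm x" for b
    using linear_bounded_pos[OF coord(1)[of b]] by blast
  then obtain K where K: "\<And>b. 0 < K b" "\<And>b x. \<bar>coord b x\<bar> \<le> K b * norm x"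
    by (metis real_norm_def)
  have "\<bar>coord b x\<bar> \<le> ((\<Sum>b\<in>B. K b) + 1) * norm x" if "b \<in> B" for b x
  proof -
    have "K b \<le> (\<Sum>b\<in>B. K b)"
      using that finite_B K(1) by (intro member_le_sum) (auto intro: less_imp_le)
    then have "K b * norm x \<le> ((\<Sum>b\<in>B. K b) + 1) * norm x"
      by (intro mult_right_mono) auto
    then show ?thesis
      using K(2)[of b x] by linarith
  qed
  moreover have "0 < (\<Sum>b\<in>B. K b) + 1"
    using K(1) by (intro add_nonneg_pos sum_nonneg) (auto intro: less_imp_le)
  ultimately show ?thesis
    using that by blast
qed

definition basis_norm :: real where
  "basis_norm = (\<Sum>b\<in>B. norm b) + 1"

lemma basis_norm_pos: "0 < basis_norm"
  unfolding basis_norm_def by (intro add_nonneg_pos sum_nonneg) auto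

lemma norm_le_coords:
  assumes "x \<in> span B" "\<And>b. b \<in> B \<Longrightarrow> \<bar>coord b x\<bar> \<le> t" "0 \<le> t"
  shows "norm x \<le> t * basis_norm"
proof -
  have "norm x = norm (comb (\<lambda>b. coord b x))"
    using assms by (simp add: comb_coord)
  also have "\<dots> \<le> (\<Sum>b\<in>B. t * norm b)"
    unfolding comb_def using assms(2) by (intro sum_norm_le) (simp add: mult_right_mono)
  also have "\<dots> \<le> t * basis_norm"
    using assms(3) by (simp add: basis_norm_def sum_distrib_left[symmetric] algebra_simps)
  finally show ?thesis .
qed

text \<open>Pigeonhole principle in a coordinate grid of mesh \<open>s / (2 * basis_norm)\<close>:
  two points in one grid cell are at most \<open>s / 2\<close> apart. The summand 2 in each factor
  pays for rounding.\<close>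

lemma separated_card_le:
  assumes P: "P \<subseteq> span B" and box: "\<And>p b. p \<in> P \<Longrightarrow> b \<in> B \<Longrightarrow> \<bar>coord b p\<bar> \<le> \<rho> b"
    and rho: "\<And>b. b \<in> B \<Longrightarrow> 0 \<le> \<rho> b"
    and s: "0 < s" and sep: "\<And>p q. p \<in> P \<Longrightarrow> q \<in> P \<Longrightarrow> p \<noteq> q \<Longrightarrow> s \<le> norm (p - q)"
  shows "finite P" "real (card P) \<le> (\<Prod>b\<in>B. 2 * \<rho> b * (2 * basis_norm / s) + 2)"
proof -
  define t where "t = s / (2 * basis_norm)"
  have t: "0 < t"
    using s basis_norm_pos by (simp add: t_def)
  define f where "f p = restrict (\<lambda>b. \<lfloor>coord b p / t\<rfloor>) B" for p
  define I where "I b = {\<lfloor>- \<rho> b / t\<rfloor>..\<lfloor>\<rho> b / t\<rfloor>}" for b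
  have inj: "inj_on f P"
  proof (rule inj_onI, rule ccontr)
    fix p q assume pq: "p \<in> P" "q \<in> P" "f p = f q" "p \<noteq> q"
    have "\<bar>coord b (p - q)\<bar> \<le> t" if "b \<in> B" for b
    proof -
      have "\<lfloor>coord b p / t\<rfloor> = \<lfloor>coord b q / t\<rfloor>"
        using fun_cong[OF pq(3), of b] that by (simp add: f_def)
      then have "\<bar>coord b p / t - coord b q / t\<bar> \<le> 1"
        by linarith
      then have "\<bar>coord b p - coord b q\<bar> / t \<le> 1"
        using t by (simp add: diff_divide_distrib[symmetric] abs_divide)
      then show ?thesis
        using t by (simp add: linear_diff[OF coord(1)])
    qed
    then have "norm (p - q) \<le> t * basis_norm"
      using P pq t by (intro norm_le_coords) (auto intro: span_diff)
    also have "\<dots> = s / 2"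
      using basis_norm_pos by (simp add: t_def)
    finally show False
      using sep[OF pq(1,2,4)] s by simp
  qed
  have im: "f ` P \<subseteq> PiE B I"
  proof (rule image_subsetI, rule PiE_I)
    show "f p b \<in> I b" if "p \<in> P" "b \<in> B" for p b
    proof -
      have "- \<rho> b / t \<le> coord b p / t" "coord b p / t \<le> \<rho> b / t"
        using box[OF that] t by (intro divide_right_mono; simp add: abs_le_iff; linarith)+
      then have "\<lfloor>- \<rho> b / t\<rfloor> \<le> \<lfloor>coord b p / t\<rfloor>" "\<lfloor>coord b p / t\<rfloor> \<le> \<lfloor>\<rho> b / t\<rfloor>"
        by (simp_all only: floor_mono)
      moreover have "f p b = \<lfloor>coord b p / t\<rfloor>"
        using that by (simp add: f_def)
      ultimately show ?thesis
        unfolding I_def by (simp only: atLeastAtMost_iff simp_thms)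
    qed
  qed (simp add: f_def)
  have fin: "finite (PiE B I)"
    by (intro finite_PiE finite_B) (simp add: I_def)
  show "finite P"
    using inj im fin by (meson finite_imageD finite_subset)
  show "real (card P) \<le> (\<Prod>b\<in>B. 2 * \<rho> b * (2 * basis_norm / s) + 2)"
  proof -
    have "real (card P) \<le> real (card (PiE B I))"
      using card_inj_on_le[OF inj im fin] by simp
    also have "\<dots> = (\<Prod>b\<in>B. real (card (I b)))"
      by (simp add: card_PiE finite_B)
    also have "\<dots> \<le> (\<Prod>b\<in>B. 2 * \<rho> b * (2 * basis_norm / s) + 2)"
    proof (intro prod_mono conjI)
      fix b assume "b \<in> B"
      then have \<rho>: "0 \<le> \<rho> b"
        by (rule rho)
      have "real (card (I b)) = real_of_int (\<lfloor>\<rho> b / t\<rfloor> - \<lfloor>- \<rho> b / t\<rfloor> + 1)"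
      proof -
        have "\<lfloor>- \<rho> b / t\<rfloor> \<le> \<lfloor>\<rho> b / t\<rfloor>"
          using \<rho> t by (intro floor_mono divide_right_mono) auto
        then show ?thesis
          by (simp add: I_def)
      qed
      also have "\<dots> \<le> \<rho> b / t + \<rho> b / t + 2"
      proof -
        have "- \<rho> b / t = - (\<rho> b / t)"
          by simp
        then show ?thesis
          using of_int_floor_le[of "\<rho> b / t"] floor_correct[of "- \<rho> b / t", THEN conjunct2]
          unfolding of_int_add of_int_diff of_int_1 by linarith
      qed
      also have "\<dots> = 2 * \<rho> b * (2 * basis_norm / s) + 2"
        by (simp add: t_def)
      finally show "real (card (I b)) \<le> 2 * \<rho> b * (2 * basis_norm / s) + 2" .
    qed simp
    finally show ?thesis .
  qed
qed

definition lattice :: "real \<Rightarrow> ('a \<Rightarrow> nat) \<Rightarrow> 'a set" where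
  "lattice \<eta> n = (\<lambda>k. comb (\<lambda>b. \<eta> * real (k b))) ` (PiE B (\<lambda>b. {..<n b}))"

lemma lattice_mem:
  assumes "y \<in> lattice \<eta> n" "0 < \<eta>"
  shows "y \<in> span B" "b \<in> B \<Longrightarrow> 0 \<le> coord b y" "b \<in> B \<Longrightarrow> coord b y \<le> \<eta> * (real (n b) - 1)"
proof -
  obtain k where k: "k \<in> PiE B (\<lambda>b. {..<n b})" "y = comb (\<lambda>b. \<eta> * real (k b))"
    using assms(1) by (auto simp: lattice_def)
  show "y \<in> span B"
    by (simp add: k comb_mem)
  assume b: "b \<in> B"
  then have "real (k b) \<le> real (n b) - 1"
    using k(1) by (auto simp: PiE_iff Ball_def lessThan_iff dest!: spec[of _ b])
  then show "0 \<le> coord b y" "coord b y \<le> \<eta> * (real (n b) - 1)"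
    using b assms(2) by (simp_all add: k coord_comb)
qed

lemma card_lattice:
  assumes "0 < \<eta>"
  shows "finite (lattice \<eta> n)" "card (lattice \<eta> n) = (\<Prod>b\<in>B. n b)"
proof -
  have "inj_on (\<lambda>k. comb (\<lambda>b. \<eta> * real (k b))) (PiE B (\<lambda>b. {..<n b}))"
  proof (rule inj_onI)
    fix k k' assume k: "k \<in> PiE B (\<lambda>b. {..<n b})" "k' \<in> PiE B (\<lambda>b. {..<n b})"
      and eq: "comb (\<lambda>b. \<eta> * real (k b)) = comb (\<lambda>b. \<eta> * real (k' b))"
    have "k b = k' b" if "b \<in> B" for b
      using arg_cong[OF eq, of "coord b"] assms that by (simp add: coord_comb)
    with k show "k = k'"
      by (intro PiE_ext) auto
  qed
  then have "card (lattice \<eta> n) = card (PiE B (\<lambda>b. {..<n b}))"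
    unfolding lattice_def by (rule card_image)
  then show "card (lattice \<eta> n) = (\<Prod>b\<in>B. n b)"
    by (simp add: card_PiE finite_B)
  show "finite (lattice \<eta> n)"
    unfolding lattice_def by (intro finite_imageI finite_PiE finite_B) auto
qed

lemma lattice_separated:
  obtains c where "0 < c"
    "\<And>\<eta> n y y'. 0 < \<eta> \<Longrightarrow> y \<in> lattice \<eta> n \<Longrightarrow> y' \<in> lattice \<eta> n \<Longrightarrow> y \<noteq> y' \<Longrightarrow> c * \<eta> \<le> norm (y - y')"
proof -
  obtain K where K: "0 < K" "\<And>b x. b \<in> B \<Longrightarrow> \<bar>coord b x\<bar> \<le> K * norm x"
    using coord_bound by blast
  have "1 / K * \<eta> \<le> norm (y - y')" if \<eta>: "0 < \<eta>" and y: "y \<in> lattice \<eta> n" "y' \<in> lattice \<eta> n" "y \<noteq> y'" for \<eta> n y y'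
  proof -
    obtain k k' where k: "y = comb (\<lambda>b. \<eta> * real (k b))" "y' = comb (\<lambda>b. \<eta> * real (k' b))"
      using y(1,2) by (auto simp: lattice_def)
    obtain b where b: "b \<in> B" "k b \<noteq> k' b"
      using y(3) k by (metis (mono_tags, lifting) comb_def sum.cong)
    have "\<eta> * 1 \<le> \<eta> * \<bar>real (k b) - real (k' b)\<bar>"
      using b(2) \<eta> by (intro mult_left_mono) auto
    also have "\<dots> = \<bar>coord b (y - y')\<bar>"
      using b(1) \<eta> by (simp add: k linear_diff[OF coord(1)] coord_comb right_diff_distrib[symmetric] abs_mult)
    also have "\<dots> \<le> K * norm (y - y')"
      by (rule K(2)[OF b(1)])
    finally show ?thesis
      using K(1) by (simp add: field_simps)
  qed
  with K(1) show ?thesis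
    by (intro that[of "1 / K"]) auto
qed

section \<open>Lower bound for the Hausdorff dimension\<close>

abbreviation hdim :: nat where
  "hdim \<equiv> \<Sum>b\<in>B. wt b"

definition unit_box :: "'a set" where
  "unit_box = {x \<in> span B. \<forall>b\<in>B. 0 \<le> coord b x \<and> coord b x \<le> 1}"

lemma compact_unit_box: "compact unit_box"
proof -
  have "norm x \<le> 1 * basis_norm" if "x \<in> unit_box" for x
    using that by (intro norm_le_coords) (auto simp: unit_box_def)
  then have "bounded unit_box"
    unfolding bounded_iff by blast
  moreover have "closed unit_box"
  proof -
    have cont: "continuous_on UNIV (coord b)" for b
      using coord(1) by (simp add: linear_continuous_on linear_conv_bounded_linear)
    have "closed {x. 0 \<le> coord b x \<and> coord b x \<le> 1}" for b
      by (intro closed_Collect_conj closed_Collect_le cont continuous_intros)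
    then have "closed (span B \<inter> (\<Inter>b\<in>B. {x. 0 \<le> coord b x \<and> coord b x \<le> 1}))"
      by (intro closed_Int closed_INT closed_span) auto
    moreover have "unit_box = span B \<inter> (\<Inter>b\<in>B. {x. 0 \<le> coord b x \<and> coord b x \<le> 1})"
      by (auto simp: unit_box_def)
    ultimately show ?thesis
      by simp
  qed
  ultimately show ?thesis
    by (simp add: compact_eq_bounded_closed)
qed

text \<open>Counting points of a fine lattice: a ball of radius D contains at most
  const * D^hdim / \<eta>^(card B) lattice points, whereas the unit box contains \<eta>^(- card B) of them.\<close>

lemma unit_box_cover_lower:
  obtains c where "0 < c"
    "\<And>J x D. finite J \<Longrightarrow> (\<And>j. j \<in> J \<Longrightarrow> x j \<in> unit_box \<and> 0 < D j \<and> D j \<le> (1::real)) \<Longrightarrow>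
       unit_box \<subseteq> (\<Union>j\<in>J. cl_ball d (x j) (D j)) \<Longrightarrow> c \<le> (\<Sum>j\<in>(J::nat set). D j ^ hdim)"
proof -
  obtain K where K: "0 < K" "\<And>b x. b \<in> B \<Longrightarrow> \<bar>coord b x\<bar> \<le> K * norm x"
    using coord_bound by blast
  obtain R1 where R1: "\<And>x. d 0 x \<le> 1 \<Longrightarrow> norm x \<le> R1"
    using d_zero_proper[of 1] by blast
  have "0 \<le> R1"
    using R1[of 0] by simp
  obtain \<Lambda> where \<Lambda>: "0 < \<Lambda>"
    "\<And>x y z. norm x \<le> max basis_norm R1 \<Longrightarrow> norm y \<le> max basis_norm R1 \<Longrightarrow> norm z \<le> max basis_norm R1 \<Longrightarrow>
      norm (x \<cdot> y - x \<cdot> z) \<le> \<Lambda> * norm (y - z)"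
    using mul_lipschitz[of "max basis_norm R1"] by blast
  obtain c where c: "0 < c" "\<And>\<eta> n y y'. 0 < \<eta> \<Longrightarrow> y \<in> lattice \<eta> n \<Longrightarrow> y' \<in> lattice \<eta> n \<Longrightarrow> y \<noteq> y' \<Longrightarrow> c * \<eta> \<le> norm (y - y')"
    using lattice_separated by blast
  \<comment> \<open>\<open>K * R1\<close> bounds the coordinates on the unit ball of
    \<open>d\<close>, and \<open>c / \<Lambda>\<close> is the separation per unit of mesh that is
    left after a translation.\<close>
  define M where "M = 2 * (K * R1) * (2 * basis_norm / (c / \<Lambda>)) + 2"
  have "2 \<le> M"
    unfolding M_def using K(1) \<open>0 \<le> R1\<close> basis_norm_pos c(1) \<Lambda>(1) by simp
  have unit_norm: "norm x \<le> basis_norm" if "x \<in> unit_box" for x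
    using norm_le_coords[of x 1] that by (auto simp: unit_box_def)
  show ?thesis
  proof (rule that[of "1 / M ^ card B"])
    show "0 < 1 / M ^ card B"
      using \<open>2 \<le> M\<close> by simp
    fix J :: "nat set" and x D
    assume J: "finite J" and xD: "\<And>j. j \<in> J \<Longrightarrow> x j \<in> unit_box \<and> 0 < D j \<and> D j \<le> (1::real)"
      and cover: "unit_box \<subseteq> (\<Union>j\<in>J. cl_ball d (x j) (D j))"
    \<comment> \<open>The mesh is chosen after the finite cover and below every
      \<open>D j ^ \<kappa>\<close>. Then the rounding term 2 in each factor of the count is
      dominated by a multiple of \<open>D j ^ wt b / \<eta>\<close>.\<close>
    have "\<forall>\<^sub>F n in sequentially. \<forall>j\<in>J. inverse (real (Suc n)) \<le> D j ^ \<kappa>"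
    proof (rule eventually_ball_finite[OF J], rule ballI)
      fix j assume "j \<in> J"
      then have "0 < D j ^ \<kappa>"
        using xD by simp
      from order_tendstoD(2)[OF LIMSEQ_inverse_real_of_nat this]
      show "\<forall>\<^sub>F n in sequentially. inverse (real (Suc n)) \<le> D j ^ \<kappa>"
        by eventually_elim simp
    qed
    then obtain n where n: "\<And>j. j \<in> J \<Longrightarrow> inverse (real (Suc n)) \<le> D j ^ \<kappa>"
      unfolding eventually_sequentially by blast
    define \<eta> where "\<eta> = inverse (real (Suc n))"
    have \<eta>: "0 < \<eta>"
      by (simp add: \<eta>_def)
    let ?L = "lattice \<eta> (\<lambda>_. Suc n)"
    have L_sub: "?L \<subseteq> unit_box"
    proof
      fix y assume y: "y \<in> ?L"
      have "\<eta> * (real (Suc n) - 1) \<le> 1"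
        by (simp add: \<eta>_def field_simps)
      then show "y \<in> unit_box"
        using lattice_mem[OF y \<eta>] by (force simp: unit_box_def)
    qed
    have count: "real (card (?L \<inter> cl_ball d (x j) (D j))) \<le> M ^ card B * D j ^ hdim * real (Suc n) ^ card B"
      if j: "j \<in> J" for j
    proof -
      have xj: "x j \<in> unit_box" "x j \<in> span B" and D: "0 < D j" "D j \<le> 1"
        using xD[OF j] by (auto simp: unit_box_def)
      \<comment> \<open>Moved to 0, the ball lies in a box whose side in direction \<open>b\<close>
        is proportional to \<open>D j ^ wt b\<close>, because dilations act diagonally on
        coordinates.\<close>
      let ?P = "(\<lambda>y. - x j \<cdot> y) ` (?L \<inter> cl_ball d (x j) (D j))"
      have Pd: "p \<in> span B \<and> d 0 p \<le> D j" if p: "p \<in> ?P" for p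
      proof -
        obtain y where y: "y \<in> ?L" "y \<in> cl_ball d (x j) (D j)" "p = - x j \<cdot> y"
          using p by blast
        then show ?thesis
          using lattice_mem(1)[OF y(1) \<eta>] xj(2) d_translate[of "x j" y]
          by (auto simp: cl_ball_eq intro: minus_mul_mem)
      qed
      have Pnorm: "norm p \<le> max basis_norm R1" if "p \<in> ?P" for p
        using R1[of p] Pd[OF that] D by auto
      have box: "\<bar>coord b p\<bar> \<le> K * R1 * D j ^ wt b" if p: "p \<in> ?P" and b: "b \<in> B" for p b
      proof -
        let ?u = "dil (1 / D j) p"
        have u: "?u \<in> span B"
          using Pd[OF p] by (intro dil_mem) simp
        have "d 0 ?u \<le> 1"
          using Pd[OF p] D by (simp add: d_zero_dil)
        then have "norm ?u \<le> R1"
          by (rule R1)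
        then have "\<bar>coord b ?u\<bar> \<le> K * R1"
          using K(2)[OF b, of ?u] K(1) by (meson mult_left_mono less_imp_le order_trans)
        moreover have "p = dil (D j) ?u"
          using D by (simp add: dil_dil)
        then have "coord b p = D j ^ wt b * coord b ?u"
          using coord_dil[OF u b, of "D j"] by simp
        ultimately show ?thesis
          using D by (simp add: abs_mult mult.commute mult_right_mono)
      qed
      have sep: "c / \<Lambda> * \<eta> \<le> norm (p - q)" if pq: "p \<in> ?P" "q \<in> ?P" "p \<noteq> q" for p q
      proof -
        obtain y where y: "y \<in> ?L" "p = - x j \<cdot> y"
          using pq(1) by blast
        obtain z where z: "z \<in> ?L" "q = - x j \<cdot> z"
          using pq(2) by blast
        have "c * \<eta> \<le> norm (y - z)"
          using pq(3) y z by (intro c(2)[OF \<eta> y(1) z(1)]) auto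
        also have "\<dots> = norm (x j \<cdot> p - x j \<cdot> q)"
          using y z by simp
        also have "\<dots> \<le> \<Lambda> * norm (p - q)"
          using unit_norm[OF xj(1)] Pnorm pq by (intro \<Lambda>(2)) auto
        finally show ?thesis
          using \<Lambda>(1) by (simp add: field_simps)
      qed
      have "inj_on (\<lambda>y. - x j \<cdot> y) (?L \<inter> cl_ball d (x j) (D j))"
        by (rule inj_onI) (metis minus_mul_cancel(2))
      then have "real (card (?L \<inter> cl_ball d (x j) (D j))) = real (card ?P)"
        by (simp add: card_image)
      also have "\<dots> \<le> (\<Prod>b\<in>B. 2 * (K * R1 * D j ^ wt b) * (2 * basis_norm / (c / \<Lambda> * \<eta>)) + 2)"
        using Pd box sep \<eta> c(1) \<Lambda>(1) K(1) \<open>0 \<le> R1\<close> D by (intro separated_card_le(2)) auto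
      also have "\<dots> \<le> (\<Prod>b\<in>B. M * D j ^ wt b * real (Suc n))"
      proof (intro prod_mono conjI)
        fix b assume b: "b \<in> B"
        show "0 \<le> 2 * (K * R1 * D j ^ wt b) * (2 * basis_norm / (c / \<Lambda> * \<eta>)) + 2"
          using K(1) \<open>0 \<le> R1\<close> D basis_norm_pos c(1) \<Lambda>(1) \<eta> by (intro add_nonneg_nonneg mult_nonneg_nonneg divide_nonneg_nonneg) auto
        have "inverse (real (Suc n)) \<le> D j ^ wt b"
        proof -
          have "D j ^ \<kappa> \<le> D j ^ wt b"
            using D wt[OF b] by (intro power_decreasing) auto
          then show ?thesis
            using n[OF j] by linarith
        qed
        then have "1 \<le> D j ^ wt b * real (Suc n)"
          by (simp add: inverse_eq_divide pos_divide_le_eq del: of_nat_Suc)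
        then have "2 * (K * R1 * D j ^ wt b) * (2 * basis_norm / (c / \<Lambda> * \<eta>)) + 2
            \<le> 2 * (K * R1 * D j ^ wt b) * (2 * basis_norm / (c / \<Lambda> * \<eta>)) + 2 * (D j ^ wt b * real (Suc n))"
          by simp
        also have "\<dots> = M * D j ^ wt b * real (Suc n)"
          by (simp add: M_def \<eta>_def field_simps del: of_nat_Suc)
        finally show "2 * (K * R1 * D j ^ wt b) * (2 * basis_norm / (c / \<Lambda> * \<eta>)) + 2 \<le> M * D j ^ wt b * real (Suc n)" .
      qed
      also have "\<dots> = M ^ card B * D j ^ hdim * real (Suc n) ^ card B"
        by (simp add: prod.distrib power_sum)
      finally show ?thesis .
    qed
    have "?L = (\<Union>j\<in>J. ?L \<inter> cl_ball d (x j) (D j))"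
      using L_sub cover by blast
    then have "card ?L \<le> (\<Sum>j\<in>J. card (?L \<inter> cl_ball d (x j) (D j)))"
      using card_UN_le[OF J, of "\<lambda>j. ?L \<inter> cl_ball d (x j) (D j)"] by simp
    then have "real (card ?L) \<le> real (\<Sum>j\<in>J. card (?L \<inter> cl_ball d (x j) (D j)))"
      by (rule of_nat_mono)
    then have "real (Suc n) ^ card B \<le> (\<Sum>j\<in>J. real (card (?L \<inter> cl_ball d (x j) (D j))))"
      unfolding card_lattice(2)[OF \<eta>] by (simp only: prod_constant of_nat_power of_nat_sum)
    also have "\<dots> \<le> (\<Sum>j\<in>J. M ^ card B * D j ^ hdim * real (Suc n) ^ card B)"
      by (intro sum_mono count)
    also have "\<dots> = (M ^ card B * (\<Sum>j\<in>J. D j ^ hdim)) * real (Suc n) ^ card B"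
      by (simp add: sum_distrib_left sum_distrib_right)
    finally have "1 \<le> M ^ card B * (\<Sum>j\<in>J. D j ^ hdim)"
      by (simp del: of_nat_Suc)
    then show "1 / M ^ card B \<le> (\<Sum>j\<in>J. D j ^ hdim)"
      using \<open>2 \<le> M\<close> by (simp add: pos_divide_le_eq mult.commute)
  qed
qed

text \<open>A cover of small cost is turned into open balls with centres in the unit box, and
  compactness leaves finitely many of them. As the radii are below 1, their powers of exponent
  \<open>hdim\<close> are at most those of exponent \<open>s\<close>, against
  \<open>unit_box_cover_lower\<close>.\<close>

lemma hausdorff_measure_pos:
  assumes s: "0 < s" "s \<le> real hdim"
  shows "hausdorff_measure d s (span B) \<noteq> 0"
proof
  assume zero: "hausdorff_measure d s (span B) = 0"
  obtain c where c: "0 < c"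
    "\<And>J x D. finite J \<Longrightarrow> (\<And>j. j \<in> J \<Longrightarrow> x j \<in> unit_box \<and> 0 < D j \<and> D j \<le> (1::real)) \<Longrightarrow>
       unit_box \<subseteq> (\<Union>j\<in>J. cl_ball d (x j) (D j)) \<Longrightarrow> c \<le> (\<Sum>j\<in>(J::nat set). D j ^ hdim)"
    using unit_box_cover_lower by blast
  let ?covers = "{E :: nat \<Rightarrow> 'a set. span B \<subseteq> (\<Union>j. E j) \<and> (\<forall>j. diameter_wrt d (E j) \<le> ennreal (1 / 2))}"
  let ?cost = "\<lambda>E :: nat \<Rightarrow> 'a set. \<Sum>j. ennreal (enn2real (diameter_wrt d (E j)) powr s)"
  have "(INF E\<in>?covers. ?cost E) \<le> hausdorff_measure d s (span B)"
    unfolding hausdorff_measure_def by (rule SUP_upper) simp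
  then have "(INF E\<in>?covers. ?cost E) < ennreal (c / 2)"
    using zero c(1) by simp
  from this[unfolded INF_less_iff] obtain E where E: "E \<in> ?covers" "?cost E < ennreal (c / 2)"
    by blast
  define t where "t j = enn2real (diameter_wrt d (E j))" for j
  have diam: "diameter_wrt d (E j) = ennreal (t j)" "t j \<le> 1 / 2" "0 \<le> t j" for j
  proof -
    have le: "diameter_wrt d (E j) \<le> ennreal (1 / 2)"
      using E(1) by blast
    then have "diameter_wrt d (E j) < Orderings.top"
      by (rule le_less_trans) (rule ennreal_less_top)
    then show eq: "diameter_wrt d (E j) = ennreal (t j)"
      by (simp only: t_def ennreal_enn2real)
    have "ennreal (t j) \<le> ennreal (1 / 2)"
      using le unfolding eq .
    then show "t j \<le> 1 / 2"
      by (subst (asm) ennreal_le_iff) auto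
    show "0 \<le> t j"
      by (simp add: t_def)
  qed
  have dist_le: "d x y \<le> t j" if "x \<in> E j" "y \<in> E j" for x y j
  proof -
    have "ennreal (d x y) \<le> diameter_wrt d (E j)"
      unfolding diameter_wrt_def using that by (intro SUP_upper2[of x] SUP_upper2[of y]) auto
    then show ?thesis
      using diam(1,3)[of j] by simp
  qed
  \<comment> \<open>The budget \<open>c\<close> is split: the diameters cost less than
    \<open>c / 2\<close>, and the enlargements add at most \<open>c / 2\<close> through a geometric
    series. Diameters at most 1/2 leave room for radii below 1.\<close>
  have "\<exists>D. t j < D \<and> D < 1 \<and> D powr s < t j powr s + c / 2 * (1 / 2) ^ Suc j" for j
    using powr_near[OF diam(3)[of j] s(1), of "c / 2 * (1 / 2) ^ Suc j" 1] c(1) diam(2)[of j] by auto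
  then obtain D where D: "\<And>j. t j < D j" "\<And>j. D j < 1" "\<And>j. D j powr s < t j powr s + c / 2 * (1 / 2) ^ Suc j"
    by metis
  have Dpos: "0 < D j" for j
    using D(1)[of j] diam(3)[of j] by linarith
  define I where "I = {j. E j \<inter> unit_box \<noteq> {}}"
  define x where "x j = (SOME x. x \<in> E j \<inter> unit_box)" for j
  have x: "x j \<in> E j" "x j \<in> unit_box" if "j \<in> I" for j
    using that someI_ex[of "\<lambda>x. x \<in> E j \<inter> unit_box"] unfolding I_def x_def by blast+
  have box_cover: "unit_box \<subseteq> (\<Union>j\<in>I. {y. d (x j) y < D j})"
  proof
    fix y assume y: "y \<in> unit_box"
    then have "y \<in> (\<Union>j. E j)"
      using E(1) unfolding unit_box_def by blast
    then obtain j where j: "y \<in> E j"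
      by blast
    then have "j \<in> I"
      using y by (auto simp: I_def)
    moreover have "d (x j) y < D j"
      using dist_le[OF x(1)[OF \<open>j \<in> I\<close>] j] D(1)[of j] by linarith
    ultimately show "y \<in> (\<Union>j\<in>I. {y. d (x j) y < D j})"
      by blast
  qed
  have op: "open {y. d (x j) y < D j}" for j
    by (intro open_Collect_less continuous_intros)
  obtain J where J: "J \<subseteq> I" "finite J" "unit_box \<subseteq> (\<Union>j\<in>J. {y. d (x j) y < D j})"
    by (rule compactE_image[OF compact_unit_box op box_cover])
  have "c \<le> (\<Sum>j\<in>J. D j ^ hdim)"
  proof (rule c(2)[OF J(2)])
    show "x j \<in> unit_box \<and> 0 < D j \<and> D j \<le> 1" if "j \<in> J" for j
      using that J(1) x(2) Dpos D(2)[of j] by auto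
    show "unit_box \<subseteq> (\<Union>j\<in>J. cl_ball d (x j) (D j))"
      using J(3) by (force simp: cl_ball_eq)
  qed
  also have "\<dots> \<le> (\<Sum>j\<in>J. D j powr s)"
  proof (rule sum_mono)
    fix j
    have "D j ^ hdim = D j powr real hdim"
      by (rule powr_realpow[OF Dpos, symmetric])
    also have "\<dots> \<le> D j powr s"
      using Dpos[of j] D(2)[of j] s(2) by (intro powr_mono') auto
    finally show "D j ^ hdim \<le> D j powr s" .
  qed
  also have "\<dots> \<le> (\<Sum>j\<in>J. t j powr s) + (\<Sum>j\<in>J. c / 2 * (1 / 2) ^ Suc j)"
    unfolding sum.distrib[symmetric] by (intro sum_mono less_imp_le D(3))
  also have "(\<Sum>j\<in>J. c / 2 * (1 / 2) ^ Suc j) \<le> c / 2"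
  proof -
    have "(\<lambda>j. c / 2 * (1 / 2) ^ Suc j) sums (c / 2 * 1)"
      by (intro sums_mult power_half_series)
    then show ?thesis
      using sum_le_suminf[of "\<lambda>j. c / 2 * (1 / 2) ^ Suc j" J] J(2) c(1)
      by (simp add: sums_iff)
  qed
  also have "(\<Sum>j\<in>J. t j powr s) < c / 2"
  proof -
    have "ennreal (\<Sum>j\<in>J. t j powr s) = (\<Sum>j\<in>J. ennreal (t j powr s))"
      by (simp add: sum_ennreal)
    also have "\<dots> \<le> (\<Sum>j. ennreal (t j powr s))"
      using J(2) by (intro sum_le_suminf) auto
    also have "\<dots> < ennreal (c / 2)"
      using E(2) by (simp add: t_def)
    finally show ?thesis
      by (simp add: ennreal_less_iff sum_nonneg)
  qed
  finally show False
    by simp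
qed

section \<open>Upper bound for the Hausdorff dimension\<close>

definition big_box :: "real \<Rightarrow> 'a set" where
  "big_box R = {x \<in> span B. \<forall>b\<in>B. \<bar>coord b x\<bar> \<le> R}"

text \<open>Each point of an e-separated set carries a disjoint translated copy of a lattice of mesh
  const * e^\<kappa> in a ball of radius e / 4, and all these points stay separated.\<close>

lemma separated_set_card:
  assumes "0 \<le> R"
  obtains C where "0 < C"
    "\<And>e X. 0 < e \<Longrightarrow> e \<le> 1 \<Longrightarrow> X \<subseteq> big_box R \<Longrightarrow> finite X \<Longrightarrow> (\<And>x y. x \<in> X \<Longrightarrow> y \<in> X \<Longrightarrow> x \<noteq> y \<Longrightarrow> e \<le> d x y) \<Longrightarrow>
      real (card X) * e ^ hdim \<le> C"
proof -
  obtain K where K: "0 < K" "\<And>b x. b \<in> B \<Longrightarrow> \<bar>coord b x\<bar> \<le> K * norm x"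
    using coord_bound by blast
  obtain \<delta> where \<delta>: "0 < \<delta>" "\<And>x. norm x < \<delta> \<Longrightarrow> d 0 x < 1 / 4"
    using d_small[of "1 / 4"] by auto
  define r0 where "r0 = \<delta> / (2 * basis_norm)"
  have r0: "0 < r0"
    using \<delta>(1) basis_norm_pos by (simp add: r0_def)
  have small: "d 0 z < 1 / 4" if "z \<in> span B" "\<And>b. b \<in> B \<Longrightarrow> \<bar>coord b z\<bar> \<le> r0" for z
  proof (rule \<delta>(2))
    have "norm z \<le> r0 * basis_norm"
      using that r0 by (intro norm_le_coords) auto
    also have "\<dots> = \<delta> / 2"
      using basis_norm_pos by (simp add: r0_def)
    finally show "norm z < \<delta>"
      using \<delta>(1) by simp
  qed
  obtain M where M: "\<And>x. norm x \<le> R * basis_norm \<Longrightarrow> d 0 x \<le> M"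
    using d_zero_bounded[of "R * basis_norm"] by blast
  obtain R1 where R1: "\<And>x. d 0 x \<le> max M 0 + 1 \<Longrightarrow> norm x \<le> R1"
    using d_zero_proper[of "max M 0 + 1"] by blast
  have "0 \<le> R1"
    using R1[of 0] by simp
  obtain \<Lambda> where \<Lambda>: "0 < \<Lambda>"
    "\<And>x y z. norm x \<le> R1 \<Longrightarrow> norm y \<le> R1 \<Longrightarrow> norm z \<le> R1 \<Longrightarrow> norm (x \<cdot> y - x \<cdot> z) \<le> \<Lambda> * norm (y - z)"
    using mul_lipschitz[of R1] by blast
  obtain c1 where c1: "0 < c1" "\<And>\<eta> n y y'. 0 < \<eta> \<Longrightarrow> y \<in> lattice \<eta> n \<Longrightarrow> y' \<in> lattice \<eta> n \<Longrightarrow> y \<noteq> y' \<Longrightarrow> c1 * \<eta> \<le> norm (y - y')"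
    using lattice_separated by blast
  obtain c2 where c2: "0 < c2"
    "\<And>x y e. norm x \<le> R1 \<Longrightarrow> norm y \<le> R1 \<Longrightarrow> 0 < e \<Longrightarrow> e \<le> 1 \<Longrightarrow> e / 2 \<le> d x y \<Longrightarrow> c2 * e ^ \<kappa> \<le> norm (x - y)"
    using norm_separated_of_d[of R1] by blast
  define c where "c = min c2 (c1 * r0 / \<Lambda>)"
  have c: "0 < c" "c \<le> c2" "c \<le> c1 * r0 / \<Lambda>"
    using c1(1) c2(1) r0 \<Lambda>(1) by (auto simp: c_def)
  define N where "N = 2 * (K * R1) * (2 * basis_norm / c) + 2"
  have "2 \<le> N"
    unfolding N_def using K(1) \<open>0 \<le> R1\<close> basis_norm_pos c(1) by simp
  show ?thesis
  proof (rule that[of "N ^ card B"])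
    show "0 < N ^ card B"
      using \<open>2 \<le> N\<close> by simp
    fix e :: real and X
    assume e: "0 < e" "e \<le> 1" and X: "X \<subseteq> big_box R" "finite X"
      and sep: "\<And>x y. x \<in> X \<Longrightarrow> y \<in> X \<Longrightarrow> x \<noteq> y \<Longrightarrow> e \<le> d x y"
    \<comment> \<open>The mesh is the same in all directions, but direction \<open>b\<close> gets
      about \<open>e ^ wt b / e ^ \<kappa>\<close> points, and at least one. The lattice thus lies
      in the dilate by \<open>e\<close> of a box of size \<open>r0\<close>, on which
      \<open>d 0\<close> is below 1/4.\<close>
    define \<eta> where "\<eta> = r0 * e ^ \<kappa>"
    have \<eta>: "0 < \<eta>"
      using r0 e by (simp add: \<eta>_def)
    define n where "n b = nat \<lceil>e ^ wt b / e ^ \<kappa>\<rceil>" for b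
    have n: "real (n b) - 1 \<le> e ^ wt b / e ^ \<kappa>" "e ^ wt b / e ^ \<kappa> \<le> real (n b)" for b
    proof -
      have "0 \<le> e ^ wt b / e ^ \<kappa>"
        using e by simp
      then show "real (n b) - 1 \<le> e ^ wt b / e ^ \<kappa>" "e ^ wt b / e ^ \<kappa> \<le> real (n b)"
        unfolding n_def by linarith+
    qed
    let ?L = "lattice \<eta> n"
    have L_d: "d 0 z \<le> e / 4" if z: "z \<in> ?L" for z
    proof -
      let ?u = "dil (1 / e) z"
      have zB: "z \<in> span B"
        using lattice_mem(1)[OF z \<eta>] .
      have "d 0 ?u < 1 / 4"
      proof (rule small)
        show "?u \<in> span B"
          using zB by (rule dil_mem)
        fix b assume b: "b \<in> B"
        have "coord b z \<le> \<eta> * (e ^ wt b / e ^ \<kappa>)"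
          using lattice_mem(3)[OF z \<eta> b] mult_left_mono[OF n(1)[of b], of \<eta>] \<eta> by simp
        also have "\<dots> = r0 * e ^ wt b"
          using e by (simp add: \<eta>_def)
        finally have "\<bar>coord b z\<bar> \<le> r0 * e ^ wt b"
          using lattice_mem(2)[OF z \<eta> b] by simp
        then show "\<bar>coord b ?u\<bar> \<le> r0"
          using e by (simp add: coord_dil[OF zB b] abs_mult power_divide pos_divide_le_eq)
      qed
      then have "d 0 z / e < 1 / 4"
        using e by (simp add: d_zero_dil)
      then show ?thesis
        using e by (simp add: field_simps)
    qed
    have X_d: "x \<in> span B" "d 0 x \<le> max M 0" if "x \<in> X" for x
    proof -
      have x: "x \<in> span B" "\<And>b. b \<in> B \<Longrightarrow> \<bar>coord b x\<bar> \<le> R"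
        using that X(1) by (auto simp: big_box_def)
      then show "x \<in> span B"
        by simp
      have "norm x \<le> R * basis_norm"
        using x assms by (intro norm_le_coords)
      from M[OF this] show "d 0 x \<le> max M 0"
        by simp
    qed
    have prod_norm: "norm (x \<cdot> z) \<le> R1" if "x \<in> X" "z \<in> ?L" for x z
      using X_d(2)[OF that(1)] L_d[OF that(2)] d_zero_mul[of x z] e by (intro R1) simp
    have x_norm: "norm (- x) \<le> R1" if "x \<in> X" for x
      using R1[of x] X_d(2)[OF that] by simp
    have z_norm: "norm z \<le> R1" if "z \<in> ?L" for z
      using R1[of z] L_d[OF that] e by simp
    define f where "f = (\<lambda>(x, z). x \<cdot> z)"
    have f_sep: "c * e ^ \<kappa> \<le> norm (f q - f q')" if q: "q \<in> X \<times> ?L" "q' \<in> X \<times> ?L" "q \<noteq> q'" for q q'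
    proof -
      obtain x z x' z' where eq: "q = (x, z)" "q' = (x', z')"
        by (cases q; cases q')
      have mem: "x \<in> X" "z \<in> ?L" "x' \<in> X" "z' \<in> ?L"
        using q eq by auto
      \<comment> \<open>With a common centre, separation comes from the lattice and the Lipschitz
        bound for translation by \<open>- x\<close>. With different centres, two moves of at most
        \<open>e / 4\<close> leave distance \<open>e / 2\<close>, which
        \<open>norm_separated_of_d\<close> converts into norm.\<close>
      show ?thesis
      proof (cases "x = x'")
        case True
        then have "c1 * \<eta> \<le> norm (z - z')"
          using c1(2)[OF \<eta> mem(2,4)] q(3) eq by simp
        also have "z - z' = - x \<cdot> (x \<cdot> z) - - x \<cdot> (x \<cdot> z')"
          by simp
        also have "norm \<dots> \<le> \<Lambda> * norm (x \<cdot> z - x \<cdot> z')"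
          using prod_norm x_norm mem True by (intro \<Lambda>(2)) auto
        finally have "c1 * \<eta> / \<Lambda> \<le> norm (x \<cdot> z - x \<cdot> z')"
          using \<Lambda>(1) by (simp add: field_simps)
        moreover have "c * e ^ \<kappa> \<le> c1 * r0 / \<Lambda> * e ^ \<kappa>"
          using c(3) e by (intro mult_right_mono) auto
        ultimately show ?thesis
          using True by (simp add: f_def eq \<eta>_def)
      next
        case False
        have "d x (x \<cdot> z) \<le> e / 4" "d x' (x' \<cdot> z') \<le> e / 4"
          using L_d mem left_invariant[of x 0 z] left_invariant[of x' 0 z'] by simp_all
        then have "e / 2 \<le> d (x \<cdot> z) (x' \<cdot> z')"
          using sep[OF mem(1,3) False] triangle[of x "x \<cdot> z" x'] triangle[of "x \<cdot> z" "x' \<cdot> z'" x']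
            commute[of x' "x' \<cdot> z'"] by simp
        then have "c2 * e ^ \<kappa> \<le> norm (x \<cdot> z - x' \<cdot> z')"
          using prod_norm mem e by (intro c2(2)) auto
        moreover have "c * e ^ \<kappa> \<le> c2 * e ^ \<kappa>"
          using c(2) e by (intro mult_right_mono) auto
        ultimately show ?thesis
          by (simp add: f_def eq)
      qed
    qed
    have ce: "0 < c * e ^ \<kappa>"
      using c(1) e by simp
    have "inj_on f (X \<times> ?L)"
    proof (rule inj_onI, rule ccontr)
      fix q q' assume q: "q \<in> X \<times> ?L" "q' \<in> X \<times> ?L" "f q = f q'" "q \<noteq> q'"
      show False
        using f_sep[OF q(1,2,4)] q(3) ce by simp
    qed
    then have "card (f ` (X \<times> ?L)) = card X * card ?L"
      by (simp add: card_image card_cartesian_product)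
    moreover have "real (card (f ` (X \<times> ?L))) \<le> (\<Prod>b\<in>B. 2 * (K * R1) * (2 * basis_norm / (c * e ^ \<kappa>)) + 2)"
    proof (rule separated_card_le(2)[OF _ _ _ ce])
      show "0 \<le> K * R1"
        using K(1) \<open>0 \<le> R1\<close> by simp
      show "f ` (X \<times> ?L) \<subseteq> span B"
        using X_d(1) lattice_mem(1)[OF _ \<eta>] mul_closed by (auto simp: f_def)
      show "\<bar>coord b p\<bar> \<le> K * R1" if "p \<in> f ` (X \<times> ?L)" "b \<in> B" for p b
      proof -
        have "norm p \<le> R1"
          using that(1) prod_norm by (auto simp: f_def)
        then show ?thesis
          using K(2)[OF that(2), of p] K(1) by (meson mult_left_mono less_imp_le order_trans)
      qed
      show "c * e ^ \<kappa> \<le> norm (p - q)" if "p \<in> f ` (X \<times> ?L)" "q \<in> f ` (X \<times> ?L)" "p \<noteq> q" for p q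
        using that f_sep by blast
    qed
    ultimately have "real (card X) * real (card ?L) \<le> (\<Prod>b\<in>B. 2 * (K * R1) * (2 * basis_norm / (c * e ^ \<kappa>)) + 2)"
      by simp
    also have "\<dots> \<le> (\<Prod>b\<in>B. N * (1 / e ^ \<kappa>))"
    proof (intro prod_mono conjI)
      show "0 \<le> 2 * (K * R1) * (2 * basis_norm / (c * e ^ \<kappa>)) + 2"
        using K(1) \<open>0 \<le> R1\<close> basis_norm_pos ce by simp
      have "1 \<le> 1 / e ^ \<kappa>"
        using e by (simp add: power_le_one)
      moreover have "2 * (K * R1) * (2 * basis_norm / (c * e ^ \<kappa>)) = 2 * (K * R1) * (2 * basis_norm / c) * (1 / e ^ \<kappa>)"
        by simp
      ultimately show "2 * (K * R1) * (2 * basis_norm / (c * e ^ \<kappa>)) + 2 \<le> N * (1 / e ^ \<kappa>)"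
        by (simp only: N_def distrib_right)
    qed
    also have "\<dots> = N ^ card B * (1 / e ^ \<kappa>) ^ card B"
      by (simp only: prod_constant power_mult_distrib)
    finally have 1: "real (card X) * real (card ?L) \<le> N ^ card B * (1 / e ^ \<kappa>) ^ card B" .
    \<comment> \<open>The product set is counted from below here and was counted from above in 1.
      The powers of \<open>1 / e ^ \<kappa>\<close> cancel, which leaves a bound that does not
      depend on \<open>e\<close>.\<close>
    have "e ^ hdim * (1 / e ^ \<kappa>) ^ card B = (\<Prod>b\<in>B. e ^ wt b / e ^ \<kappa>)"
      by (simp add: power_sum prod_dividef power_divide)
    also have "\<dots> \<le> (\<Prod>b\<in>B. real (n b))"
      using n(2) e by (intro prod_mono) auto
    also have "\<dots> = real (card ?L)"
      by (simp add: card_lattice(2)[OF \<eta>])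
    finally have "real (card X) * (e ^ hdim * (1 / e ^ \<kappa>) ^ card B) \<le> real (card X) * real (card ?L)"
      by (intro mult_left_mono) auto
    with 1 have "(real (card X) * e ^ hdim) * (1 / e ^ \<kappa>) ^ card B \<le> N ^ card B * (1 / e ^ \<kappa>) ^ card B"
      by (simp add: mult_ac)
    then show "real (card X) * e ^ hdim \<le> N ^ card B"
      by (rule mult_right_le_imp_le) (use e in simp)
  qed
qed

text \<open>An \<open>e\<close>-separated subset of largest cardinality, which exists by
  \<open>separated_set_card\<close>, is an \<open>e\<close>-net.\<close>

lemma big_box_cover:
  assumes "0 \<le> R"
  obtains C where "0 < C"
    "\<And>e. 0 < e \<Longrightarrow> e \<le> 1 \<Longrightarrow> \<exists>X. finite X \<and> big_box R \<subseteq> (\<Union>x\<in>X. cl_ball d x e) \<and> real (card X) * e ^ hdim \<le> C"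
proof -
  obtain C where C: "0 < C"
    "\<And>e X. 0 < e \<Longrightarrow> e \<le> 1 \<Longrightarrow> X \<subseteq> big_box R \<Longrightarrow> finite X \<Longrightarrow> (\<And>x y. x \<in> X \<Longrightarrow> y \<in> X \<Longrightarrow> x \<noteq> y \<Longrightarrow> e \<le> d x y) \<Longrightarrow>
      real (card X) * e ^ hdim \<le> C"
    using separated_set_card[OF assms] by blast
  have "\<exists>X. finite X \<and> big_box R \<subseteq> (\<Union>x\<in>X. cl_ball d x e) \<and> real (card X) * e ^ hdim \<le> C"
    if e: "0 < e" "e \<le> 1" for e
  proof -
    let ?P = "\<lambda>X. X \<subseteq> big_box R \<and> finite X \<and> (\<forall>x\<in>X. \<forall>y\<in>X. x \<noteq> y \<longrightarrow> e \<le> d x y)"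
    have bound: "card X < Suc (nat \<lceil>C / e ^ hdim\<rceil>)" if "?P X" for X
    proof -
      have "real (card X) * e ^ hdim \<le> C"
        using that e by (intro C(2)) auto
      then have "real (card X) \<le> C / e ^ hdim"
        using e by (simp add: pos_le_divide_eq)
      then show ?thesis
        by linarith
    qed
    have "?P {}"
      by simp
    then obtain X where X: "?P X" "\<And>Y. ?P Y \<Longrightarrow> card Y \<le> card X"
      using ex_has_greatest_nat[of ?P "{}" card "Suc (nat \<lceil>C / e ^ hdim\<rceil>)"] bound by blast
    have "big_box R \<subseteq> (\<Union>x\<in>X. cl_ball d x e)"
    proof
      fix y assume y: "y \<in> big_box R"
      show "y \<in> (\<Union>x\<in>X. cl_ball d x e)"
      proof (rule ccontr)
        assume no: "y \<notin> (\<Union>x\<in>X. cl_ball d x e)"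
        then have far: "e \<le> d x y" if "x \<in> X" for x
          using that by (force simp: cl_ball_eq)
        have "y \<notin> X"
          using no e by (auto simp: cl_ball_eq)
        moreover have "?P (insert y X)"
          using X(1) y far commute by auto
        ultimately show False
          using X(2)[of "insert y X"] X(1) by simp
      qed
    qed
    moreover have "real (card X) * e ^ hdim \<le> C"
      using X(1) e by (intro C(2)) auto
    ultimately show ?thesis
      using X(1) by blast
  qed
  with C(1) show ?thesis
    using that by blast
qed

text \<open>Boxes of integer size exhaust the span. Covering one of them by balls of radius
  \<open>e\<close> costs at most a constant times \<open>e powr (s - real hdim)\<close>, so each box
  may have its own radius, with costs summing to at most \<epsilon>.\<close>

lemma hausdorff_measure_zero:
  assumes s: "real hdim < s"
  shows "hausdorff_measure d s (span B) = 0"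
proof -
  have s0: "0 < s"
    using s of_nat_0_le_iff[of hdim] by linarith
  have "(INF E\<in>{E :: nat \<Rightarrow> 'a set. span B \<subseteq> (\<Union>j. E j) \<and> (\<forall>j. diameter_wrt d (E j) \<le> ennreal \<delta>)}.
        \<Sum>j. ennreal (enn2real (diameter_wrt d (E j)) powr s)) \<le> 0" (is "?I \<le> 0") if \<delta>: "0 < \<delta>" for \<delta> :: real
  proof (rule ennreal_le_epsilon)
    fix \<epsilon> :: real assume \<epsilon>: "0 < \<epsilon>"
    have "\<exists>e X. 0 < e \<and> 2 * e \<le> \<delta> \<and> finite X \<and> big_box (real n) \<subseteq> (\<Union>x\<in>X. cl_ball d x e) \<and>
        real (card X) * (2 * e) powr s \<le> \<epsilon> * (1 / 2) ^ Suc n" for n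
    proof -
      obtain C where C: "0 < C"
        "\<And>e. 0 < e \<Longrightarrow> e \<le> 1 \<Longrightarrow> \<exists>X. finite X \<and> big_box (real n) \<subseteq> (\<Union>x\<in>X. cl_ball d x e) \<and> real (card X) * e ^ hdim \<le> C"
        using big_box_cover[of "real n"] by auto
      have "((\<lambda>e. C * 2 powr s * e powr (s - real hdim)) \<longlongrightarrow> C * 2 powr s * 0 powr (s - real hdim)) (at_right 0)"
        using s by (intro tendsto_mult tendsto_const tendsto_powr' tendsto_ident_at)
          (auto simp: eventually_at_filter)
      then have "\<forall>\<^sub>F e in at_right 0. C * 2 powr s * e powr (s - real hdim) < \<epsilon> * (1 / 2) ^ Suc n"
        using \<epsilon> s by (intro order_tendstoD(2)) auto
      moreover have "\<forall>\<^sub>F e in at_right (0::real). 0 < e \<and> e < min 1 (\<delta> / 2)"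
        using \<delta> by (auto simp: eventually_at_right_field intro!: exI[of _ "min 1 (\<delta> / 2)"])
      ultimately have "\<forall>\<^sub>F e in at_right 0. C * 2 powr s * e powr (s - real hdim) < \<epsilon> * (1 / 2) ^ Suc n \<and> 0 < e \<and> e < min 1 (\<delta> / 2)"
        by eventually_elim auto
      from eventually_happens'[OF trivial_limit_at_right_real this]
      obtain e where e: "C * 2 powr s * e powr (s - real hdim) < \<epsilon> * (1 / 2) ^ Suc n" "0 < e" "e < min 1 (\<delta> / 2)"
        by blast
      then obtain X where X: "finite X" "big_box (real n) \<subseteq> (\<Union>x\<in>X. cl_ball d x e)" "real (card X) * e ^ hdim \<le> C"
        using C(2)[of e] by auto
      have "(2 * e) powr s = e ^ hdim * (2 powr s * e powr (s - real hdim))"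
      proof -
        have "(2 * e) powr s = 2 powr s * e powr s"
          using e(2) by (simp add: powr_mult)
        moreover have "e powr (s - real hdim) = e powr s / e ^ hdim"
          by (simp only: powr_diff powr_realpow[OF e(2)])
        ultimately show ?thesis
          using e(2) by simp
      qed
      then have "real (card X) * (2 * e) powr s = (real (card X) * e ^ hdim) * (2 powr s * e powr (s - real hdim))"
        by simp
      also have "\<dots> \<le> C * (2 powr s * e powr (s - real hdim))"
        using X(3) by (intro mult_right_mono) auto
      also have "\<dots> \<le> \<epsilon> * (1 / 2) ^ Suc n"
        using e(1) by simp
      finally show ?thesis
        using e X by (intro exI[of _ e] exI[of _ X]) auto
    qed
    then obtain e X where eX: "\<And>n. 0 < e n" "\<And>n. 2 * e n \<le> \<delta>" "\<And>n. finite (X n)"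
      "\<And>n. big_box (real n) \<subseteq> (\<Union>x\<in>X n. cl_ball d x (e n))"
      "\<And>n. real (card (X n)) * (2 * e n) powr s \<le> \<epsilon> * (1 / 2) ^ Suc n"
      by metis
    define F where "F = (\<lambda>(n, i). if i < card (X n) then cl_ball d (from_nat_into (X n) i) (e n) else {})"
    define E where "E j = F (prod_decode j)" for j
    have diam_F: "diameter_wrt d (F (n, i)) \<le> ennreal (if i < card (X n) then 2 * e n else 0)" for n i
      using diameter_cl_ball by (simp add: F_def) (simp add: diameter_wrt_def bot_ennreal)
    have "E \<in> {E :: nat \<Rightarrow> 'a set. span B \<subseteq> (\<Union>j. E j) \<and> (\<forall>j. diameter_wrt d (E j) \<le> ennreal \<delta>)}"
    proof (intro CollectI conjI subsetI allI)
      fix y assume y: "y \<in> span B"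
      obtain K where K: "0 < K" "\<And>b x. b \<in> B \<Longrightarrow> \<bar>coord b x\<bar> \<le> K * norm x"
        using coord_bound by blast
      obtain n where "K * norm y \<le> real n"
        using real_arch_simple by blast
      then have "y \<in> big_box (real n)"
        using y K(2)[of _ y] by (force simp: big_box_def)
      then obtain x where x: "x \<in> X n" "y \<in> cl_ball d x (e n)"
        using eX(4) by blast
      have "x \<in> from_nat_into (X n) ` {..<card (X n)}"
        using x(1) bij_betw_from_nat_into_finite[OF eX(3)[of n]] by (simp add: bij_betw_def)
      then obtain i where "i < card (X n)" "x = from_nat_into (X n) i"
        by blast
      then have "y \<in> E (prod_encode (n, i))"
        using x(2) by (simp add: E_def F_def)
      then show "y \<in> (\<Union>j. E j)"
        by blast
    next
      fix j
      obtain n i where ni: "prod_decode j = (n, i)"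
        by fastforce
      have "(if i < card (X n) then 2 * e n else 0) \<le> \<delta>"
        using eX(2)[of n] \<delta> by auto
      then show "diameter_wrt d (E j) \<le> ennreal \<delta>"
        using diam_F[of n i] unfolding E_def ni by (meson ennreal_leI order_trans)
    qed
    then have "?I \<le> (\<Sum>j. ennreal (enn2real (diameter_wrt d (E j)) powr s))"
      by (rule INF_lower)
    also have "\<dots> = (\<Sum>n. \<Sum>i. ennreal (enn2real (diameter_wrt d (F (n, i))) powr s))"
      unfolding E_def
      by (rule suminf_ennreal_2dimen[where f = "\<lambda>q. ennreal (enn2real (diameter_wrt d (F q)) powr s)"]) simp
    also have "\<dots> \<le> (\<Sum>n. ennreal (\<epsilon> * (1 / 2) ^ Suc n))"
    proof (intro suminf_le summableI)
      fix n
      let ?g = "\<lambda>i. ennreal (if i < card (X n) then (2 * e n) powr s else 0)"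
      have "ennreal (enn2real (diameter_wrt d (F (n, i))) powr s) \<le> ?g i" for i
      proof -
        have "enn2real (diameter_wrt d (F (n, i))) \<le> (if i < card (X n) then 2 * e n else 0)"
          using diam_F[of i n] diam_F[of n i] eX(1)[of n] by (intro enn2real_leI) (auto split: if_splits)
        then have "enn2real (diameter_wrt d (F (n, i))) powr s \<le> (if i < card (X n) then 2 * e n else 0) powr s"
          using s0 by (intro powr_mono2) auto
        then show ?thesis
          by (intro ennreal_leI) (auto split: if_splits)
      qed
      then have "(\<Sum>i. ennreal (enn2real (diameter_wrt d (F (n, i))) powr s)) \<le> (\<Sum>i. ?g i)"
        by (intro suminf_le summableI)
      also have "\<dots> = (\<Sum>i<card (X n). ?g i)"
        by (rule suminf_finite) auto
      also have "\<dots> = ennreal (real (card (X n)) * (2 * e n) powr s)"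
        by (simp add: ennreal_of_nat_eq_real_of_nat ennreal_mult'')
      also have "\<dots> \<le> ennreal (\<epsilon> * (1 / 2) ^ Suc n)"
        by (intro ennreal_leI eX(5))
      finally show "(\<Sum>i. ennreal (enn2real (diameter_wrt d (F (n, i))) powr s)) \<le> ennreal (\<epsilon> * (1 / 2) ^ Suc n)" .
    qed
    also have "\<dots> = ennreal \<epsilon>"
    proof (rule suminf_ennreal_eq)
      show "(\<lambda>n. \<epsilon> * (1 / 2) ^ Suc n) sums \<epsilon>"
        using sums_mult[OF power_half_series, of \<epsilon>] by simp
    qed (use \<epsilon> in simp)
    finally show "?I \<le> 0 + ennreal \<epsilon>"
      by simp
  qed
  then show ?thesis
    unfolding hausdorff_measure_def by (auto intro!: antisym SUP_least)
qed

theorem hausdorff_dim_span: "hausdorff_dim d (span B) = of_nat hdim"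
proof (rule antisym)
  show "hausdorff_dim d (span B) \<le> of_nat hdim"
  proof (rule ennreal_le_epsilon)
    fix e :: real assume "0 < e"
    then have "0 < real hdim + e" "real hdim < real hdim + e"
      using of_nat_0_le_iff[of hdim] by linarith+
    then have "hausdorff_dim d (span B) \<le> ennreal (real hdim + e)"
      unfolding hausdorff_dim_def by (intro INF_lower CollectI conjI hausdorff_measure_zero)
    also have "\<dots> = of_nat hdim + ennreal e"
      using \<open>0 < e\<close> by (simp add: ennreal_of_nat_eq_real_of_nat del: of_nat_sum)
    finally show "hausdorff_dim d (span B) \<le> of_nat hdim + ennreal e" .
  qed
  show "of_nat hdim \<le> hausdorff_dim d (span B)"
    unfolding hausdorff_dim_def
  proof (rule INF_greatest)
    fix s assume "s \<in> {s. 0 < s \<and> hausdorff_measure d s (span B) = 0}"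
    then have "real hdim < s"
      using hausdorff_measure_pos[of s] by (auto simp: not_le[symmetric])
    then show "of_nat hdim \<le> ennreal s"
      by (simp add: ennreal_of_nat_eq_real_of_nat ennreal_leI del: of_nat_sum)
  qed
qed

end

section \<open>Homogeneous subgroups of every dimension\<close>

lemma Ck_on_const: "Ck_on k (\<lambda>x. c) S"
proof (induction k arbitrary: c)
  case (Suc k)
  then show ?case
    by (auto intro!: exI[of _ "\<lambda>x v. 0"])
qed simp

lemma smooth_on_ident: "smooth_on (\<lambda>x. x) S"
  unfolding smooth_on_def
proof
  show "Ck_on k (\<lambda>x. x) S" for k
  proof (cases k)
    case (Suc n)
    then show ?thesis
      using Ck_on_const by (auto intro!: exI[of _ "\<lambda>x v. v"])
  qed simp
qed

lemma embedded_submanifold_subspace: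
  fixes S :: "'a::euclidean_space set"
  assumes "subspace S"
  shows "embedded_submanifold S"
  unfolding embedded_submanifold_def
proof (intro exI[of _ "dim S"] ballI)
  fix p assume "p \<in> S"
  show "\<exists>U W \<psi> g T. open U \<and> p \<in> U \<and> open W \<and> homeomorphism U W \<psi> g \<and> smooth_on \<psi> U \<and> smooth_on g W \<and>
      subspace (T :: 'a set) \<and> dim T = dim S \<and> \<psi> ` (S \<inter> U) = T \<inter> W"
    by (rule exI[of _ UNIV], rule exI[of _ UNIV], rule exI[of _ "\<lambda>x. x"], rule exI[of _ "\<lambda>x. x"], rule exI[of _ S])
      (use assms smooth_on_ident in \<open>simp add: homeomorphism_def\<close>)
qed

section \<open>Bases adapted to the layers\<close>

context carnot_group
begin

text \<open>Each layer is spanned by brackets with the preceding one, so a trivial layer would make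
  all later layers trivial, including the last.\<close>

lemma layer_nonzero:
  assumes "i \<in> {1..\<kappa>}"
  shows "V i \<noteq> {0}"
proof
  assume zero: "V i = {0}"
  have "i + n \<le> \<kappa> \<Longrightarrow> V (i + n) = {0}" for n
  proof (induction n)
    case (Suc n)
    then have "V (i + Suc n) = bracket_span G (V 1) (V (i + n))"
      using bracket_layer[of "i + n"] assms by simp
    also have "\<dots> = {0}"
    proof -
      have "V (i + n) = {0}"
        using Suc by simp
      then have "{lie_bracket G u v | u v. u \<in> V 1 \<and> v \<in> V (i + n)} \<subseteq> {0}"
        by (auto simp: lie_bracket_eq linear_0[OF second_deriv_linear_right])
      then have "span {lie_bracket G u v | u v. u \<in> V 1 \<and> v \<in> V (i + n)} \<subseteq> {0}"
        by (intro span_minimal) auto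
      then show ?thesis
        unfolding bracket_span_def using span_zero by blast
    qed
    finally show ?case .
  qed (simp add: zero)
  from this[of "\<kappa> - i"] show False
    using last_layer assms by simp
qed

lemma layer_bases:
  obtains Bs where
    "\<And>i. i \<in> {1..\<kappa>} \<Longrightarrow> Bs i \<subseteq> V i \<and> independent (Bs i) \<and> V i \<subseteq> span (Bs i) \<and> card (Bs i) = dim (V i) \<and> finite (Bs i)"
proof -
  have "\<exists>B. B \<subseteq> V i \<and> independent B \<and> V i \<subseteq> span B \<and> card B = dim (V i) \<and> finite B" for i
    using basis_exists[of "V i"] independent_imp_finite by metis
  then show ?thesis
    using that by metis
qed

text \<open>Projection to a layer isolates the part of a linear relation that is carried by the
  basis of that layer.\<close>

lemma independent_graded_union:
  assumes Bs: "\<And>i. i \<in> {1..\<kappa>} \<Longrightarrow> Bs i \<subseteq> V i \<and> independent (Bs i) \<and> finite (Bs i)"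
  shows "independent (\<Union>i\<in>{1..\<kappa>}. Bs i)"
    and "i \<in> {1..\<kappa>} \<Longrightarrow> j \<in> {1..\<kappa>} \<Longrightarrow> i \<noteq> j \<Longrightarrow> Bs i \<inter> Bs j = {}"
proof -
  have ne0: "x \<noteq> 0" if "x \<in> Bs i" "i \<in> {1..\<kappa>}" for x i
    using that Bs[of i] dependent_zero[of "Bs i"] by blast
  show disj: "Bs i \<inter> Bs j = {}" if ij: "i \<in> {1..\<kappa>}" "j \<in> {1..\<kappa>}" "i \<noteq> j" for i j
  proof (rule ccontr)
    assume "Bs i \<inter> Bs j \<noteq> {}"
    then obtain x where x: "x \<in> Bs i" "x \<in> Bs j"
      by blast
    then have "proj i x = x" "proj i x = 0"
      using proj_layer[of x i i] proj_layer[of x j i] Bs[of i] Bs[of j] ij by auto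
    then show False
      using ne0[OF x(1) ij(1)] by simp
  qed
  let ?E = "\<Union>i\<in>{1..\<kappa>}. Bs i"
  have fin: "finite ?E"
    using Bs by auto
  show "independent ?E"
  proof (rule independent_if_scalars_zero[OF fin])
    fix f x assume sum0: "(\<Sum>x\<in>?E. f x *\<^sub>R x) = 0" and "x \<in> ?E"
    then obtain i where i: "i \<in> {1..\<kappa>}" "x \<in> Bs i"
      by blast
    have pr: "proj i y = (if y \<in> Bs i then y else 0)" if y: "y \<in> ?E" for y
    proof -
      obtain j where j: "j \<in> {1..\<kappa>}" "y \<in> Bs j"
        using y by blast
      show ?thesis
      proof (cases "i = j")
        case True
        then show ?thesis
          using j Bs[of j] proj_layer[of y j i] i(1) by auto
      next
        case False
        then have "y \<notin> Bs i"
          using disj[OF i(1) j(1)] j(2) by blast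
        then show ?thesis
          using False j Bs[of j] proj_layer[of y j i] i(1) by auto
      qed
    qed
    have "0 = proj i (\<Sum>x\<in>?E. f x *\<^sub>R x)"
      using sum0 linear_0[OF linear_proj[OF i(1)]] by simp
    also have "\<dots> = (\<Sum>x\<in>?E. f x *\<^sub>R proj i x)"
      by (simp add: linear_sum[OF linear_proj[OF i(1)]] linear_scale[OF linear_proj[OF i(1)]])
    also have "\<dots> = (\<Sum>x\<in>?E. if x \<in> Bs i then f x *\<^sub>R x else 0)"
      by (intro sum.cong refl) (simp add: pr)
    also have "\<dots> = (\<Sum>x\<in>?E \<inter> Bs i. f x *\<^sub>R x)"
      by (rule sum.inter_restrict[OF fin, symmetric])
    also have "?E \<inter> Bs i = Bs i"
      using i(1) by blast
    finally have "(\<Sum>x\<in>Bs i. f x *\<^sub>R x) = 0"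
      by simp
    then show "f x = 0"
      using independentD[of "Bs i" "Bs i" f x] Bs[OF i(1)] i(2) by simp
  qed
qed

end

context homogeneous_distance
begin

text \<open>\<open>k\<close> is the least index above which the layers weigh less than
  \<open>h\<close>. By minimality the missing weight is at most \<open>k * dim (V k)\<close>;
  \<open>a\<close> and \<open>j\<close> are its quotient and remainder on division by
  \<open>k\<close>.\<close>

lemma homogeneous_dim_decompose:
  assumes "1 \<le> h" "h \<le> homogeneous_dim \<kappa> V"
  obtains k a j where "k \<in> {1..\<kappa>}" "a \<le> dim (V k)" "j < k"
    "h = j + k * a + (\<Sum>i\<in>{k<..\<kappa>}. i * dim (V i))"
proof -
  define T where "T k = (\<Sum>i\<in>{k<..\<kappa>}. i * dim (V i))" for k
  define k where "k = (LEAST k. T k < h)"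
  have top: "T \<kappa> < h"
    using assms(1) by (simp add: T_def)
  then have k: "T k < h" "k \<le> \<kappa>"
    unfolding k_def by (rule LeastI, rule Least_le)
  have "T 0 = homogeneous_dim \<kappa> V"
    unfolding T_def homogeneous_dim_def by (intro sum.cong) auto
  then have "k \<noteq> 0"
    using k(1) assms(2) by (metis leD)
  then obtain m where m: "k = Suc m"
    using not0_implies_Suc by blast
  then have "\<not> T m < h"
    using not_less_Least[of m "\<lambda>k. T k < h"] by (simp add: k_def)
  moreover have "T m = k * dim (V k) + T k"
  proof -
    have "{m<..\<kappa>} = insert k {k<..\<kappa>}"
      using m k(2) by auto
    then show ?thesis
      by (simp add: T_def)
  qed
  ultimately have le: "h - T k \<le> k * dim (V k)"
    by simp
  show ?thesis
  proof (rule that)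
    show "k \<in> {1..\<kappa>}"
      using k(2) \<open>k \<noteq> 0\<close> by simp
    show "(h - T k) div k \<le> dim (V k)"
      using div_le_mono[OF le, of k] \<open>k \<noteq> 0\<close> by simp
    show "(h - T k) mod k < k"
      using \<open>k \<noteq> 0\<close> by simp
    show "h = (h - T k) mod k + k * ((h - T k) div k) + (\<Sum>i\<in>{k<..\<kappa>}. i * dim (V i))"
      using k(1) mod_mult_div_eq[of "h - T k" k] unfolding T_def[symmetric] by linarith
  qed
qed

theorem Gr_nonempty:
  assumes h: "1 \<le> h" "h \<le> homogeneous_dim \<kappa> V"
  shows "Gr G \<kappa> V d h \<noteq> {}"
proof -
  obtain k a j where k: "k \<in> {1..\<kappa>}" and a: "a \<le> dim (V k)" and j: "j < k"
    and h_eq: "h = j + k * a + (\<Sum>i\<in>{k<..\<kappa>}. i * dim (V i))"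
    using homogeneous_dim_decompose[OF h] by blast
  obtain Bs where Bs: "\<And>i. i \<in> {1..\<kappa>} \<Longrightarrow>
      Bs i \<subseteq> V i \<and> independent (Bs i) \<and> V i \<subseteq> span (Bs i) \<and> card (Bs i) = dim (V i) \<and> finite (Bs i)"
    using layer_bases by blast
  have disj: "i \<in> {1..\<kappa>} \<Longrightarrow> j \<in> {1..\<kappa>} \<Longrightarrow> i \<noteq> j \<Longrightarrow> Bs i \<inter> Bs j = {}" for i j
    using independent_graded_union(2)[of Bs i j] Bs by blast
  have indep: "independent (\<Union>i\<in>{1..\<kappa>}. Bs i)"
    using independent_graded_union(1)[of Bs] Bs by blast
  define wt where "wt b = (THE i. i \<in> {1..\<kappa>} \<and> b \<in> Bs i)" for b
  have wt_eq: "wt b = i" if "i \<in> {1..\<kappa>}" "b \<in> Bs i" for b i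
    unfolding wt_def using that disj by (intro the_equality) blast+
  obtain U where U: "U \<subseteq> Bs k" "card U = a"
    using a Bs[OF k] obtain_subset_with_card_n[of a "Bs k"] by metis
  have finU: "finite U"
    using U(1) Bs[OF k] finite_subset by blast
  \<comment> \<open>If the remainder \<open>j\<close> is 0 there is no line: \<open>X\<close> is
    empty and \<open>x = 0\<close>. Otherwise \<open>X\<close> consists of one basis vector of the
    layer \<open>j\<close>, which contributes the weight \<open>j\<close>.\<close>
  obtain X x where X: "X \<subseteq> {x}" "x \<in> span X" "X \<subseteq> (\<Union>i\<in>{1..<k}. Bs i)" "(\<Sum>b\<in>X. wt b) = j"
  proof (cases "j = 0")
    case True
    then show ?thesis
      using that[of "{}" 0] by simp
  next
    case False
    then have j1: "j \<in> {1..\<kappa>}"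
      using j k by auto
    have "Bs j \<noteq> {}"
    proof
      assume "Bs j = {}"
      then have "V j \<subseteq> {0}"
        using Bs[OF j1] by simp
      then show False
        using layer_nonzero[OF j1] subspace_0[OF layer_subspace[OF j1]] by blast
    qed
    then obtain x where x: "x \<in> Bs j"
      by blast
    show ?thesis
    proof (rule that)
      show "{x} \<subseteq> (\<Union>i\<in>{1..<k}. Bs i)"
        using x j False by (auto intro: bexI[of _ j])
      show "(\<Sum>b\<in>{x}. wt b) = j"
        using wt_eq[OF j1 x] by simp
    qed (auto intro: span_base)
  qed
  define C where "C = U \<union> (\<Union>i\<in>{k<..\<kappa>}. Bs i)"
  define B where "B = X \<union> C"
  have B_sub: "B \<subseteq> (\<Union>i\<in>{1..\<kappa>}. Bs i)"
    using X(3) U(1) k unfolding B_def C_def by fastforce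
  have fin: "finite (\<Union>i\<in>{1..\<kappa>}. Bs i)"
    using Bs by auto
  have B_mem: "\<exists>i\<in>{1..\<kappa>}. b \<in> Bs i" if "b \<in> B" for b
    using B_sub that by blast
  have C_filt: "C \<subseteq> filt k"
  proof -
    have "Bs i \<subseteq> filt k" if "i \<in> {k..\<kappa>}" for i
      using layer_filt[of i k] Bs[of i] that k by auto
    moreover have "C \<subseteq> (\<Union>i\<in>{k..\<kappa>}. Bs i)"
      using U(1) k unfolding C_def by fastforce
    ultimately show ?thesis
      by blast
  qed
  have dec: "\<exists>s u. y = s *\<^sub>R x + u \<and> u \<in> span B \<inter> filt k" if y: "y \<in> span B" for y
  proof -
    have "B \<subseteq> insert x C"
      using X(1) by (auto simp: B_def)
    then have "y \<in> span (insert x C)"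
      using subsetD[OF span_mono y] by blast
    then obtain s where s: "y - s *\<^sub>R x \<in> span C"
      by (auto simp: span_insert)
    have "span C \<subseteq> span B"
      by (rule span_mono) (simp add: B_def)
    moreover have "span C \<subseteq> filt k"
      using C_filt subspace_filt by (rule span_minimal)
    ultimately have "y - s *\<^sub>R x \<in> span B \<inter> filt k"
      using s by blast
    then show ?thesis
      by (intro exI[of _ s] exI[of _ "y - s *\<^sub>R x"]) simp
  qed
  have top: "filt (Suc k) \<subseteq> span B"
  proof
    fix v assume v: "v \<in> filt (Suc k)"
    have "id v \<in> span B"
    proof (rule filt_induct[OF v subspace_span _ linear_id])
      fix i v assume i: "i \<in> {1..\<kappa>}" "Suc k \<le> i" "v \<in> V i"
      then have "v \<in> span (Bs i)"
        using Bs by blast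
      moreover have "span (Bs i) \<subseteq> span B"
        using i by (intro span_mono) (auto simp: B_def C_def)
      ultimately show "id v \<in> span B"
        by auto
    qed
    then show "v \<in> span B"
      by simp
  qed
  have x: "x \<in> span B"
    using X(2) span_mono[of X B] by (auto simp: B_def)
  \<comment> \<open>Apart from the line of \<open>x\<close>, all generators lie in
    \<open>filt k\<close>, and all layers above \<open>k\<close> are present in full.\<close>
  have closed: "p \<cdot> q \<in> span B" if "p \<in> span B" "q \<in> span B" for p q
    using subspace_span x top dec that by (rule mul_closed_line_filt)
  interpret graded_subgroup G \<kappa> V d B wt
  proof
    show "finite B"
      using B_sub fin by (rule finite_subset)
    show "independent B"
      using indep B_sub by (rule independent_mono)
    show "wt b \<in> {1..\<kappa>}" "b \<in> V (wt b)" if "b \<in> B" for b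
      using B_mem[OF that] wt_eq Bs by blast+
  qed (rule closed)
  have "(\<Sum>b\<in>B. wt b) = h"
  proof -
    have "X \<inter> C = {}"
    proof -
      have "Bs i \<inter> Bs i' = {}" if "i \<in> {1..<k}" "i' \<in> {k..\<kappa>}" for i i'
        using that k by (intro disj) auto
      moreover have "C \<subseteq> (\<Union>i\<in>{k..\<kappa>}. Bs i)"
        using U(1) k unfolding C_def by fastforce
      ultimately show ?thesis
        using X(3) by blast
    qed
    moreover have "finite X" "finite C"
      using finite_B by (auto simp: B_def)
    ultimately have "(\<Sum>b\<in>B. wt b) = j + (\<Sum>b\<in>C. wt b)"
      unfolding B_def by (simp add: sum.union_disjoint X(4))
    also have "(\<Sum>b\<in>C. wt b) = (\<Sum>b\<in>U. wt b) + (\<Sum>b\<in>(\<Union>i\<in>{k<..\<kappa>}. Bs i). wt b)"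
      unfolding C_def
    proof (rule sum.union_disjoint[OF finU])
      show "finite (\<Union>i\<in>{k<..\<kappa>}. Bs i)"
        using Bs by auto
      have "Bs k \<inter> Bs i = {}" if "i \<in> {k<..\<kappa>}" for i
        using that k by (intro disj) auto
      then show "U \<inter> (\<Union>i\<in>{k<..\<kappa>}. Bs i) = {}"
        using U(1) by blast
    qed
    also have "(\<Sum>b\<in>U. wt b) = k * a"
    proof -
      have "(\<Sum>b\<in>U. wt b) = (\<Sum>b\<in>U. k)"
        using U(1) wt_eq[OF k] by (intro sum.cong) auto
      then show ?thesis
        using U(2) by simp
    qed
    also have "(\<Sum>b\<in>(\<Union>i\<in>{k<..\<kappa>}. Bs i). wt b) = (\<Sum>i\<in>{k<..\<kappa>}. \<Sum>b\<in>Bs i. wt b)"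
      using Bs disj by (intro sum.UNION_disjoint) auto
    also have "\<dots> = (\<Sum>i\<in>{k<..\<kappa>}. i * dim (V i))"
    proof (rule sum.cong)
      fix i assume "i \<in> {k<..\<kappa>}"
      then have i: "i \<in> {1..\<kappa>}"
        by auto
      have "(\<Sum>b\<in>Bs i. wt b) = (\<Sum>b\<in>Bs i. i)"
        using wt_eq[OF i] by (intro sum.cong) auto
      then show "(\<Sum>b\<in>Bs i. wt b) = i * dim (V i)"
        using Bs[OF i] by simp
    qed simp
    finally show ?thesis
      by (simp add: h_eq)
  qed
  then have "hausdorff_dim d (span B) = of_nat h"
    using hausdorff_dim_span by simp
  moreover have "homogeneous_subgroup G \<kappa> V (span B)"
    unfolding homogeneous_subgroup_def lie_subgroup_def
    using subgroup_of_subspace[OF subspace_span] mul_closed embedded_submanifold_subspace[OF subspace_span] dil_mem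
    by auto
  ultimately show ?thesis
    by (auto simp: Gr_def)
qed

end

theorem theorem1p4:
  fixes G :: "'a::euclidean_space monoid" and \<kappa> :: nat and V :: "nat \<Rightarrow> 'a set"
    and d :: "'a \<Rightarrow> 'a \<Rightarrow> real" and h :: nat and \<phi> :: "'a measure"
  assumes "carnot_group G \<kappa> V"
    and "homogeneous_distance G \<kappa> V d"
    and "1 \<le> h" and "h \<le> homogeneous_dim \<kappa> V"
    and "P_rectifiable G \<kappa> V d h \<phi>"
  shows "\<forall>\<alpha>>0. \<exists>(H :: nat \<Rightarrow> 'a set) (\<Gamma> :: nat \<Rightarrow> 'a set).
           (\<forall>i. H i \<in> Gr G \<kappa> V d h \<and> compact (\<Gamma> i) \<and> cone_set G d (H i) \<alpha> (\<Gamma> i)) \<and>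
           emeasure \<phi> (UNIV - (\<Union>i. \<Gamma> i)) = 0"
proof (intro allI impI)
  fix \<alpha> :: real assume "0 < \<alpha>"
  interpret homogeneous_distance G \<kappa> V d
    by (rule assms(2))
  show "\<exists>(H :: nat \<Rightarrow> 'a set) (\<Gamma> :: nat \<Rightarrow> 'a set).
           (\<forall>i. H i \<in> Gr G \<kappa> V d h \<and> compact (\<Gamma> i) \<and> cone_set G d (H i) \<alpha> (\<Gamma> i)) \<and>
           emeasure \<phi> (UNIV - (\<Union>i. \<Gamma> i)) = 0"
    using assms(3,5) Gr_nonempty[OF assms(3,4)] \<open>0 < \<alpha>\<close> by (rule P_rectifiable_cone_cover)
qed

end
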